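(* Assume that the forcing is uniformly bounded, $F:=\sup_{n\ge2}\|\vec{\mathbf f}^n\|<\infty$, and that $$0<\Delta t\le\frac{C_a^3}{536\,C_S^2C_{ct}^4C_{tr}^8}.$$ Then the solution of the BDF2 scheme is uniformly bounded for all time: there exist $\lambda_1\in(0,1)$ and $K>0$, depending only on $\Delta t$, the parameters and the domains (not on $n$, the initial data or the forcing), such that for all $n\ge0$ $$\|\vec{\mathbf u}^n\|^2\le K\Big(\lambda_1^n\big(\|\vec{\mathbf u}^0\|^2+\|\vec{\mathbf u}^1\|^2+\Delta t\|\nabla\vec{\mathbf u}^0\|^2+\Delta t\|\nabla\vec{\mathbf u}^1\|^2\big)+F^2\Big).$$
   Context: Let $d\in\{2,3\}$, $\Omega_f,\Omega_p\subset\mathbb R^d$ bounded Lipschitz domains with disjoint interiors sharing the interface $\Gamma=\partial\Omega_f\cap\partial\Omega_p$; $\mathbf n_f$ is the unit outward normal of $\Omega_f$ on $\Gamma$, $\boldsymbol\tau$ a unit tangent on $\Gamma$ (for $d=3$ the tangential term is summed over $d-1$ tangent vectors). Parameters: $\nu,g,S,\alpha_{BJ}>0$, a symmetric positive definite matrix $\mathbb K$ with smallest eigenvalue $K_{\min}>0$, and $\gamma_f,\gamma_p\ge0$. Spaces: $\mathbf H_f=\{\mathbf v\in H^1(\Omega_f)^d:\mathbf v=0\text{ on }\partial\Omega_f\setminus\Gamma\}$, $H_p=\{\psi\in H^1(\Omega_p):\psi=0\text{ on }\partial\Omega_p\setminus\Gamma\}$, $Q=L^2(\Omega_f)$, $\mathbf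 W=\mathbf H_f\times H_p$, elements written $\vec{\mathbf u}=(\mathbf u,\phi)$, $\vec{\mathbf v}=(\mathbf v,\psi)$. Norms: $\|\vec{\mathbf v}\|^2=\|\mathbf v\|^2_{L^2(\Omega_f)}+\|\psi\|^2_{L^2(\Omega_p)}$, $\|\nabla\vec{\mathbf v}\|^2=\|\nabla\mathbf v\|^2_{L^2(\Omega_f)}+\|\nabla\psi\|^2_{L^2(\Omega_p)}$, $\|\vec{\mathbf v}\|_\Gamma^2=\|\mathbf v\|_{L^2(\Gamma)}^2+\|\psi\|_{L^2(\Gamma)}^2$. Forms: $\langle\langle\vec{\mathbf u},\vec{\mathbf v}\rangle\rangle=(\mathbf u,\mathbf v)_{\Omega_f}+gS(\phi,\psi)_{\Omega_p}$, $\|\vec{\mathbf v}\|_S=\langle\langle\vec{\mathbf v},\vec{\mathbf v}\rangle\rangle^{1/2}$; $a(\vec{\mathbf u},\vec{\mathbf v})=\nu(\nabla\mathbf u,\nabla\mathbf v)_{\Omega_f}+g(\mathbb K\nabla\phi,\nabla\psi)_{\Omega_p}+\alpha_{BJ}(\mathbf u\cdot\boldsymbol\tau,\mathbf v\cdot\boldsymbol\tau)_\Gamma$; $b(\mathbf v,q)=-(q,\nabla\cdot\mathbf v)_{\Omega_f}$; $a_\Gamma(\vec{\mathbf u},\vec{\mathbf v})=g(\phi,\mathbf v\cdot\mathbf n_f)_\Gamma-g(\mathbf u\cdot\mathbf n_f,\psi)_\Gamma$; $a_{st}(\vec{\mathbf u},\vec{\mathbf v})=\gamma_f(\mathbf u\cdot\mathbf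 n_f,\mathbf v\cdot\mathbf n_f)_\Gamma+\gamma_p(\phi,\psi)_\Gamma$; $\widetilde a_\Gamma=a_\Gamma-a_{st}$. A forcing pair is $\vec{\mathbf f}=(\mathbf f,f)\in L^2(\Omega_f)^d\times L^2(\Omega_p)$ with $\langle\langle\langle\vec{\mathbf f},\vec{\mathbf v}\rangle\rangle\rangle=(\mathbf f,\mathbf v)_{\Omega_f}+g(f,\psi)_{\Omega_p}$ and $\|\vec{\mathbf f}\|^2=\|\mathbf f\|^2+\|f\|^2$. Constants: $C_a=\min(\nu,gK_{\min})$; $C_S$ is a constant with $\|\vec{\mathbf v}\|\le C_S\|\vec{\mathbf v}\|_S$ for all $\vec{\mathbf v}$; $C_{tr}$ is a constant with $\|\vec{\mathbf v}\|_\Gamma\le C_{tr}(\|\vec{\mathbf v}\|\|\nabla\vec{\mathbf v}\|)^{1/2}$ and $\|\vec{\mathbf v}\|_\Gamma\le C_{tr}\|\nabla\vec{\mathbf v}\|$ for all $\vec{\mathbf v}\in\mathbf W$; $C_{ct}=\sqrt2\max\{\gamma_f,\gamma_p,g\}$. BDF2 scheme: given $\Delta t>0$, $\vec{\mathbf u}^0,\vec{\mathbf u}^1\in\mathbf W$ and forcing pairs $\vec{\mathbf f}^n$, $n\ge2$, for each $n\ge1$ the pair $(\vec{\mathbf u}^{n+1},p^{n+1})\in\mathbf W\times Q$ satisfies, for all $\vec{\mathbf v}\in\mathbf W$, $q\in Q$, $\langle\langle\frac{3\vec{\mathbf u}^{n+1}-4\vec{\mathbf u}^n+\vec{\mathbf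 u}^{n-1}}{2\Delta t},\vec{\mathbf v}\rangle\rangle+a(\vec{\mathbf u}^{n+1},\vec{\mathbf v})+b(\mathbf v,p^{n+1})+a_{st}(\vec{\mathbf u}^{n+1},\vec{\mathbf v})=\langle\langle\langle\vec{\mathbf f}^{n+1},\vec{\mathbf v}\rangle\rangle\rangle-\widetilde a_\Gamma(2\vec{\mathbf u}^n-\vec{\mathbf u}^{n-1},\vec{\mathbf v})$, and $b(\mathbf u^{n+1},q)=0$. *)

theory Defs
  imports "HOL-Analysis.Analysis"
begin

definition hausdorff_coef :: "real \<Rightarrow> real" where
  "hausdorff_coef s = pi powr (s / 2) / Gamma (s / 2 + 1) / 2 powr s"

definition hausdorff_approx :: "real \<Rightarrow> real \<Rightarrow> 'a::metric_space set \<Rightarrow> ennreal" where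
  "hausdorff_approx s \<delta> A =
     (INF C \<in> {C :: nat \<Rightarrow> 'a set. A \<subseteq> (\<Union>k. C k) \<and> (\<forall>k. bounded (C k) \<and> diameter (C k) < \<delta>)}.
        (\<Sum>k. ennreal (hausdorff_coef s * diameter (C k) powr s)))"

definition hausdorff_outer :: "real \<Rightarrow> 'a::metric_space set \<Rightarrow> ennreal" where
  "hausdorff_outer s A = (SUP \<delta> \<in> {0<..}. hausdorff_approx s \<delta> A)"

definition hausdorff_measure :: "real \<Rightarrow> 'a::metric_space measure" where
  "hausdorff_measure s = measure_of UNIV (sets borel) (hausdorff_outer s)"

definition surf :: "(real^'d) set \<Rightarrow> (real^'d) measure" where
  "surf A = restrict_space (hausdorff_measure (real (CARD('d)) - 1)) A"

definition lipschitz_domain :: "(real^'d) set \<Rightarrow> bool" where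
  "lipschitz_domain \<Omega> \<longleftrightarrow> open \<Omega> \<and> connected \<Omega> \<and> bounded \<Omega> \<and> \<Omega> \<noteq> {} \<and>
     (\<forall>x\<in>frontier \<Omega>. \<exists>r>0. \<exists>Q k (h :: real^'d \<Rightarrow> real) L.
        orthogonal_transformation Q \<and>
        (\<forall>z t. h (\<chi> j. if j = k then t else z $ j) = h z) \<and>
        L-lipschitz_on UNIV h \<and>
        \<Omega> \<inter> ball x r = {y \<in> ball x r. Q (y - x) $ k < h (Q (y - x))})"

text \<open>Measure-theoretic (De Giorgi) unit outward normal of \<Omega> at x.\<close>
definition outward_normal :: "(real^'d) set \<Rightarrow> real^'d \<Rightarrow> real^'d \<Rightarrow> bool" where
  "outward_normal \<Omega> x n \<longleftrightarrow> norm n = 1 \<and>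
     ((\<lambda>r. measure lebesgue (((\<Omega> - {y. (y - x) \<bullet> n < 0}) \<union> ({y. (y - x) \<bullet> n < 0} - \<Omega>)) \<inter> ball x r)
              / r ^ CARD('d)) \<longlongrightarrow> 0) (at_right 0)"

definition L2 :: "(real^'d) set \<Rightarrow> (real^'d \<Rightarrow> real) \<Rightarrow> bool" where
  "L2 \<Omega> f \<longleftrightarrow> f \<in> borel_measurable (lebesgue_on \<Omega>) \<and> integrable (lebesgue_on \<Omega>) (\<lambda>x. (f x)\<^sup>2)"

definition L2v :: "(real^'d) set \<Rightarrow> (real^'d \<Rightarrow> real^'k) \<Rightarrow> bool" where
  "L2v \<Omega> u \<longleftrightarrow> (\<forall>i. L2 \<Omega> (\<lambda>x. u x $ i))"

definition C1_grad :: "(real^'d \<Rightarrow> real) \<Rightarrow> (real^'d \<Rightarrow> real^'d) \<Rightarrow> bool" where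
  "C1_grad \<phi> G \<longleftrightarrow> continuous_on UNIV G \<and> (\<forall>x. (\<phi> has_derivative (\<lambda>h. G x \<bullet> h)) (at x))"

definition cgrad :: "(real^'d \<Rightarrow> real) \<Rightarrow> real^'d \<Rightarrow> real^'d" where
  "cgrad \<phi> = (SOME G. C1_grad \<phi> G)"

definition C1c :: "(real^'d \<Rightarrow> real) \<Rightarrow> bool" where
  "C1c \<phi> \<longleftrightarrow> (\<exists>G. C1_grad \<phi> G) \<and> compact (closure {x. \<phi> x \<noteq> 0})"

definition weak_grad :: "(real^'d) set \<Rightarrow> (real^'d \<Rightarrow> real) \<Rightarrow> (real^'d \<Rightarrow> real^'d) \<Rightarrow> bool" where
  "weak_grad \<Omega> f G \<longleftrightarrow> L2v \<Omega> G \<and>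
     (\<forall>\<phi>. C1c \<phi> \<and> closure {x. \<phi> x \<noteq> 0} \<subseteq> \<Omega> \<longrightarrow>
        (\<forall>i. (\<integral>x. f x * cgrad \<phi> x $ i \<partial>lebesgue_on \<Omega>) = - (\<integral>x. G x $ i * \<phi> x \<partial>lebesgue_on \<Omega>)))"

definition H1 :: "(real^'d) set \<Rightarrow> (real^'d \<Rightarrow> real) \<Rightarrow> bool" where
  "H1 \<Omega> f \<longleftrightarrow> L2 \<Omega> f \<and> (\<exists>G. weak_grad \<Omega> f G)"

definition wgrad :: "(real^'d) set \<Rightarrow> (real^'d \<Rightarrow> real) \<Rightarrow> real^'d \<Rightarrow> real^'d" where
  "wgrad \<Omega> f = (SOME G. weak_grad \<Omega> f G)"

definition has_trace :: "(real^'d) set \<Rightarrow> (real^'d \<Rightarrow> real) \<Rightarrow> (real^'d \<Rightarrow> real) \<Rightarrow> bool" where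
  "has_trace \<Omega> f g \<longleftrightarrow> H1 \<Omega> f \<and>
     g \<in> borel_measurable (surf (frontier \<Omega>)) \<and> integrable (surf (frontier \<Omega>)) (\<lambda>x. (g x)\<^sup>2) \<and>
     (\<exists>\<phi> :: nat \<Rightarrow> real^'d \<Rightarrow> real. (\<forall>k. C1c (\<phi> k)) \<and>
        ((\<lambda>k. \<integral>\<^sup>+x. ennreal ((\<phi> k x - f x)\<^sup>2) \<partial>lebesgue_on \<Omega>) \<longlonglongrightarrow> 0) \<and>
        ((\<lambda>k. \<integral>\<^sup>+x. ennreal ((norm (cgrad (\<phi> k) x - wgrad \<Omega> f x))\<^sup>2) \<partial>lebesgue_on \<Omega>) \<longlonglongrightarrow> 0) \<and>
        ((\<lambda>k. \<integral>\<^sup>+x. ennreal ((\<phi> k x - g x)\<^sup>2) \<partial>surf (frontier \<Omega>)) \<longlonglongrightarrow> 0))"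

definition tr :: "(real^'d) set \<Rightarrow> (real^'d \<Rightarrow> real) \<Rightarrow> real^'d \<Rightarrow> real" where
  "tr \<Omega> f = (SOME g. has_trace \<Omega> f g)"

definition wjac :: "(real^'d) set \<Rightarrow> (real^'d \<Rightarrow> real^'d) \<Rightarrow> real^'d \<Rightarrow> real^'d^'d" where
  "wjac \<Omega> u x = (\<chi> i. wgrad \<Omega> (\<lambda>y. u y $ i) x)"

definition trv :: "(real^'d) set \<Rightarrow> (real^'d \<Rightarrow> real^'d) \<Rightarrow> real^'d \<Rightarrow> real^'d" where
  "trv \<Omega> u x = (\<chi> i. tr \<Omega> (\<lambda>y. u y $ i) x)"

definition wdiv :: "(real^'d) set \<Rightarrow> (real^'d \<Rightarrow> real^'d) \<Rightarrow> real^'d \<Rightarrow> real" where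
  "wdiv \<Omega> u x = (\<Sum>i\<in>UNIV. wjac \<Omega> u x $ i $ i)"

type_synonym ('d) wel = "(real^'d \<Rightarrow> real^'d) \<times> (real^'d \<Rightarrow> real)"

definition interface :: "(real^'d) set \<Rightarrow> (real^'d) set \<Rightarrow> (real^'d) set" where
  "interface \<Omega>f \<Omega>p = frontier \<Omega>f \<inter> frontier \<Omega>p"

definition surfG :: "(real^'d) set \<Rightarrow> (real^'d) set \<Rightarrow> (real^'d) measure" where
  "surfG \<Omega>f \<Omega>p = surf (interface \<Omega>f \<Omega>p)"

definition Hf :: "(real^'d) set \<Rightarrow> (real^'d) set \<Rightarrow> (real^'d \<Rightarrow> real^'d) set" where
  "Hf \<Omega>f \<Omega>p = {v. \<forall>i. \<exists>g. has_trace \<Omega>f (\<lambda>x. v x $ i) g \<and>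
        (AE x in surf (frontier \<Omega>f - interface \<Omega>f \<Omega>p). g x = 0)}"

definition Hp :: "(real^'d) set \<Rightarrow> (real^'d) set \<Rightarrow> (real^'d \<Rightarrow> real) set" where
  "Hp \<Omega>f \<Omega>p = {\<psi>. \<exists>g. has_trace \<Omega>p \<psi> g \<and>
        (AE x in surf (frontier \<Omega>p - interface \<Omega>f \<Omega>p). g x = 0)}"

definition W :: "(real^'d) set \<Rightarrow> (real^'d) set \<Rightarrow> 'd wel set" where
  "W \<Omega>f \<Omega>p = Hf \<Omega>f \<Omega>p \<times> Hp \<Omega>f \<Omega>p"

definition wadd :: "('d::finite) wel \<Rightarrow> 'd wel \<Rightarrow> ('d::finite) wel" where
  "wadd U V = (\<lambda>x. fst U x + fst V x, \<lambda>x. snd U x + snd V x)"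

definition wscale :: "real \<Rightarrow> 'd wel \<Rightarrow> ('d::finite) wel" where
  "wscale c U = (\<lambda>x. c *\<^sub>R fst U x, \<lambda>x. c * snd U x)"

definition normsq :: "(real^'d) set \<Rightarrow> (real^'d) set \<Rightarrow> 'd wel \<Rightarrow> real" where
  "normsq \<Omega>f \<Omega>p V = (\<integral>x. (norm (fst V x))\<^sup>2 \<partial>lebesgue_on \<Omega>f) + (\<integral>x. (snd V x)\<^sup>2 \<partial>lebesgue_on \<Omega>p)"

definition gradsq :: "(real^'d) set \<Rightarrow> (real^'d) set \<Rightarrow> 'd wel \<Rightarrow> real" where
  "gradsq \<Omega>f \<Omega>p V = (\<integral>x. (norm (wjac \<Omega>f (fst V) x))\<^sup>2 \<partial>lebesgue_on \<Omega>f)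
                    + (\<integral>x. (norm (wgrad \<Omega>p (snd V) x))\<^sup>2 \<partial>lebesgue_on \<Omega>p)"

definition gammasq :: "(real^'d) set \<Rightarrow> (real^'d) set \<Rightarrow> 'd wel \<Rightarrow> real" where
  "gammasq \<Omega>f \<Omega>p V = (\<integral>x. (norm (trv \<Omega>f (fst V) x))\<^sup>2 \<partial>surfG \<Omega>f \<Omega>p)
                     + (\<integral>x. (tr \<Omega>p (snd V) x)\<^sup>2 \<partial>surfG \<Omega>f \<Omega>p)"

definition ipS :: "real \<Rightarrow> real \<Rightarrow> (real^'d) set \<Rightarrow> (real^'d) set \<Rightarrow> 'd wel \<Rightarrow> 'd wel \<Rightarrow> real" where
  "ipS g S \<Omega>f \<Omega>p U V = (\<integral>x. fst U x \<bullet> fst V x \<partial>lebesgue_on \<Omega>f)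
                       + g * S * (\<integral>x. snd U x * snd V x \<partial>lebesgue_on \<Omega>p)"

definition tang :: "real^'d \<Rightarrow> real^'d \<Rightarrow> real^'d" where
  "tang n w = w - (w \<bullet> n) *\<^sub>R n"

definition form_a :: "real \<Rightarrow> real \<Rightarrow> real^'d^'d \<Rightarrow> real \<Rightarrow> (real^'d \<Rightarrow> real^'d) \<Rightarrow>
     (real^'d) set \<Rightarrow> (real^'d) set \<Rightarrow> 'd wel \<Rightarrow> 'd wel \<Rightarrow> real" where
  "form_a \<nu> g Kp \<alpha>BJ nf \<Omega>f \<Omega>p U V =
      \<nu> * (\<integral>x. wjac \<Omega>f (fst U) x \<bullet> wjac \<Omega>f (fst V) x \<partial>lebesgue_on \<Omega>f)
    + g * (\<integral>x. (Kp *v wgrad \<Omega>p (snd U) x) \<bullet> wgrad \<Omega>p (snd V) x \<partial>lebesgue_on \<Omega>p)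
    + \<alpha>BJ * (\<integral>x. tang (nf x) (trv \<Omega>f (fst U) x) \<bullet> tang (nf x) (trv \<Omega>f (fst V) x) \<partial>surfG \<Omega>f \<Omega>p)"

definition form_b :: "(real^'d) set \<Rightarrow> (real^'d \<Rightarrow> real^'d) \<Rightarrow> (real^'d \<Rightarrow> real) \<Rightarrow> real" where
  "form_b \<Omega>f v q = - (\<integral>x. q x * wdiv \<Omega>f v x \<partial>lebesgue_on \<Omega>f)"

definition form_aG :: "real \<Rightarrow> (real^'d \<Rightarrow> real^'d) \<Rightarrow> (real^'d) set \<Rightarrow> (real^'d) set \<Rightarrow>
     'd wel \<Rightarrow> 'd wel \<Rightarrow> real" where
  "form_aG g nf \<Omega>f \<Omega>p U V =
      g * (\<integral>x. tr \<Omega>p (snd U) x * (trv \<Omega>f (fst V) x \<bullet> nf x) \<partial>surfG \<Omega>f \<Omega>p)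
    - g * (\<integral>x. (trv \<Omega>f (fst U) x \<bullet> nf x) * tr \<Omega>p (snd V) x \<partial>surfG \<Omega>f \<Omega>p)"

definition form_ast :: "real \<Rightarrow> real \<Rightarrow> (real^'d \<Rightarrow> real^'d) \<Rightarrow> (real^'d) set \<Rightarrow> (real^'d) set \<Rightarrow>
     'd wel \<Rightarrow> 'd wel \<Rightarrow> real" where
  "form_ast \<gamma>f \<gamma>p nf \<Omega>f \<Omega>p U V =
      \<gamma>f * (\<integral>x. (trv \<Omega>f (fst U) x \<bullet> nf x) * (trv \<Omega>f (fst V) x \<bullet> nf x) \<partial>surfG \<Omega>f \<Omega>p)
    + \<gamma>p * (\<integral>x. tr \<Omega>p (snd U) x * tr \<Omega>p (snd V) x \<partial>surfG \<Omega>f \<Omega>p)"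

definition form_aGt :: "real \<Rightarrow> real \<Rightarrow> real \<Rightarrow> (real^'d \<Rightarrow> real^'d) \<Rightarrow> (real^'d) set \<Rightarrow> (real^'d) set \<Rightarrow>
     'd wel \<Rightarrow> 'd wel \<Rightarrow> real" where
  "form_aGt g \<gamma>f \<gamma>p nf \<Omega>f \<Omega>p U V = form_aG g nf \<Omega>f \<Omega>p U V - form_ast \<gamma>f \<gamma>p nf \<Omega>f \<Omega>p U V"

definition forcing_ok :: "(real^'d) set \<Rightarrow> (real^'d) set \<Rightarrow> 'd wel \<Rightarrow> bool" where
  "forcing_ok \<Omega>f \<Omega>p Fv \<longleftrightarrow> L2v \<Omega>f (fst Fv) \<and> L2 \<Omega>p (snd Fv)"

definition fpair :: "real \<Rightarrow> (real^'d) set \<Rightarrow> (real^'d) set \<Rightarrow> 'd wel \<Rightarrow> 'd wel \<Rightarrow> real" where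
  "fpair g \<Omega>f \<Omega>p Fv V = (\<integral>x. fst Fv x \<bullet> fst V x \<partial>lebesgue_on \<Omega>f)
                        + g * (\<integral>x. snd Fv x * snd V x \<partial>lebesgue_on \<Omega>p)"

definition min_eig :: "real^'d^'d \<Rightarrow> real" where
  "min_eig K = Min {l. \<exists>x. x \<noteq> 0 \<and> K *v x = l *\<^sub>R x}"

definition spd :: "real^'d^'d \<Rightarrow> bool" where
  "spd K \<longleftrightarrow> transpose K = K \<and> (\<forall>x. x \<noteq> 0 \<longrightarrow> x \<bullet> (K *v x) > 0)"

end

theory Submission
  imports Defs
begin

text \<open>
  Testing the scheme with \<open>u\<^sup>n\<^sup>+\<^sup>1\<close> and using the G-stability identity of BDF2, the interface form, being skew
  up to its stabilisation, only contributes \<open>a\<^sub>\<Gamma>(\<delta>, u\<^sup>n\<^sup>+\<^sup>1)\<close> with the second difference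
  \<open>\<delta> = u\<^sup>n\<^sup>+\<^sup>1 - 2 u\<^sup>n + u\<^sup>n\<^sup>-\<^sup>1\<close>. The multiplicative trace inequality and the time step restriction
  let the numerical dissipation \<open>\<parallel>\<delta>\<parallel>\<^sup>2\<close> and the viscous dissipation absorb it; the rest is a Poincare inequality and a
  discrete Gronwall argument.

  The analysis behind it has two parts. Traces are unique, so that they depend linearly on the function, because smooth
  functions tending to 0 in \<open>H\<^sup>1\<close> have boundary values tending to 0: this follows by integrating along the
  lines transversal to the boundary graph and comparing the Hausdorff measure of a graph with the volume below it. The
  Poincare inequality on the energy space follows from a Friedrichs inequality with a boundary term, obtained by following
  rays until they leave the domain, combined with the assumed bound of traces by gradients, which excludes
  constant functions.
\<close>

text \<open>Weak gradients and traces are \<open>SOME\<close> choices, so nothing about them is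
  linear until uniqueness almost everywhere is known; this is why closability of the trace has to be
  proved. The surface measure is the raw Hausdorff measure, handled by two one-sided estimates in
  place of an area formula: a piece of a graph is null if the tube below it is, and the volume of a
  shadow is bounded by the Hausdorff measure of the set that casts it.

  The constants come from splitting the viscous dissipation 4 dt Ca |grad u^{n+1}|^2. The forcing
  takes 1/8 of it and the interface term 1/4; the gradient of the second difference costs 4/134 of
  |grad u^{n+1}|^2 + 2 |grad u^n|^2 + |grad u^{n-1}|^2. Since 4/134 < 1/32, at least 1 - 1/8 - 1/4 -
  1/32 = 19/32 is left, which outweighs the older gradients with their weights 1/16 and 1/32. The
  536 in the time step restriction is 4 times 134, and \<open>Cct ^ 4\<close> is 4 M^4 for the
  maximum M of \<open>\<gamma>f\<close>, \<open>\<gamma>p\<close> and \<open>g\<close>.\<close>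

section \<open>Hausdorff measure\<close>

lemma hausdorff_coef_pos: "s > -2 \<Longrightarrow> hausdorff_coef s > 0"
  unfolding hausdorff_coef_def by (intro divide_pos_pos Gamma_real_pos) auto

lemma hausdorff_coef_nonneg [simp]: "s > -2 \<Longrightarrow> hausdorff_coef s \<ge> 0"
  using hausdorff_coef_pos[of s] by simp

section \<open>Monotonicity and countable subadditivity of the Hausdorff premeasures\<close>

lemma hausdorff_approx_le:
  assumes "A \<subseteq> (\<Union>k. C k)" "\<And>k. bounded (C k)" "\<And>k. diameter (C k) < \<delta>"
  shows "hausdorff_approx s \<delta> A \<le> (\<Sum>k. ennreal (hausdorff_coef s * diameter (C k) powr s))"
  unfolding hausdorff_approx_def by (rule INF_lower) (use assms in auto)

lemma hausdorff_approx_mono: "A \<subseteq> B \<Longrightarrow> hausdorff_approx s \<delta> A \<le> hausdorff_approx s \<delta> B"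
  unfolding hausdorff_approx_def by (rule INF_superset_mono) auto

lemma hausdorff_approx_antimono: "\<delta> \<le> \<delta>' \<Longrightarrow> hausdorff_approx s \<delta>' A \<le> hausdorff_approx s \<delta> A"
  unfolding hausdorff_approx_def by (rule INF_superset_mono) (auto intro: less_le_trans)

lemma hausdorff_approx_empty: "\<delta> > 0 \<Longrightarrow> hausdorff_approx s \<delta> {} = 0"
  using hausdorff_approx_le[of "{}" "\<lambda>_. {}" \<delta> s] by simp

lemma hausdorff_approx_le_outer: "\<delta> > 0 \<Longrightarrow> hausdorff_approx s \<delta> A \<le> hausdorff_outer s A"
  unfolding hausdorff_outer_def by (rule SUP_upper) auto

lemma hausdorff_outer_mono: "A \<subseteq> B \<Longrightarrow> hausdorff_outer s A \<le> hausdorff_outer s B"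
  unfolding hausdorff_outer_def by (rule SUP_mono) (use hausdorff_approx_mono in blast)

lemma hausdorff_outer_empty: "hausdorff_outer s {} = 0"
  unfolding hausdorff_outer_def by (simp add: hausdorff_approx_empty)

text \<open>Near-optimal covers of the \<open>A i\<close>, with surplus e/2^(i+1) each, are merged
  into one cover through the pairing of the naturals. If the sum on the right is finite, so is every
  term, which makes the strict surplus possible.\<close>

lemma hausdorff_approx_UN_le:
  fixes A :: "nat \<Rightarrow> 'a::metric_space set"
  shows "hausdorff_approx s \<delta> (\<Union>i. A i) \<le> (\<Sum>i. hausdorff_approx s \<delta> (A i))"
proof (cases "(\<Sum>i. hausdorff_approx s \<delta> (A i)) = top")
  case False
  let ?w = "\<lambda>C. ennreal (hausdorff_coef s * diameter C powr s)"
  show ?thesis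
  proof (rule ennreal_le_epsilon)
    fix e :: real assume e: "0 < e"
    have fin: "hausdorff_approx s \<delta> (A i) \<noteq> top" for i
      using False ennreal_suminf_lessD[of "\<lambda>i. hausdorff_approx s \<delta> (A i)" top i]
      unfolding less_top by blast
    have "\<exists>C. A i \<subseteq> (\<Union>k. C k) \<and> (\<forall>k. bounded (C k) \<and> diameter (C k) < \<delta>) \<and>
           (\<Sum>k. ?w (C k)) < hausdorff_approx s \<delta> (A i) + ennreal (e * (1/2)^Suc i)" for i
    proof -
      have "hausdorff_approx s \<delta> (A i) < hausdorff_approx s \<delta> (A i) + ennreal (e * (1/2)^Suc i)"
        using fin[of i] e by (cases "hausdorff_approx s \<delta> (A i)")
          (auto simp: ennreal_plus[symmetric] ennreal_less_iff simp del: ennreal_plus)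
      then show ?thesis
        unfolding hausdorff_approx_def[of s \<delta> "A i"] INF_less_iff by blast
    qed
    then obtain C where C: "\<And>i. A i \<subseteq> (\<Union>k. C i k)" "\<And>i k. bounded (C i k)" "\<And>i k. diameter (C i k) < \<delta>"
      "\<And>i. (\<Sum>k. ?w (C i k)) < hausdorff_approx s \<delta> (A i) + ennreal (e * (1/2)^Suc i)"
      by metis
    have "hausdorff_approx s \<delta> (\<Union>i. A i) \<le> (\<Sum>n. ?w (case prod_decode n of (i, k) \<Rightarrow> C i k))"
    proof (rule hausdorff_approx_le)
      show "(\<Union>i. A i) \<subseteq> (\<Union>n. case prod_decode n of (i, k) \<Rightarrow> C i k)"
      proof
        fix x assume "x \<in> (\<Union>i. A i)"
        then obtain i k where "x \<in> C i k" using C(1) by blast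
        then show "x \<in> (\<Union>n. case prod_decode n of (i, k) \<Rightarrow> C i k)"
          by (intro UN_I[of "prod_encode (i,k)"]) auto
      qed
    qed (auto split: prod.split simp: C)
    also have "\<dots> = (\<Sum>i. \<Sum>k. ?w (C i k))"
      using suminf_ennreal_2dimen[of "\<lambda>i. \<Sum>k. ?w (C i k)" "\<lambda>(i, k). ?w (C i k)"]
      by (simp add: prod.case_eq_if comp_def)
    also have "\<dots> \<le> (\<Sum>i. hausdorff_approx s \<delta> (A i) + ennreal (e * (1/2)^Suc i))"
      by (intro suminf_le less_imp_le C) auto
    also have "\<dots> = (\<Sum>i. hausdorff_approx s \<delta> (A i)) + (\<Sum>i. ennreal (e * (1/2)^Suc i))"
      by (rule suminf_add[symmetric]) auto
    also have "(\<Sum>i. ennreal (e * (1/2)^Suc i)) = ennreal e"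
      using e sums_mult[OF power_half_series, of e] by (intro suminf_ennreal_eq) (auto simp: mult.commute)
    finally show "hausdorff_approx s \<delta> (\<Union>i. A i) \<le> (\<Sum>i. hausdorff_approx s \<delta> (A i)) + ennreal e" .
  qed
qed simp

lemma hausdorff_outer_UN_le:
  fixes A :: "nat \<Rightarrow> 'a::metric_space set"
  shows "hausdorff_outer s (\<Union>i. A i) \<le> (\<Sum>i. hausdorff_outer s (A i))"
  unfolding hausdorff_outer_def[of s "\<Union>i. A i"]
proof (rule SUP_least)
  fix \<delta> :: real assume "\<delta> \<in> {0<..}"
  then have "(\<Sum>i. hausdorff_approx s \<delta> (A i)) \<le> (\<Sum>i. hausdorff_outer s (A i))"
    by (intro suminf_le hausdorff_approx_le_outer) auto
  then show "hausdorff_approx s \<delta> (\<Union>i. A i) \<le> (\<Sum>i. hausdorff_outer s (A i))"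
    using hausdorff_approx_UN_le order_trans by blast
qed

text \<open>A set of diameter below \<delta> \<le> \<eta> cannot meet both \<open>A\<close> and
  \<open>B\<close>, so every admissible cover of the union splits into a cover of \<open>A\<close>
  and a cover of \<open>B\<close>.\<close>

lemma hausdorff_approx_separated:
  fixes A B :: "'a::metric_space set"
  assumes sep: "\<And>x y. x \<in> A \<Longrightarrow> y \<in> B \<Longrightarrow> \<eta> \<le> dist x y" and "0 < \<delta>" "\<delta> \<le> \<eta>"
  shows "hausdorff_approx s \<delta> A + hausdorff_approx s \<delta> B \<le> hausdorff_approx s \<delta> (A \<union> B)"
  unfolding hausdorff_approx_def[of s \<delta> "A \<union> B"]
proof (rule INF_greatest, safe)
  fix C :: "nat \<Rightarrow> 'a set"
  assume cov: "A \<union> B \<subseteq> (\<Union>k. C k)" and C: "\<forall>k. bounded (C k) \<and> diameter (C k) < \<delta>"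
  let ?w = "\<lambda>C. ennreal (hausdorff_coef s * diameter C powr s)"
  \<comment> \<open>Sets on the wrong side are replaced by the empty set, whose weight is 0 because
    \<open>0 powr s = 0\<close> for every s.\<close>
  define P where "P k \<longleftrightarrow> C k \<inter> A \<noteq> {}" for k
  have "hausdorff_approx s \<delta> A \<le> (\<Sum>k. ?w (if P k then C k else {}))"
    by (rule hausdorff_approx_le) (use cov C \<open>0<\<delta>\<close> in \<open>auto simp: P_def\<close>, blast)
  moreover have "hausdorff_approx s \<delta> B \<le> (\<Sum>k. ?w (if P k then {} else C k))"
  proof (rule hausdorff_approx_le)
    show "B \<subseteq> (\<Union>k. if P k then {} else C k)"
    proof
      fix y assume y: "y \<in> B"
      then obtain k where k: "y \<in> C k" using cov by blast
      have "\<not> P k"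
      proof
        assume "P k"
        then obtain x where "x \<in> C k" "x \<in> A" by (auto simp: P_def)
        then have "\<eta> \<le> diameter (C k)"
          using sep[of x y] y k C diameter_bounded_bound[of "C k" x y] by (meson order_trans)
        then show False using C \<open>\<delta> \<le> \<eta>\<close> by (meson leD le_less_trans less_le_trans)
      qed
      then show "y \<in> (\<Union>k. if P k then {} else C k)" using k by (intro UN_I[of k]) auto
    qed
  qed (use C \<open>0<\<delta>\<close> in auto)
  ultimately have "hausdorff_approx s \<delta> A + hausdorff_approx s \<delta> B
     \<le> (\<Sum>k. ?w (if P k then C k else {})) + (\<Sum>k. ?w (if P k then {} else C k))"
    by (rule add_mono)
  also have "\<dots> = (\<Sum>k. ?w (if P k then C k else {}) + ?w (if P k then {} else C k))"
    by (rule suminf_add) auto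
  also have "\<dots> = (\<Sum>k. ?w (C k))"
    by (rule suminf_cong) auto
  finally show "hausdorff_approx s \<delta> A + hausdorff_approx s \<delta> B \<le> (\<Sum>k. ?w (C k))" .
qed

lemma hausdorff_outer_separated:
  fixes A B :: "'a::metric_space set"
  assumes sep: "\<And>x y. x \<in> A \<Longrightarrow> y \<in> B \<Longrightarrow> \<eta> \<le> dist x y" and "0 < \<eta>"
  shows "hausdorff_outer s A + hausdorff_outer s B \<le> hausdorff_outer s (A \<union> B)"
proof -
  have 1: "a + b \<le> hausdorff_outer s (A \<union> B)"
    if ab: "a \<in> (\<lambda>\<delta>. hausdorff_approx s \<delta> A) ` {0<..}" "b \<in> (\<lambda>\<delta>. hausdorff_approx s \<delta> B) ` {0<..}" for a b
  proof -
    obtain d1 d2 where d: "d1 > 0" "d2 > 0" "a = hausdorff_approx s d1 A" "b = hausdorff_approx s d2 B"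
      using ab by auto
    \<comment> \<open>The two suprema run over independent mesh sizes; both are lowered to a common
      one that is also at most \<eta>.\<close>
    let ?d = "min \<eta> (min d1 d2)"
    have "a + b \<le> hausdorff_approx s ?d A + hausdorff_approx s ?d B"
      unfolding d by (intro add_mono hausdorff_approx_antimono) auto
    also have "\<dots> \<le> hausdorff_approx s ?d (A \<union> B)"
      by (rule hausdorff_approx_separated[OF sep]) (use d \<open>0<\<eta>\<close> in auto)
    also have "\<dots> \<le> hausdorff_outer s (A \<union> B)"
      by (rule hausdorff_approx_le_outer) (use d \<open>0<\<eta>\<close> in auto)
    finally show ?thesis .
  qed
  have ne: "{0<..} \<noteq> ({}::real set)" by auto
  have "hausdorff_outer s A + hausdorff_outer s B = 
     (SUP d\<in>{0<..}. hausdorff_outer s A + hausdorff_approx s d B)"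
    unfolding hausdorff_outer_def[of s B] by (rule ennreal_SUP_add_right) auto
  also have "\<dots> = (SUP d\<in>{0<..}. SUP d'\<in>{0<..}. hausdorff_approx s d B + hausdorff_approx s d' A)"
    unfolding hausdorff_outer_def[of s A] 
    by (subst add.commute, subst ennreal_SUP_add_right) auto
  also have "\<dots> \<le> hausdorff_outer s (A \<union> B)"
    by (intro SUP_least) (subst add.commute, rule 1, auto)
  finally show ?thesis .
qed

text \<open>Caratheodory's criterion for metric outer measures. The part \<open>An n\<close> of
  \<open>A\<close> at distance at least 1/(n+1) from \<open>F\<close> is separated from
  \<open>F\<close>. What is missing from \<open>A - F\<close> is a tail of the layers
  \<open>D k\<close>, whose measures are summable because layers of equal parity are separated from
  each other.\<close>

lemma closed_in_lambda_system:
  fixes \<mu> :: "'a::metric_space set \<Rightarrow> ennreal"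
  assumes outer: "outer_measure_space (Pow UNIV) \<mu>"
    and sep: "\<And>A B \<eta>. 0 < \<eta> \<Longrightarrow> (\<And>x y. x \<in> A \<Longrightarrow> y \<in> B \<Longrightarrow> \<eta> \<le> dist x y) \<Longrightarrow> \<mu> A + \<mu> B \<le> \<mu> (A \<union> B)"
    and F: "closed F"
  shows "F \<in> lambda_system UNIV (Pow UNIV) \<mu>"
proof -
  have emp: "\<mu> {} = 0" and mono: "\<And>A B. A \<subseteq> B \<Longrightarrow> \<mu> A \<le> \<mu> B"
    and csub: "countably_subadditive (Pow UNIV) \<mu>"
    using outer by (auto simp: outer_measure_space_def positive_def increasing_def)
  have sub2: "\<mu> (A \<union> B) \<le> \<mu> A + \<mu> B" for A B
  proof -
    interpret sigma_algebra UNIV "Pow UNIV :: 'a set set" by (rule sigma_algebra_Pow)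
    have "subadditive (Pow UNIV) \<mu>"
      by (rule countably_subadditive_subadditive[OF _ csub]) (simp add: positive_def emp)
    then have "\<mu> (A \<union> (B - A)) \<le> \<mu> A + \<mu> (B - A)" by (intro subadditiveD) auto
    also have "\<dots> \<le> \<mu> A + \<mu> B" by (intro add_mono mono) auto
    finally show ?thesis by (simp add: Un_Diff_cancel)
  qed
  have subc: "\<mu> (\<Union>i. A i) \<le> (\<Sum>i. \<mu> (A i))" for A :: "nat \<Rightarrow> 'a set"
  proof -
    have "\<mu> (\<Union>i. disjointed A i) \<le> (\<Sum>i. \<mu> (disjointed A i))"
      using csub disjoint_family_disjointed[of A] unfolding countably_subadditive_def by auto
    also have "\<dots> \<le> (\<Sum>i. \<mu> (A i))"
      by (intro suminf_le mono disjointed_subset) auto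
    finally show ?thesis by (simp add: UN_disjointed_eq)
  qed
  have main: "\<mu> (F \<inter> A) + \<mu> (A - F) \<le> \<mu> A" for A
  proof (cases "F = {} \<or> \<mu> A = top")
    case True then show ?thesis by (auto simp: emp)
  next
    case False
    then have ne: "F \<noteq> {}" and fin: "\<mu> A < top" by (auto simp: less_top)
    define An where "An n = {x \<in> A. infdist x F \<ge> 1 / (real n + 1)}" for n
    define D where "D k = {x \<in> A. 1 / (real k + 2) \<le> infdist x F \<and> infdist x F < 1 / (real k + 1)}" for k
    have infd: "infdist x F - infdist y F \<le> dist x y" for x y
      using infdist_triangle[of x F y] by simp
    have sep1: "\<mu> (F \<inter> A) + \<mu> (An n) \<le> \<mu> A" for n
    proof -
      have "\<mu> (F \<inter> A) + \<mu> (An n) \<le> \<mu> (F \<inter> A \<union> An n)"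
      proof (rule sep[of "1 / (real n + 1)"])
        fix x y assume "x \<in> F \<inter> A" "y \<in> An n"
        then show "1 / (real n + 1) \<le> dist x y"
          using infd[of y x] infdist_zero[of x F] by (auto simp: An_def dist_commute)
      qed auto
      also have "\<dots> \<le> \<mu> A" by (rule mono) (auto simp: An_def)
      finally show ?thesis .
    qed
    \<comment> \<open>A skipped layer lies between two layers of equal parity, which leaves the gap
      1/(2n+p) - 1/(2n+p+1). For n = 0 the union on the left is empty, so any positive gap serves;
      the formula would involve 1/0 there when p = 0.\<close>
    have parity: "(\<Sum>k<n. \<mu> (D (2*k+p))) \<le> \<mu> (\<Union>k<n. D (2*k+p))" for n p
    proof (induction n)
      case (Suc n)
      have "(\<Sum>k<Suc n. \<mu> (D (2*k+p))) \<le> \<mu> (\<Union>k<n. D (2*k+p)) + \<mu> (D (2*n+p))"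
        using Suc by (simp add: add_right_mono)
      also have "\<dots> \<le> \<mu> ((\<Union>k<n. D (2*k+p)) \<union> D (2*n+p))"
      proof (rule sep[of "if n = 0 then 1 else 1 / (2 * real n + real p) - 1 / (2 * real n + real p + 1)"])
        fix x y assume x: "x \<in> (\<Union>k<n. D (2*k+p))" and y: "y \<in> D (2*n+p)"
        obtain j where j: "j < n" "x \<in> D (2*j+p)" using x by auto
        have "1 / (2 * real n + real p) \<le> 1 / (real (2*j+p) + 2)"
          using j by (intro divide_left_mono) auto
        also have "\<dots> \<le> infdist x F" using j by (auto simp: D_def)
        finally show "(if n = 0 then 1 else 1 / (2 * real n + real p) - 1 / (2 * real n + real p + 1)) \<le> dist x y"
          using y j infd[of x y] by (auto simp: D_def algebra_simps)
      next
        show "0 < (if n = 0 then 1 else 1 / (2 * real n + real p) - 1 / (2 * real n + real p + 1))"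
        proof (cases "n = 0")
          case False
          then have "0 < 2 * real n + real p" by simp
          then show ?thesis by (simp add: frac_less2)
        qed simp
      qed
      also have "(\<Union>k<n. D (2*k+p)) \<union> D (2*n+p) = (\<Union>k<Suc n. D (2*k+p))"
        by (auto simp: lessThan_Suc)
      finally show ?case .
    qed (simp add: emp)
    have par2: "(\<Sum>k. \<mu> (D (2*k+p))) \<le> \<mu> A" for p
    proof (rule suminf_le_const)
      show "(\<Sum>k<n. \<mu> (D (2*k+p))) \<le> \<mu> A" for n
        using parity order_trans[OF parity[of p n] mono[of "(\<Union>k<n. D (2*k+p))" A]] by (auto simp: D_def)
    qed auto
    have "(\<Sum>k<n. \<mu> (D k)) \<le> \<mu> A + \<mu> A" for n
    proof -
      have "(\<Sum>k<n. \<mu> (D k)) \<le> (\<Sum>k<2*n. \<mu> (D k))"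
        by (intro sum_mono2) auto
      also have "\<dots> = (\<Sum>k<n. \<mu> (D (2*k))) + (\<Sum>k<n. \<mu> (D (2*k+1)))"
        by (induction n) (auto simp: algebra_simps)
      also have "\<dots> \<le> (\<Sum>k. \<mu> (D (2*k+0))) + (\<Sum>k. \<mu> (D (2*k+1)))"
        using sum_le_suminf[of "\<lambda>k. \<mu> (D (2*k))" "{..<n}"] sum_le_suminf[of "\<lambda>k. \<mu> (D (2*k+1))" "{..<n}"]
        by (intro add_mono) auto
      also have "\<dots> \<le> \<mu> A + \<mu> A" by (intro add_mono par2)
      finally show ?thesis .
    qed
    then have "(\<Sum>k. \<mu> (D k)) \<le> \<mu> A + \<mu> A" by (intro suminf_le_const) auto
    also have "\<dots> < top" using fin by simp
    finally have sumfin: "(\<Sum>k. \<mu> (D k)) < top" .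
    have "\<mu> (F \<inter> A) + \<mu> (A - F) \<le> \<mu> A"
    proof (rule ennreal_le_epsilon)
      fix e :: real assume e: "0 < e"
      define r where "r k = enn2real (\<mu> (D k))" for k
      have r: "\<mu> (D k) = ennreal (r k)" for k
        using ennreal_suminf_lessD[OF sumfin, of k] by (simp add: r_def)
      have r0: "0 \<le> r k" for k by (simp add: r_def)
      have "summable r"
        by (rule summable_suminf_not_top) (use sumfin r0 in \<open>auto simp: r\<close>)
      then obtain N where N: "\<And>n. n \<ge> N \<Longrightarrow> norm (\<Sum>i. r (i + n)) < e"
        using suminf_exist_split[OF e] by blast
      have tail: "(\<Sum>i. \<mu> (D (i + N))) \<le> ennreal e"
        unfolding r using N[of N] \<open>summable r\<close> r0 
        by (subst suminf_ennreal2) (auto simp: summable_iff_shift intro!: ennreal_leI)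
      have "A - F \<subseteq> An N \<union> (\<Union>i. D (i + N))"
      proof
        fix x assume x: "x \<in> A - F"
        then have pos: "infdist x F > 0" using F ne
          in_closed_iff_infdist_zero[OF F ne, of x] infdist_nonneg[of x F] by simp
        show "x \<in> An N \<union> (\<Union>i. D (i + N))"
        proof (cases "infdist x F \<ge> 1 / (real N + 1)")
          case False
          \<comment> \<open>With m the ceiling of the reciprocal distance, 1/m \<le>
            \<open>infdist x F\<close> < 1/(m-1), so x lies in the layer numbered m - 2. A distance
            below 1/(N+1) forces m to be at least N + 2.\<close>
          define m where "m = nat \<lceil>1 / infdist x F\<rceil>"
          have m: "real m \<ge> 1 / infdist x F" "real m < 1 / infdist x F + 1"
          proof -
            have "0 < 1 / infdist x F" using pos by simp
            then have "0 \<le> \<lceil>1 / infdist x F\<rceil>" by linarith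
            then have "real m = of_int \<lceil>1 / infdist x F\<rceil>" by (simp add: m_def)
            then show "real m \<ge> 1 / infdist x F" "real m < 1 / infdist x F + 1"
              using ceiling_correct[of "1 / infdist x F"] by auto
          qed
          have "1 / infdist x F > real N + 1" using False pos by (simp add: field_simps)
          then have mN: "m \<ge> N + 2" using m by linarith
          have "1 / real m \<le> infdist x F"
            using m(1) pos mN by (simp add: divide_simps mult.commute)
          moreover have "infdist x F < 1 / (real m - 1)"
          proof -
            have "(real m - 1) * infdist x F < (1 / infdist x F) * infdist x F"
              using m(2) pos by (intro mult_strict_right_mono) auto
            then show ?thesis using pos mN by (simp add: pos_less_divide_eq mult.commute)
          qed
          ultimately have inD: "1 / (real (m - 2) + 2) \<le> infdist x F" "infdist x F < 1 / (real (m - 2) + 1)"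
            using mN by (simp_all add: of_nat_diff)
          then have "x \<in> D (m - 2)" using x by (simp add: D_def)
          also have "m - 2 = (m - 2 - N) + N" using mN by simp
          finally show ?thesis by blast
        qed (use x in \<open>auto simp: An_def\<close>)
      qed
      then have "\<mu> (A - F) \<le> \<mu> (An N \<union> (\<Union>i. D (i + N)))" by (rule mono)
      also have "\<dots> \<le> \<mu> (An N) + \<mu> (\<Union>i. D (i + N))" by (rule sub2)
      also have "\<dots> \<le> \<mu> (An N) + ennreal e" using order_trans[OF subc tail] by (simp add: add_left_mono)
      finally have "\<mu> (F \<inter> A) + \<mu> (A - F) \<le> (\<mu> (F \<inter> A) + \<mu> (An N)) + ennreal e"
        by (simp add: add_left_mono add.assoc)
      also have "\<dots> \<le> \<mu> A + ennreal e" by (intro add_right_mono sep1)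
      finally show "\<mu> (F \<inter> A) + \<mu> (A - F) \<le> \<mu> A + ennreal e" .
    qed
    then show ?thesis .
  qed
  have "\<mu> (F \<inter> A) + \<mu> ((UNIV - F) \<inter> A) = \<mu> A" for A
  proof (rule antisym)
    have "(UNIV - F) \<inter> A = A - F" by auto
    then show "\<mu> (F \<inter> A) + \<mu> ((UNIV - F) \<inter> A) \<le> \<mu> A" using main[of A] by simp
    show "\<mu> A \<le> \<mu> (F \<inter> A) + \<mu> ((UNIV - F) \<inter> A)"
      by (rule order_trans[OF mono sub2]) auto
  qed
  then show ?thesis unfolding lambda_system_def by blast
qed

section \<open>The Hausdorff measure on Borel sets\<close>

lemma sets_hausdorff_measure [simp, measurable_cong]: "sets (hausdorff_measure s :: 'a::metric_space measure) = sets borel"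
  unfolding hausdorff_measure_def using sets.sigma_sets_eq[of "borel :: 'a measure"]
  by (subst sets_measure_of) simp_all

lemma space_hausdorff_measure [simp]: "space (hausdorff_measure s) = UNIV"
  unfolding hausdorff_measure_def by (simp add: space_measure_of_conv)

text \<open>\<open>measure_of\<close> takes the prescribed values only if they form a measure on the
  generated sigma algebra. Hence all Borel sets must be Caratheodory measurable, and for this closed
  sets suffice.\<close>

lemma emeasure_hausdorff_measure:
  fixes A :: "'a::metric_space set"
  assumes A: "A \<in> sets borel"
  shows "emeasure (hausdorff_measure s) A = hausdorff_outer s A"
proof -
  have outer: "outer_measure_space (Pow UNIV) (hausdorff_outer s :: 'a set \<Rightarrow> ennreal)"
    unfolding outer_measure_space_def positive_def increasing_def countably_subadditive_def
    by (intro conjI ballI allI impI hausdorff_outer_empty hausdorff_outer_mono hausdorff_outer_UN_le)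
  interpret P: sigma_algebra UNIV "Pow UNIV :: 'a set set" by (rule sigma_algebra_Pow)
  let ?L = "lambda_system UNIV (Pow UNIV) (hausdorff_outer s :: 'a set \<Rightarrow> ennreal)"
  have ms: "measure_space UNIV ?L (hausdorff_outer s)"
    by (rule P.caratheodory_lemma[OF outer])
  have "F \<in> ?L" if "closed F" for F
    by (rule closed_in_lambda_system[OF outer hausdorff_outer_separated that]) auto
  then have "sigma_sets UNIV {F. closed F} \<subseteq> ?L"
    using ms by (intro sigma_algebra.sigma_sets_subset) (auto simp: measure_space_def)
  moreover have "sets (borel :: 'a measure) = sigma_sets UNIV {F. closed F}"
    unfolding borel_eq_closed by simp
  ultimately have sub: "sets borel \<subseteq> ?L" by simp
  have "measure_space UNIV (sets (borel :: 'a measure)) (hausdorff_outer s)"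
    unfolding measure_space_def
  proof (intro conjI)
    show "sigma_algebra UNIV (sets (borel :: 'a measure))"
      using sets.sigma_algebra_axioms[of "borel :: 'a measure"] by simp
    show "positive (sets (borel :: 'a measure)) (hausdorff_outer s)"
      by (simp add: positive_def hausdorff_outer_empty)
    show "countably_additive (sets (borel :: 'a measure)) (hausdorff_outer s)"
      unfolding countably_additive_def
    proof (intro allI impI)
      fix B :: "nat \<Rightarrow> 'a set"
      assume B: "range B \<subseteq> sets borel" "disjoint_family B" "(\<Union>i. B i) \<in> sets borel"
      have "countably_additive ?L (hausdorff_outer s)" using ms by (simp add: measure_space_def)
      then show "(\<Sum>i. hausdorff_outer s (B i)) = hausdorff_outer s (\<Union>i. B i)"
        using order_trans[OF B(1) sub] B(2) subsetD[OF sub B(3)] by (simp add: countably_additive_def)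
    qed
  qed
  then show ?thesis
    unfolding hausdorff_measure_def using A
      sets.sigma_sets_eq[of "borel :: 'a measure"]
    by (simp add: emeasure_measure_of_conv)
qed

section \<open>Lipschitz graphs and shadows\<close>

text \<open>Enclose \<open>T\<close> in an open set of measure at most \<eta> and apply the covering
  lemma with a gauge that keeps every box small and inside that set. The boxes arise by subdividing
  a cube, so they are cubes, and the volumes of their disjoint interiors add up to at most
  \<eta>.\<close>

lemma negligible_cube_cover:
  fixes T :: "'a::euclidean_space set"
  assumes T: "negligible T" "bounded T" and "0 < \<delta>" "0 < \<eta>"
  obtains u :: "nat \<Rightarrow> 'a" and l :: "nat \<Rightarrow> real"
    where "\<And>n. 0 \<le> l n" "\<And>n. real DIM('a) * l n < \<delta>"
      "T \<subseteq> (\<Union>n. cbox (u n) (u n + l n *\<^sub>R One))" "(\<Sum>n. ennreal (l n ^ DIM('a))) \<le> ennreal \<eta>"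
proof -
  obtain O' where O': "open O'" "T \<subseteq> O'" "emeasure lebesgue (O' - T) < ennreal \<eta>"
    using sets_lebesgue_outer_open[OF negligible_imp_sets[OF T(1)] \<open>0<\<eta>\<close>] by metis
  have "emeasure lebesgue O' \<le> emeasure lebesgue ((O' - T) \<union> T)"
    using O' T(1) by (intro emeasure_mono) (auto simp: negligible_imp_sets)
  also have "\<dots> \<le> emeasure lebesgue (O' - T) + emeasure lebesgue T"
    using O' T(1) by (intro emeasure_subadditive) (auto simp: negligible_imp_sets)
  also have "emeasure lebesgue T = 0" using negligible_iff_emeasure0[OF negligible_imp_sets[OF T(1)]] T(1) by blast
  finally have mO: "emeasure lebesgue O' \<le> ennreal \<eta>" using O'(3) by simp
  obtain r where r: "0 < r" "\<And>x. x \<in> T \<Longrightarrow> norm x < r" using bounded_pos_less[of T] T(2) by blast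
  have Tbox: "T \<subseteq> cbox (- r *\<^sub>R One) (r *\<^sub>R One)"
  proof
    fix x assume "x \<in> T"
    then have "\<bar>x \<bullet> i\<bar> \<le> r" if "i \<in> Basis" for i
      using r(2)[of x] Basis_le_norm[OF that, of x] by simp
    then show "x \<in> cbox (- r *\<^sub>R One) (r *\<^sub>R One)" by (auto simp: mem_box abs_le_iff minus_le_iff)
  qed
  have ne: "box (- r *\<^sub>R One) (r *\<^sub>R One :: 'a) \<noteq> {}" using r(1) by (auto simp: box_ne_empty)
  \<comment> \<open>A cube inside a ball of radius \<rho> has side below 2\<rho>, so DIM times the
    side is below \<delta>/2.\<close>
  define \<rho> where "\<rho> = \<delta> / (4 * real DIM('a))"
  have \<rho>: "\<rho> > 0" using \<open>0<\<delta>\<close> by (simp add: \<rho>_def)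
  define g where "g x = (if x \<in> O' then O' \<inter> ball x \<rho> else ball x \<rho>)" for x
  have "gauge g" using O'(1) \<rho> by (auto simp: gauge_def g_def)
  obtain \<D> where D: "countable \<D>" and "\<Union>\<D> \<subseteq> cbox (- r *\<^sub>R One) (r *\<^sub>R One)"
    and D2: "\<And>K. K \<in> \<D> \<Longrightarrow> interior K \<noteq> {} \<and> (\<exists>c d. K = cbox c d)"
    and D3: "pairwise (\<lambda>A B. interior A \<inter> interior B = {}) \<D>"
    and D4: "\<And>K. K \<in> \<D> \<Longrightarrow> \<exists>x \<in> T \<inter> K. K \<subseteq> g x"
    and D5: "\<And>u v. cbox u v \<in> \<D> \<Longrightarrow> \<exists>n. \<forall>i \<in> Basis. v \<bullet> i - u \<bullet> i = ((r *\<^sub>R One) \<bullet> i - (- r *\<^sub>R One) \<bullet> i) / 2^n"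
    and D6: "T \<subseteq> \<Union>\<D>"
    using covering_lemma[OF Tbox ne \<open>gauge g\<close>] by blast
  have "\<exists>u l. K = cbox u (u + l *\<^sub>R One) \<and> 0 < l" if K: "K \<in> \<D>" for K
  proof -
    obtain u v where uv: "K = cbox u v" using D2[OF K] by blast
    obtain n where n: "\<forall>i \<in> Basis. v \<bullet> i - u \<bullet> i = ((r *\<^sub>R One) \<bullet> i - (- r *\<^sub>R One) \<bullet> i) / 2^n"
      using D5 K uv by blast
    have "v = u + (2 * r / 2^n) *\<^sub>R One"
    proof (rule euclidean_eqI)
      fix i :: 'a assume i: "i \<in> Basis"
      have "v \<bullet> i - u \<bullet> i = 2 * r / 2^n" using bspec[OF n i] i by simp
      then show "v \<bullet> i = (u + (2 * r / 2^n) *\<^sub>R One) \<bullet> i" using i by (simp add: inner_add_left)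
    qed
    then show ?thesis using uv r(1) by (intro exI[of _ u] exI[of _ "2 * r / 2^n"]) auto
  qed
  then obtain U Lf where UL: "\<And>K. K \<in> \<D> \<Longrightarrow> K = cbox (U K) (U K + Lf K *\<^sub>R One) \<and> 0 < Lf K"
    by metis
  define ix where "ix = to_nat_on \<D>"
  define I where "I = ix ` \<D>"
  have ij: "inj_on ix \<D>" unfolding ix_def using D by (rule inj_on_to_nat_on)
  define k where "k n = inv_into \<D> ix n" for n
  have kD: "k n \<in> \<D>" if "n \<in> I" for n using that by (auto simp: k_def I_def inv_into_into)
  have kinj: "inj_on k I" unfolding k_def I_def by (rule inj_on_inv_into) simp
  \<comment> \<open>Numbers that index no cube get side 0: the closed box is then a single point,
    which does not hurt the cover, and the open box is empty.\<close>
  define l where "l n = (if n \<in> I then Lf (k n) else 0)" for n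
  define u where "u n = U (k n)" for n
  show thesis
  proof (rule that[of l u])
    show l0: "0 \<le> l n" for n using UL[OF kD] by (auto simp: l_def less_imp_le)
    show "real DIM('a) * l n < \<delta>" for n
    proof (cases "n \<in> I")
      case True
      let ?K = "k n"
      obtain x where x: "?K \<subseteq> ball x \<rho>" using D4[OF kD[OF True]] by (auto simp: g_def split: if_splits)
      define u0 l0 where "u0 = U ?K" and "l0 = Lf ?K"
      have K: "?K = cbox u0 (u0 + l0 *\<^sub>R One)" "0 < l0"
        using UL[OF kD[OF True]] by (auto simp: u0_def l0_def)
      obtain b :: 'a where b: "b \<in> Basis" using nonempty_Basis by blast
      have "u0 \<in> ?K" "u0 + l0 *\<^sub>R One \<in> ?K"
        unfolding K(1) using K(2) by (auto simp: mem_box inner_add_left)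
      then have "u0 \<in> ball x \<rho>" "u0 + l0 *\<^sub>R One \<in> ball x \<rho>" using x by blast+
      then have "dist u0 (u0 + l0 *\<^sub>R One) < 2 * \<rho>"
        using dist_triangle_less_add[of u0 x \<rho> "u0 + l0 *\<^sub>R One" \<rho>] by (simp add: dist_commute)
      moreover have "l0 \<le> norm (l0 *\<^sub>R One :: 'a)"
        using Basis_le_norm[OF b, of "l0 *\<^sub>R One"] b K(2) by simp
      ultimately have "l0 < 2 * \<rho>" by (simp add: dist_norm)
      then have "real DIM('a) * l0 < real DIM('a) * (2 * \<rho>)" by (intro mult_strict_left_mono) auto
      then show ?thesis using True \<open>0<\<delta>\<close> by (simp add: l_def l0_def \<rho>_def)
    qed (use \<open>0<\<delta>\<close> in \<open>simp add: l_def\<close>)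
    show "T \<subseteq> (\<Union>n. cbox (u n) (u n + l n *\<^sub>R One))"
    proof
      fix x assume "x \<in> T"
      then obtain K where K: "K \<in> \<D>" "x \<in> K" using D6 by blast
      have "k (ix K) = K" "ix K \<in> I" using ij K(1) by (auto simp: k_def I_def)
      then have "x \<in> cbox (u (ix K)) (u (ix K) + l (ix K) *\<^sub>R One)"
        using UL[OF K(1)] K(2) by (simp add: u_def l_def)
      then show "x \<in> (\<Union>n. cbox (u n) (u n + l n *\<^sub>R One))" by blast
    qed
    define B where "B n = box (u n) (u n + l n *\<^sub>R One)" for n
    have Bi: "B n = interior (k n)" if "n \<in> I" for n
      using UL[OF kD[OF that]] that interior_cbox[of "U (k n)" "U (k n) + Lf (k n) *\<^sub>R One"]
      by (simp add: B_def u_def l_def)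
    have Be: "B n = {}" if "n \<notin> I" for n
      using that nonempty_Basis by (auto simp: B_def l_def box_eq_empty)
    have disj: "disjoint_family B"
      unfolding disjoint_family_on_def
    proof (intro ballI impI)
      fix m n :: nat assume "m \<noteq> n"
      show "B m \<inter> B n = {}"
      proof (cases "m \<in> I \<and> n \<in> I")
        case True
        then have "k m \<noteq> k n" using kinj \<open>m\<noteq>n\<close> by (auto simp: inj_on_def)
        then show ?thesis using True Bi D3 kD unfolding pairwise_def by blast
      qed (use Be in auto)
    qed
    have sub: "(\<Union>n. B n) \<subseteq> O'"
    proof
      fix x assume "x \<in> (\<Union>n. B n)"
      then obtain n where n: "x \<in> B n" by blast
      then have nI: "n \<in> I" using Be by blast
      obtain y where "y \<in> T" "k n \<subseteq> g y" using D4[OF kD[OF nI]] by blast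
      then have "k n \<subseteq> O'" using O'(2) by (auto simp: g_def split: if_splits)
      then show "x \<in> O'" using n Bi[OF nI] interior_subset by blast
    qed
    have "ennreal (l n ^ DIM('a)) = emeasure lebesgue (B n)" for n
      using l0[of n] by (simp add: B_def emeasure_lborel_box inner_add_left)
    then have "(\<Sum>n. ennreal (l n ^ DIM('a))) = (\<Sum>n. emeasure lebesgue (B n))" by simp
    also have "\<dots> = emeasure lebesgue (\<Union>n. B n)"
      by (intro suminf_emeasure disj) (auto simp: B_def)
    also have "\<dots> \<le> emeasure lebesgue O'" using sub O'(1) by (intro emeasure_mono) auto
    finally show "(\<Sum>n. ennreal (l n ^ DIM('a))) \<le> ennreal \<eta>" using mO by simp
  qed
qed

lemma norm_diff_cube:
  fixes p q :: "'a::euclidean_space"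
  assumes "p \<in> cbox u (u + l *\<^sub>R One)" "q \<in> cbox u (u + l *\<^sub>R One)"
  shows "norm (p - q) \<le> real DIM('a) * l"
proof -
  have "norm (p - q) \<le> (\<Sum>b\<in>Basis. \<bar>(p - q) \<bullet> b\<bar>)" by (rule norm_le_l1)
  also have "\<dots> \<le> (\<Sum>b\<in>(Basis::'a set). l)"
    using assms by (intro sum_mono) (force simp: mem_box inner_add_left inner_diff_left abs_le_iff)
  finally show ?thesis by simp
qed

text \<open>Translating a fine cube cover of the tube below the graph by \<open>t e\<close> gives, for each \<open>t\<close>, a cover of
  the graph, and a cube is needed only for \<open>t\<close> in an interval of length comparable to its side; so averaging
  over \<open>t\<close> turns the \<open>(d - 1)\<close>-dimensional sums into volumes.\<close>

lemma hausdorff_outer_graph_null: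
  fixes N :: "'a::euclidean_space set" and e :: 'a
  assumes dim: "DIM('a) \<ge> 2" and e: "norm e = 1" and "0 \<le> L"
    and cone: "\<And>y y'. y \<in> N \<Longrightarrow> y' \<in> N \<Longrightarrow>
       \<bar>(y - y') \<bullet> e\<bar> \<le> L * norm ((y - y') - ((y - y') \<bullet> e) *\<^sub>R e)"
    and bN: "bounded N" and \<epsilon>: "0 < \<epsilon>" and Z: "negligible Z"
    and tube: "\<And>y t. y \<in> N \<Longrightarrow> 0 < t \<Longrightarrow> t < \<epsilon> \<Longrightarrow> y - t *\<^sub>R e \<in> Z"
  shows "hausdorff_outer (real DIM('a) - 1) N = 0"
proof -
  define D where "D = real DIM('a)"
  define s where "s = D - 1"
  define c where "c = hausdorff_coef s"
  have s: "s \<ge> 1" using dim by (simp add: s_def D_def)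
  have c: "c > 0" unfolding c_def using s by (intro hausdorff_coef_pos) simp
  have D: "D \<ge> 2" using s by (simp add: s_def)
  \<comment> \<open>If two points of \<open>N\<close>, lowered by t and t', land in one cube of side
    l, the cone condition gives |t - t'| \<le> (1 + L) D l = M l.\<close>
  define M where "M = (1 + L) * D"
  have M: "M > 0" using \<open>0 \<le> L\<close> D by (simp add: M_def)
  define T where "T = {y - t *\<^sub>R e | y t. y \<in> N \<and> 0 < t \<and> t < \<epsilon>}"
  have nT: "negligible T" by (rule negligible_subset[OF Z]) (use tube in \<open>auto simp: T_def\<close>)
  obtain r where r: "\<And>y. y \<in> N \<Longrightarrow> norm y \<le> r" using bN bounded_iff by blast
  have bT: "bounded T"
    unfolding bounded_iff
  proof (intro exI ballI)
    fix x assume "x \<in> T"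
    then obtain y t where "x = y - t *\<^sub>R e" "y \<in> N" "0 < t" "t < \<epsilon>" by (auto simp: T_def)
    then show "norm x \<le> r + \<epsilon>" using r[of y] e norm_triangle_ineq4[of y "t *\<^sub>R e"] by simp
  qed
  have approx0: "hausdorff_approx s \<delta> N = 0" if \<delta>: "\<delta> > 0" for \<delta>
  proof -
    define C where "C = c * D powr s * (2 * M)"
    have C: "C > 0" using c M D by (simp add: C_def)
    have bnd: "ennreal \<epsilon> * hausdorff_approx s \<delta> N \<le> ennreal C * ennreal \<eta>" if \<eta>: "\<eta> > 0" for \<eta>
    proof -
      obtain u :: "nat \<Rightarrow> 'a" and l where l': "\<And>n. 0 \<le> l n" "\<And>n. real DIM('a) * l n < \<delta>"
        and cov: "T \<subseteq> (\<Union>n. cbox (u n) (u n + l n *\<^sub>R One))"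
        and sm: "(\<Sum>n. ennreal (l n ^ DIM('a))) \<le> ennreal \<eta>"
        by (rule negligible_cube_cover[OF nT bT \<delta> \<eta>]) (rule that)
      note l = l'[folded D_def]
      define K where "K n = cbox (u n) (u n + l n *\<^sub>R One)" for n
      \<comment> \<open>These are the shifts for which cube n is needed. As \<open>N\<close> is
        arbitrary, \<open>J n\<close> may fail to be measurable, so it is enclosed in the interval
        \<open>I n\<close> around one of its points.\<close>
      define J where "J n = {t. \<exists>y\<in>N. y - t *\<^sub>R e \<in> K n}" for n
      define \<tau> where "\<tau> n = (SOME t. t \<in> J n)" for n
      define I where "I n = {\<tau> n - M * l n .. \<tau> n + M * l n}" for n
      have JI: "J n \<subseteq> I n" for n
      proof
        fix t assume t: "t \<in> J n"
        then have "\<tau> n \<in> J n" unfolding \<tau>_def by (rule someI)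
        then obtain y y' where y: "y \<in> N" "y - t *\<^sub>R e \<in> K n" and y': "y' \<in> N" "y' - \<tau> n *\<^sub>R e \<in> K n"
          using t by (auto simp: J_def)
        define p where "p = (y - t *\<^sub>R e) - (y' - \<tau> n *\<^sub>R e)"
        have np: "norm p \<le> D * l n"
          unfolding p_def D_def using y y' by (intro norm_diff_cube[of _ "u n"]) (auto simp: K_def)
        have ee: "e \<bullet> e = 1" using e by (simp add: norm_eq_1)
        have yy: "y - y' = p + (t - \<tau> n) *\<^sub>R e" by (simp add: p_def algebra_simps)
        have ye: "(y - y') \<bullet> e = p \<bullet> e + (t - \<tau> n)" unfolding yy by (simp add: inner_add_left ee)
        have "(y - y') - ((y - y') \<bullet> e) *\<^sub>R e = p - (p \<bullet> e) *\<^sub>R e"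
          unfolding ye unfolding yy by (simp add: algebra_simps)
        moreover have "norm (p - (p \<bullet> e) *\<^sub>R e) \<le> norm p"
        proof -
          have "(norm (p - (p \<bullet> e) *\<^sub>R e))\<^sup>2 = (norm p)\<^sup>2 - (p \<bullet> e)\<^sup>2"
            using e by (simp add: power2_norm_eq_inner inner_diff_left inner_diff_right ee inner_commute[of e p])
              (simp add: power2_eq_square)
          then show ?thesis by (auto intro: power2_le_imp_le[OF _ norm_ge_zero])
        qed
        ultimately have "\<bar>(y - y') \<bullet> e\<bar> \<le> L * norm p"
          using cone[OF y(1) y'(1)] \<open>0\<le>L\<close> by (metis mult_left_mono order_trans)
        moreover have "\<bar>p \<bullet> e\<bar> \<le> norm p" using Cauchy_Schwarz_ineq2[of p e] e by simp
        ultimately have "\<bar>t - \<tau> n\<bar> \<le> (1 + L) * norm p" unfolding ye by (simp add: algebra_simps) 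
        also have "\<dots> \<le> (1 + L) * (D * l n)" using np \<open>0\<le>L\<close> by (intro mult_left_mono) auto
        finally show "t \<in> I n" by (auto simp: I_def M_def mult.assoc)
      qed
      have le: "hausdorff_approx s \<delta> N \<le> (\<Sum>n. ennreal (c * (D * l n) powr s) * indicator (I n) t)"
        if t: "0 < t" "t < \<epsilon>" for t
      proof -
        define Cv where "Cv n = (if t \<in> J n then (\<lambda>x. x + t *\<^sub>R e) ` K n else {})" for n
        have dist: "dist x y \<le> D * l n" if "x \<in> Cv n" "y \<in> Cv n" for x y n
        proof -
          from that obtain p q where "p \<in> K n" "q \<in> K n" "x = p + t *\<^sub>R e" "y = q + t *\<^sub>R e"
            by (auto simp: Cv_def split: if_splits)
          then show ?thesis using norm_diff_cube[of p "u n" "l n" q] by (simp add: dist_norm K_def D_def)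
        qed
        have bC: "bounded (Cv n)" for n
          using dist unfolding bounded_def by blast
        have dC: "diameter (Cv n) \<le> D * l n" for n
          using dist l(1)[of n] D by (intro diameter_le) (auto simp: dist_norm)
        have "hausdorff_approx s \<delta> N \<le> (\<Sum>n. ennreal (hausdorff_coef s * diameter (Cv n) powr s))"
        proof (rule hausdorff_approx_le)
          show "N \<subseteq> (\<Union>n. Cv n)"
          proof
            fix y assume y: "y \<in> N"
            then have "y - t *\<^sub>R e \<in> T" using t by (auto simp: T_def)
            then obtain n where n: "y - t *\<^sub>R e \<in> K n" using cov by (auto simp: K_def)
            then have "t \<in> J n" using y by (auto simp: J_def)
            moreover have "y \<in> (\<lambda>x. x + t *\<^sub>R e) ` K n"
              using n by (intro image_eqI[of _ _ "y - t *\<^sub>R e"]) auto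
            ultimately have "y \<in> Cv n" by (simp add: Cv_def)
            then show "y \<in> (\<Union>n. Cv n)" by blast
          qed
        qed (use bC dC l(2) in \<open>auto intro: le_less_trans\<close>)
        also have "\<dots> \<le> (\<Sum>n. ennreal (c * (D * l n) powr s) * indicator (I n) t)"
        proof (rule suminf_le)
          fix n
          show "ennreal (hausdorff_coef s * diameter (Cv n) powr s)
             \<le> ennreal (c * (D * l n) powr s) * indicator (I n) t"
          proof (cases "t \<in> J n")
            case True
            then have "t \<in> I n" using JI by blast
            moreover have "diameter (Cv n) powr s \<le> (D * l n) powr s"
              using dC s bC by (intro powr_mono2) (auto simp: diameter_ge_0)
            ultimately show ?thesis using c by (auto intro!: ennreal_leI mult_left_mono simp: c_def)
          qed (simp add: Cv_def)
        qed auto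
        finally show ?thesis .
      qed
      \<comment> \<open>The premeasure does not depend on t. Averaging the cover bound over t in (0,
        \<epsilon>) multiplies each summand l^(D-1) by the length of \<open>I n\<close>, and a
        multiple of l^D results.\<close>
      have "ennreal \<epsilon> * hausdorff_approx s \<delta> N = (\<integral>\<^sup>+t. hausdorff_approx s \<delta> N * indicator {0<..<\<epsilon>} t \<partial>lborel)"
        using \<epsilon> by (subst nn_integral_cmult_indicator) (auto simp: mult.commute)
      also have "\<dots> \<le> (\<integral>\<^sup>+t. (\<Sum>n. ennreal (c * (D * l n) powr s) * indicator (I n) t) \<partial>lborel)"
        using le by (intro nn_integral_mono) (auto simp: indicator_def)
      also have "\<dots> = (\<Sum>n. \<integral>\<^sup>+t. ennreal (c * (D * l n) powr s) * indicator (I n) t \<partial>lborel)"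
        by (intro nn_integral_suminf) (auto simp: I_def)
      also have "\<dots> = (\<Sum>n. ennreal C * ennreal (l n ^ DIM('a)))"
      proof (rule suminf_cong)
        fix n
        have "(\<integral>\<^sup>+t. ennreal (c * (D * l n) powr s) * indicator (I n) t \<partial>lborel)
            = ennreal (c * (D * l n) powr s) * ennreal (2 * M * l n)"
          using l(1)[of n] M by (subst nn_integral_cmult_indicator) (auto simp: I_def mult.assoc)
        also have "\<dots> = ennreal (c * (D * l n) powr s * (2 * M * l n))"
          using c l(1)[of n] M by (intro ennreal_mult[symmetric]) auto
        also have "c * (D * l n) powr s * (2 * M * l n) = C * l n ^ DIM('a)"
        proof (cases "l n = 0")
          case True then show ?thesis using dim by (simp add: C_def)
        next
          case False
          then have pos: "l n > 0" using l(1)[of n] by simp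
          have "l n powr s * l n = l n powr (s + 1)" using pos by (simp add: powr_add)
          also have "\<dots> = l n ^ DIM('a)" using pos powr_realpow[of "l n" "DIM('a)"] by (simp add: s_def D_def)
          finally show ?thesis using pos D by (simp add: powr_mult C_def algebra_simps)
        qed
        also have "ennreal (C * l n ^ DIM('a)) = ennreal C * ennreal (l n ^ DIM('a))"
          using C l(1)[of n] by (intro ennreal_mult) auto
        finally show "(\<integral>\<^sup>+t. ennreal (c * (D * l n) powr s) * indicator (I n) t \<partial>lborel)
          = ennreal C * ennreal (l n ^ DIM('a))" .
      qed
      also have "\<dots> = ennreal C * (\<Sum>n. ennreal (l n ^ DIM('a)))" by (rule ennreal_suminf_cmult)
      also have "\<dots> \<le> ennreal C * ennreal \<eta>" using sm by (rule mult_left_mono) simp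
      finally show ?thesis .
    qed
    have "ennreal \<epsilon> * hausdorff_approx s \<delta> N \<le> 0"
    proof (rule ennreal_le_epsilon)
      fix \<eta> :: real assume "0 < \<eta>"
      then have "ennreal \<epsilon> * hausdorff_approx s \<delta> N \<le> ennreal C * ennreal (\<eta> / C)"
        using C by (intro bnd) simp
      also have "\<dots> = ennreal (C * (\<eta> / C))" using C \<open>0<\<eta>\<close> by (intro ennreal_mult[symmetric]) auto
      also have "\<dots> = 0 + ennreal \<eta>" using C by simp
      finally show "ennreal \<epsilon> * hausdorff_approx s \<delta> N \<le> 0 + ennreal \<eta>" .
    qed
    then show ?thesis using \<epsilon> by (simp add: ennreal_mult_eq_top_iff)
  qed
  then show ?thesis unfolding hausdorff_outer_def s_def D_def by simp
qed

text \<open>A cover set of diameter d < 1 is reached only from points of \<open>E\<close> in a box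
  with side 2d in every basis direction except \<open>b\<close>, where the side is 2d + R. Its
  volume is at most (R + 2)(2d)^(D-1), which is the covering weight up to a constant. Taking
  \<open>b\<close> from \<open>Basis\<close> makes these boxes parallel to the axes.\<close>

lemma emeasure_shadow_le_hausdorff:
  fixes A E :: "'a::euclidean_space set" and b :: 'a
  assumes dim: "DIM('a) \<ge> 2" and b: "b \<in> Basis" and R: "0 \<le> R"
    and E: "\<And>z. z \<in> E \<Longrightarrow> \<exists>t. 0 \<le> t \<and> t \<le> R \<and> z + t *\<^sub>R b \<in> A"
  shows "emeasure lborel E \<le>
    ennreal (2 powr (real DIM('a) - 1) * (R + 2) / hausdorff_coef (real DIM('a) - 1)) * hausdorff_outer (real DIM('a) - 1) A"
proof -
  define s where "s = real DIM('a) - 1"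
  define c where "c = hausdorff_coef s"
  have s: "s \<ge> 1" using dim by (simp add: s_def)
  have c: "c > 0" unfolding c_def using s by (intro hausdorff_coef_pos) simp
  define k where "k = 2 powr s * (R + 2) / c"
  have k: "k > 0" using c R by (simp add: k_def)
  have main: "emeasure lborel E \<le> ennreal k * (\<Sum>n. ennreal (c * diameter (C n) powr s))"
    if cov: "A \<subseteq> (\<Union>n. C n)" and C: "\<And>n. bounded (C n)" "\<And>n. diameter (C n) < 1" for C :: "nat \<Rightarrow> 'a set"
  proof -
    define a where "a n = (SOME x. x \<in> C n)" for n
    define d where "d n = diameter (C n)" for n
    have d0: "0 \<le> d n" for n unfolding d_def using C by (simp add: diameter_ge_0)
    define B where "B n = cbox (a n - d n *\<^sub>R One - R *\<^sub>R b) (a n + d n *\<^sub>R One)" for n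
    have "E \<subseteq> (\<Union>n. B n)"
    proof
      fix z assume "z \<in> E"
      then obtain t where t: "0 \<le> t" "t \<le> R" "z + t *\<^sub>R b \<in> A" using E by blast
      then obtain n where n: "z + t *\<^sub>R b \<in> C n" using cov by blast
      then have "a n \<in> C n" unfolding a_def by (rule someI)
      then have nd: "norm (z + t *\<^sub>R b - a n) \<le> d n"
        using n C(1)[of n] diameter_bounded_bound[of "C n" "z + t *\<^sub>R b" "a n"] by (simp add: d_def dist_norm)
      have "z \<in> B n"
        unfolding B_def mem_box
      proof
        fix i :: 'a assume i: "i \<in> Basis"
        have "\<bar>(z + t *\<^sub>R b - a n) \<bullet> i\<bar> \<le> d n" using Basis_le_norm[OF i] nd order_trans by blast
        moreover have "0 \<le> t * (b \<bullet> i)" "t * (b \<bullet> i) \<le> R * (b \<bullet> i)"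
          using t i b by (auto simp: inner_Basis)
        ultimately show "(a n - d n *\<^sub>R One - R *\<^sub>R b) \<bullet> i \<le> z \<bullet> i \<and> z \<bullet> i \<le> (a n + d n *\<^sub>R One) \<bullet> i"
          using i by (simp add: inner_add_left inner_diff_left abs_le_iff)
      qed
      then show "z \<in> (\<Union>n. B n)" by blast
    qed
    then have "emeasure lborel E \<le> emeasure lborel (\<Union>n. B n)"
      by (intro emeasure_mono) (auto simp: B_def)
    also have "\<dots> \<le> (\<Sum>n. emeasure lborel (B n))"
      by (intro emeasure_subadditive_countably) (auto simp: B_def)
    also have "\<dots> \<le> (\<Sum>n. ennreal k * ennreal (c * d n powr s))"
    proof (rule suminf_le)
      fix n
      have "emeasure lborel (B n) = ennreal (\<Prod>i\<in>Basis. (2 * d n + R * (b \<bullet> i)))"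
        unfolding B_def using d0[of n] R b
        by (subst emeasure_lborel_cbox) 
          (auto simp: inner_diff_left inner_add_left inner_Basis intro!: arg_cong[where f=ennreal] prod.cong)
      also have "(\<Prod>i\<in>Basis. (2 * d n + R * (b \<bullet> i))) 
          = (2 * d n + R * (b \<bullet> b)) * (\<Prod>i\<in>Basis - {b}. 2 * d n + R * (b \<bullet> i))"
        by (rule prod.remove[OF finite_Basis b])
      also have "(\<Prod>i\<in>Basis - {b}. 2 * d n + R * (b \<bullet> i)) = (\<Prod>i\<in>Basis - {b}. 2 * d n)"
        using b by (intro prod.cong) (auto simp: inner_Basis)
      also have "b \<bullet> b = 1" using b by simp
      also have "(\<Prod>i\<in>Basis - {b}. 2 * d n) = (2 * d n) ^ (DIM('a) - 1)" using b by simp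
      also have "(2 * d n + R * 1) * (2 * d n) ^ (DIM('a) - 1) \<le> (R + 2) * (2 * d n) ^ (DIM('a) - 1)"
        using d0[of n] C(2)[of n] by (intro mult_right_mono) (auto simp: d_def)
      also have "(2 * d n) ^ (DIM('a) - 1) = 2 powr s * d n powr s"
      proof (cases "d n = 0")
        case True then show ?thesis using dim by (simp add: power_0_left)
      next
        case False
        then have "0 < 2 * d n" using d0[of n] by simp
        then have "(2 * d n) ^ (DIM('a) - 1) = (2 * d n) powr s"
          using dim by (subst powr_realpow[symmetric]) (auto simp: s_def of_nat_diff)
        then show ?thesis using d0[of n] by (simp add: powr_mult)
      qed
      also have "(R + 2) * (2 powr s * d n powr s) = k * (c * d n powr s)" using c by (simp add: k_def)
      finally show "emeasure lborel (B n) \<le> ennreal k * ennreal (c * d n powr s)"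
        using c k by (simp add: ennreal_mult[symmetric] ennreal_leI)
    qed auto
    also have "\<dots> = ennreal k * (\<Sum>n. ennreal (c * d n powr s))" by (rule ennreal_suminf_cmult)
    finally show ?thesis by (simp add: d_def)
  qed
  \<comment> \<open>The factor is divided out first, so that the infimum over all covers can be
    taken on the right-hand side alone.\<close>
  have kinv: "ennreal (1 / k) * (ennreal k * x) = x" for x
    using k by (simp add: mult.assoc[symmetric] ennreal_mult[symmetric])
  have "ennreal (1 / k) * emeasure lborel E \<le> hausdorff_approx s 1 A"
    unfolding hausdorff_approx_def
  proof (rule INF_greatest, safe)
    fix C :: "nat \<Rightarrow> 'a set" assume "A \<subseteq> (\<Union>n. C n)" "\<forall>n. bounded (C n) \<and> diameter (C n) < 1"
    then have "ennreal (1 / k) * emeasure lborel E 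
      \<le> ennreal (1 / k) * (ennreal k * (\<Sum>n. ennreal (c * diameter (C n) powr s)))"
      by (intro mult_left_mono main) auto
    then show "ennreal (1 / k) * emeasure lborel E \<le> (\<Sum>n. ennreal (hausdorff_coef s * diameter (C n) powr s))"
      by (simp only: kinv c_def)
  qed
  also have "\<dots> \<le> hausdorff_outer s A" by (rule hausdorff_approx_le_outer) simp
  finally have "ennreal k * (ennreal (1 / k) * emeasure lborel E) \<le> ennreal k * hausdorff_outer s A"
    by (rule mult_left_mono) simp
  moreover have "ennreal k * (ennreal (1 / k) * emeasure lborel E) = emeasure lborel E"
    using k by (simp add: mult.assoc[symmetric] ennreal_mult[symmetric])
  ultimately show ?thesis unfolding k_def c_def s_def by simp
qed

section \<open>Sobolev functions\<close>

definition sqint :: "'a measure \<Rightarrow> ('a \<Rightarrow> real) \<Rightarrow> bool" where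
  "sqint M f \<longleftrightarrow> f \<in> borel_measurable M \<and> integrable M (\<lambda>x. (f x)\<^sup>2)"

lemma sqint_measurable [dest]: "sqint M f \<Longrightarrow> f \<in> borel_measurable M"
  and sqint_square: "sqint M f \<Longrightarrow> integrable M (\<lambda>x. (f x)\<^sup>2)"
  by (auto simp: sqint_def)

lemma L2_iff_sqint: "L2 \<Omega> f \<longleftrightarrow> sqint (lebesgue_on \<Omega>) f"
  by (simp add: L2_def sqint_def)

lemma sqint_mult: 
  assumes "sqint M f" "sqint M g" shows "integrable M (\<lambda>x. f x * g x)"
proof (rule Bochner_Integration.integrable_bound)
  show "integrable M (\<lambda>x. (f x)\<^sup>2 + (g x)\<^sup>2)" using assms by (simp add: sqint_def)
  show "(\<lambda>x. f x * g x) \<in> borel_measurable M" using assms by (auto simp: sqint_def)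
  have "\<bar>f x * g x\<bar> \<le> (f x)\<^sup>2 + (g x)\<^sup>2" for x
  proof -
    have "2 * \<bar>f x * g x\<bar> \<le> (f x)\<^sup>2 + (g x)\<^sup>2"
      using sum_squares_bound[of "\<bar>f x\<bar>" "\<bar>g x\<bar>"] by (simp add: abs_mult)
    then show ?thesis using abs_ge_zero[of "f x * g x"] by linarith
  qed
  then show "AE x in M. norm (f x * g x) \<le> norm ((f x)\<^sup>2 + (g x)\<^sup>2)" by auto
qed

lemma sqint_lincomb:
  assumes "sqint M f" "sqint M g" shows "sqint M (\<lambda>x. a * f x + b * g x)"
  unfolding sqint_def
proof
  show "(\<lambda>x. a * f x + b * g x) \<in> borel_measurable M" using assms by (auto simp: sqint_def)
  have "integrable M (\<lambda>x. a\<^sup>2 * (f x)\<^sup>2 + b\<^sup>2 * (g x)\<^sup>2 + (2 * a * b) * (f x * g x))"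
    using assms sqint_mult[OF assms] by (auto simp: sqint_def)
  then show "integrable M (\<lambda>x. (a * f x + b * g x)\<^sup>2)" 
    by (rule back_subst[of "integrable M"]) (auto simp: power2_eq_square algebra_simps)
qed

lemma sqint_scale: "sqint M f \<Longrightarrow> sqint M (\<lambda>x. a * f x)"
  using sqint_lincomb[of M f f a 0] by simp

lemma sqint_add: "sqint M f \<Longrightarrow> sqint M g \<Longrightarrow> sqint M (\<lambda>x. f x + g x)"
  using sqint_lincomb[of M f g 1 1] by simp

lemma sqint_diff: "sqint M f \<Longrightarrow> sqint M g \<Longrightarrow> sqint M (\<lambda>x. f x - g x)"
  using sqint_lincomb[of M f g 1 "-1"] by simp

lemma sqint_zero: "sqint M (\<lambda>x. 0)"
  by (simp add: sqint_def)

lemma sqint_sum: "(\<And>i. i \<in> I \<Longrightarrow> sqint M (f i)) \<Longrightarrow> sqint M (\<lambda>x. \<Sum>i\<in>I. f i x)"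
  by (induction I rule: infinite_finite_induct) (auto simp: sqint_zero intro!: sqint_add)

lemma sqint_bounded_mult:
  assumes f: "sqint M f" and g: "g \<in> borel_measurable M" "AE x in M. \<bar>g x\<bar> \<le> B"
  shows "sqint M (\<lambda>x. f x * g x)"
  unfolding sqint_def
proof
  show "(\<lambda>x. f x * g x) \<in> borel_measurable M" using assms by (auto simp: sqint_def)
  show "integrable M (\<lambda>x. (f x * g x)\<^sup>2)"
  proof (rule Bochner_Integration.integrable_bound)
    show "integrable M (\<lambda>x. B\<^sup>2 * (f x)\<^sup>2)" using f by (simp add: sqint_def)
    show "(\<lambda>x. (f x * g x)\<^sup>2) \<in> borel_measurable M" using f g by (auto simp: sqint_def)
    show "AE x in M. norm ((f x * g x)\<^sup>2) \<le> norm (B\<^sup>2 * (f x)\<^sup>2)"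
      using g(2)
    proof eventually_elim
      case (elim x)
      then have "(g x)\<^sup>2 \<le> B\<^sup>2" using power_mono[of "\<bar>g x\<bar>" B 2] by simp
      then show ?case by (simp add: power_mult_distrib mult.commute[of "B\<^sup>2"] mult_left_mono)
    qed
  qed
qed

lemma sqint_imp_integrable:
  assumes "finite_measure M" "sqint M f" shows "integrable M f"
proof -
  interpret finite_measure M by fact
  have "sqint M (\<lambda>x. 1)" by (simp add: sqint_def)
  from sqint_mult[OF assms(2) this] show ?thesis by simp
qed

lemma finite_measure_lebesgue_on:
  fixes \<Omega> :: "'a::euclidean_space set"
  assumes "open \<Omega>" "bounded \<Omega>" shows "finite_measure (lebesgue_on \<Omega>)"
proof (rule finite_measureI)
  have "\<Omega> \<in> lmeasurable" using assms by (simp add: lmeasurable_open)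
  then show "emeasure (lebesgue_on \<Omega>) (space (lebesgue_on \<Omega>)) \<noteq> \<infinity>"
    using fmeasurableD2[of \<Omega> lebesgue] fmeasurableD[of \<Omega> lebesgue]
    by (simp add: emeasure_restrict_space space_restrict_space)
qed

lemma borel_measurable_lebesgue_on: "f \<in> borel_measurable borel \<Longrightarrow> f \<in> borel_measurable (lebesgue_on \<Omega>)"
  by (intro measurable_restrict_space1 measurable_completion) simp

lemma sqint_bounded_borel:
  fixes \<Omega> :: "'a::euclidean_space set"
  assumes "open \<Omega>" "bounded \<Omega>" "f \<in> borel_measurable borel" "\<And>x. \<bar>f x\<bar> \<le> B"
  shows "sqint (lebesgue_on \<Omega>) f"
proof -
  interpret finite_measure "lebesgue_on \<Omega>" using finite_measure_lebesgue_on assms by blast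
  have "sqint (lebesgue_on \<Omega>) (\<lambda>x. 1)" by (simp add: sqint_def)
  from sqint_bounded_mult[OF this, of f B] show ?thesis using assms borel_measurable_lebesgue_on by auto
qed

section \<open>Continuously differentiable functions of compact support\<close>

lemma C1_grad_unique:
  assumes "C1_grad \<phi> G" "C1_grad \<phi> G'" shows "G = G'"
proof
  fix x
  have "(\<lambda>h. G x \<bullet> h) = (\<lambda>h. G' x \<bullet> h)"
    using assms unfolding C1_grad_def by (metis has_derivative_unique)
  then have "G x \<bullet> h = G' x \<bullet> h" for h by metis
  then show "G x = G' x" using vector_eq_rdot[of "G x" "G' x"] by blast
qed

lemma cgrad_eq: "C1_grad \<phi> G \<Longrightarrow> cgrad \<phi> = G"
  unfolding cgrad_def using C1_grad_unique by (intro some_equality)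

lemma C1c_C1_grad: "C1c \<phi> \<Longrightarrow> C1_grad \<phi> (cgrad \<phi>)"
  unfolding C1c_def using cgrad_eq by metis

lemma C1c_has_derivative: "C1c \<phi> \<Longrightarrow> (\<phi> has_derivative (\<lambda>h. cgrad \<phi> x \<bullet> h)) (at x)"
  using C1c_C1_grad unfolding C1_grad_def by blast

lemma continuous_on_cgrad: "C1c \<phi> \<Longrightarrow> continuous_on UNIV (cgrad \<phi>)"
  using C1c_C1_grad unfolding C1_grad_def by blast

lemma C1c_continuous: "C1c \<phi> \<Longrightarrow> continuous_on UNIV \<phi>"
  using C1c_has_derivative has_derivative_continuous
  by (metis continuous_at_imp_continuous_on)

lemma C1c_measurable: "C1c \<phi> \<Longrightarrow> \<phi> \<in> borel_measurable borel"
  by (intro borel_measurable_continuous_onI C1c_continuous)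

lemma cgrad_measurable: "C1c \<phi> \<Longrightarrow> cgrad \<phi> \<in> borel_measurable borel"
  by (intro borel_measurable_continuous_onI continuous_on_cgrad)

lemma cgrad_eq_0:
  assumes "C1c \<phi>" "x \<notin> closure {x. \<phi> x \<noteq> 0}" shows "cgrad \<phi> x = 0"
proof -
  let ?S = "- closure {x. \<phi> x \<noteq> 0}"
  have "(\<phi> has_derivative (\<lambda>h. 0)) (at x)"
    by (rule has_derivative_transform_within_open[of "\<lambda>_. 0" _ _ _ ?S])
      (use assms(2) closure_subset[of "{x. \<phi> x \<noteq> 0}"] in \<open>auto simp: open_Compl\<close>)
  then have "(\<lambda>h. cgrad \<phi> x \<bullet> h) = (\<lambda>h. 0)"
    using C1c_has_derivative[OF assms(1)] has_derivative_unique by blast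
  then show ?thesis by (metis inner_eq_zero_iff)
qed

lemma continuous_compact_support_bounded:
  fixes f :: "'a::euclidean_space \<Rightarrow> 'b::real_normed_vector"
  assumes "continuous_on UNIV f" "compact K" "\<And>x. x \<notin> K \<Longrightarrow> f x = 0"
  shows "\<exists>B. \<forall>x. norm (f x) \<le> B"
proof -
  have "bounded (f ` K)"
    using assms by (intro compact_imp_bounded compact_continuous_image) (auto intro: continuous_on_subset)
  then obtain B where B: "\<And>x. x \<in> K \<Longrightarrow> norm (f x) \<le> B" by (auto simp: bounded_iff)
  have "norm (f x) \<le> max B 0" for x
    using B[of x] assms(3)[of x] by (cases "x \<in> K") auto
  then show ?thesis by blast
qed

lemma C1c_bounded: assumes "C1c \<phi>" shows "\<exists>B. \<forall>x. \<bar>\<phi> x\<bar> \<le> B"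
proof -
  have "\<phi> x = 0" if "x \<notin> closure {x. \<phi> x \<noteq> 0}" for x
    using that closure_subset[of "{x. \<phi> x \<noteq> 0}"] by blast
  moreover have "compact (closure {x. \<phi> x \<noteq> 0})" using assms by (simp add: C1c_def)
  ultimately have "\<exists>B. \<forall>x. norm (\<phi> x) \<le> B"
    by (intro continuous_compact_support_bounded[OF C1c_continuous[OF assms]])
  then show ?thesis by (simp only: real_norm_def)
qed

lemma cgrad_bounded: assumes "C1c \<phi>" shows "\<exists>B. \<forall>x. norm (cgrad \<phi> x) \<le> B"
  by (rule continuous_compact_support_bounded[OF continuous_on_cgrad[OF assms], of "closure {x. \<phi> x \<noteq> 0}"])
    (use assms cgrad_eq_0[OF assms] in \<open>simp_all add: C1c_def\<close>)

lemma C1_grad_lincomb: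
  assumes "C1_grad \<phi> F" "C1_grad \<psi> G"
  shows "C1_grad (\<lambda>x. a * \<phi> x + b * \<psi> x) (\<lambda>x. a *\<^sub>R F x + b *\<^sub>R G x)"
  unfolding C1_grad_def
proof (intro conjI allI)
  show "continuous_on UNIV (\<lambda>x. a *\<^sub>R F x + b *\<^sub>R G x)"
    using assms by (auto simp: C1_grad_def intro!: continuous_intros)
  fix x
  have "(\<phi> has_derivative (\<lambda>h. F x \<bullet> h)) (at x)" "(\<psi> has_derivative (\<lambda>h. G x \<bullet> h)) (at x)"
    using assms by (auto simp: C1_grad_def)
  then have "((\<lambda>x. a * \<phi> x + b * \<psi> x) has_derivative (\<lambda>h. a * (F x \<bullet> h) + b * (G x \<bullet> h))) (at x)"
    by (intro derivative_intros)
  then show "((\<lambda>x. a * \<phi> x + b * \<psi> x) has_derivative (\<lambda>h. (a *\<^sub>R F x + b *\<^sub>R G x) \<bullet> h)) (at x)"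
    by (simp add: inner_add_left)
qed

lemma C1c_lincomb:
  assumes "C1c \<phi>" "C1c \<psi>"
  shows "C1c (\<lambda>x. a * \<phi> x + b * \<psi> x)"
    and "cgrad (\<lambda>x. a * \<phi> x + b * \<psi> x) = (\<lambda>x. a *\<^sub>R cgrad \<phi> x + b *\<^sub>R cgrad \<psi> x)"
proof -
  note g = C1_grad_lincomb[OF C1c_C1_grad[OF assms(1)] C1c_C1_grad[OF assms(2)], of a b]
  show "cgrad (\<lambda>x. a * \<phi> x + b * \<psi> x) = (\<lambda>x. a *\<^sub>R cgrad \<phi> x + b *\<^sub>R cgrad \<psi> x)"
    by (rule cgrad_eq[OF g])
  have "{x. a * \<phi> x + b * \<psi> x \<noteq> 0} \<subseteq> closure {x. \<phi> x \<noteq> 0} \<union> closure {x. \<psi> x \<noteq> 0}"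
    using closure_subset[of "{x. \<phi> x \<noteq> 0}"] closure_subset[of "{x. \<psi> x \<noteq> 0}"] by force
  then have "closure {x. a * \<phi> x + b * \<psi> x \<noteq> 0} \<subseteq> closure {x. \<phi> x \<noteq> 0} \<union> closure {x. \<psi> x \<noteq> 0}"
    by (intro closure_minimal) auto
  moreover have "compact (closure {x. \<phi> x \<noteq> 0} \<union> closure {x. \<psi> x \<noteq> 0})"
    using assms by (intro compact_Un) (auto simp: C1c_def)
  ultimately have "compact (closure {x. a * \<phi> x + b * \<psi> x \<noteq> 0})"
    by (meson bounded_subset closed_closure compact_eq_bounded_closed)
  then show "C1c (\<lambda>x. a * \<phi> x + b * \<psi> x)" using g unfolding C1c_def by blast
qed

section \<open>C1 bumps decreasing to the indicator of a box\<close>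

definition sqpos :: "real \<Rightarrow> real" where "sqpos t = (max 0 t)\<^sup>2"

lemma sqpos_derivative: "(sqpos has_real_derivative 2 * max 0 t) (at t)"
proof -
  consider "t < 0" | "t > 0" | "t = 0" by linarith
  then show ?thesis
  proof cases
    case 1
    have "((\<lambda>_. 0) has_real_derivative 0) (at t)" by simp
    then have "(sqpos has_real_derivative 0) (at t)"
      by (rule has_field_derivative_transform_within_open[of _ _ _ "{..<0}"]) (use 1 in \<open>auto simp: sqpos_def\<close>)
    then show ?thesis using 1 by (simp add: max_def)
  next
    case 2
    have "((\<lambda>t. t\<^sup>2) has_real_derivative 2 * t) (at t)" by (auto intro!: derivative_eq_intros)
    then have "(sqpos has_real_derivative 2 * t) (at t)"
      by (rule has_field_derivative_transform_within_open[of _ _ _ "{0<..}"]) (use 2 in \<open>auto simp: sqpos_def\<close>)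
    then show ?thesis using 2 by (simp add: max_def)
  next
    case 3
    have "(\<lambda>h. (sqpos (0 + h) - sqpos 0) / h) \<midarrow>0\<rightarrow> 0"
    proof (rule Lim_null_comparison)
      show "\<forall>\<^sub>F h in at 0. norm ((sqpos (0 + h) - sqpos 0) / h) \<le> \<bar>h\<bar>"
        by (auto simp: sqpos_def max_def power2_eq_square)
      show "(\<lambda>h::real. \<bar>h\<bar>) \<midarrow>0\<rightarrow> 0" by (rule tendsto_rabs_zero) simp
    qed
    then show ?thesis using 3 by (simp add: DERIV_def)
  qed
qed

lemma sqpos_nonneg [simp]: "0 \<le> sqpos t" and sqpos_eq_0: "sqpos t = 0 \<longleftrightarrow> t \<le> 0"
  by (auto simp: sqpos_def max_def)

text \<open>For a nonempty box this is the squared Euclidean distance to it. Squares of positive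
  parts are C1, so the function is C1 across the faces of the box.\<close>

definition boxdist :: "real^'d \<Rightarrow> real^'d \<Rightarrow> real^'d \<Rightarrow> real" where
  "boxdist a b x = (\<Sum>i\<in>UNIV. sqpos (a $ i - x $ i) + sqpos (x $ i - b $ i))"

lemma boxdist_C1:
  fixes a b :: "real^'d"
  shows "C1_grad (boxdist a b) (\<lambda>x. \<chi> i. 2 * max 0 (x $ i - b $ i) - 2 * max 0 (a $ i - x $ i))"
  unfolding C1_grad_def
proof (intro conjI allI)
  show "continuous_on UNIV (\<lambda>x. \<chi> i. 2 * max 0 (x $ i - b $ i) - 2 * max 0 (a $ i - x $ i))"
    by (intro continuous_intros continuous_on_max)
  fix x :: "real^'d"
  have s: "(sqpos has_derivative (\<lambda>h. 2 * max 0 t * h)) (at t)" for t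
    using sqpos_derivative[of t] by (simp add: has_field_derivative_def)
  have d: "((\<lambda>y::real^'d. y $ i) has_derivative (\<lambda>h. h $ i)) (at x)" for i
    by (simp add: bounded_linear_imp_has_derivative bounded_linear_vec_nth)
  have "((\<lambda>y::real^'d. sqpos (a $ i - y $ i) + sqpos (y $ i - b $ i)) has_derivative
     (\<lambda>h. (2 * max 0 (x $ i - b $ i) - 2 * max 0 (a $ i - x $ i)) * h $ i)) (at x)" for i :: 'd
  proof -
    have 1: "((\<lambda>y::real^'d. a $ i - y $ i) has_derivative (\<lambda>h. 0 - h $ i)) (at x)" by (intro derivative_intros d)
    have 2: "((\<lambda>y::real^'d. y $ i - b $ i) has_derivative (\<lambda>h. h $ i - 0)) (at x)" by (intro derivative_intros d)
    have "((\<lambda>y::real^'d. sqpos (a $ i - y $ i) + sqpos (y $ i - b $ i)) has_derivative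
       (\<lambda>h. 2 * max 0 (a $ i - x $ i) * (0 - h $ i) + 2 * max 0 (x $ i - b $ i) * (h $ i - 0))) (at x)"
      by (intro has_derivative_add has_derivative_compose[OF 1 s] has_derivative_compose[OF 2 s])
    then show ?thesis by (simp add: algebra_simps)
  qed
  then have "(boxdist a b has_derivative (\<lambda>h. \<Sum>i\<in>UNIV. (2 * max 0 (x $ i - b $ i) - 2 * max 0 (a $ i - x $ i)) * h $ i)) (at x)"
    unfolding boxdist_def by (intro has_derivative_sum)
  then show "(boxdist a b has_derivative (\<lambda>h. (\<chi> i. 2 * max 0 (x $ i - b $ i) - 2 * max 0 (a $ i - x $ i)) \<bullet> h)) (at x)"
    by (simp add: inner_vec_def)
qed

lemma boxdist_eq_0: "boxdist a b x = 0 \<longleftrightarrow> x \<in> cbox a b"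
  unfolding boxdist_def
  by (subst sum_nonneg_eq_0_iff) (auto simp: add_nonneg_eq_0_iff sqpos_eq_0 mem_box_cart)

lemma boxdist_nonneg: "0 \<le> boxdist a b x"
  unfolding boxdist_def by (intro sum_nonneg) simp

lemma boxdist_ge:
  assumes "cbox a b \<noteq> {}"
  shows "\<exists>p\<in>cbox a b. (dist x p)\<^sup>2 = boxdist a b x"
proof
  have ab: "a $ i \<le> b $ i" for i using assms by (auto simp: interval_ne_empty_cart)
  let ?p = "\<chi> i. max (a $ i) (min (b $ i) (x $ i))"
  show "?p \<in> cbox a b" using ab by (simp add: mem_box_cart)
  have "(dist x ?p)\<^sup>2 = (\<Sum>i\<in>UNIV. (x $ i - ?p $ i)\<^sup>2)"
    by (simp add: dist_norm norm_vec_def L2_set_def sum_nonneg)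
  also have "\<dots> = boxdist a b x"
    unfolding boxdist_def
  proof (rule sum.cong)
    fix i
    show "(x $ i - ?p $ i)\<^sup>2 = sqpos (a $ i - x $ i) + sqpos (x $ i - b $ i)"
      using ab[of i] by (auto simp: sqpos_def max_def min_def power2_commute)
  qed simp
  finally show "(dist x ?p)\<^sup>2 = boxdist a b x" .
qed

text \<open>Equal to 1 on the box and to 0 once the squared distance reaches 1/(n+1). Test functions
  in the sense of \<open>C1c\<close> are C1, so this explicit formula can replace a mollified
  indicator.\<close>

definition boxbump :: "real^'d \<Rightarrow> real^'d \<Rightarrow> nat \<Rightarrow> real^'d \<Rightarrow> real" where
  "boxbump a b n x = sqpos (1 - (real n + 1) * boxdist a b x)"

text \<open>The support lies within distance (n+1)^(-1/2) of the compact box, and a compact subset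
  of an open set has a whole neighbourhood of fixed radius inside it.\<close>

lemma boxbump_C1c:
  fixes a b :: "real^'d"
  assumes ne: "cbox a b \<noteq> {}" and "open \<Omega>" "cbox a b \<subseteq> \<Omega>"
  shows "C1c (boxbump a b n)" 
    and "\<forall>\<^sub>F n in sequentially. closure {x. boxbump a b n x \<noteq> 0} \<subseteq> \<Omega>"
proof -
  obtain G where G: "C1_grad (boxdist a b) G" using boxdist_C1 by blast
  have cG: "continuous_on UNIV G" and dG: "(boxdist a b has_derivative (\<lambda>h. G x \<bullet> h)) (at x)" for x
    using G by (auto simp: C1_grad_def)
  have cb: "continuous_on UNIV (boxdist a b)"
    using dG has_derivative_continuous by (metis continuous_at_imp_continuous_on)
  let ?F = "\<lambda>x. (2 * max 0 (1 - (real n + 1) * boxdist a b x) * - (real n + 1)) *\<^sub>R G x"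
  have "C1_grad (boxbump a b n) ?F"
    unfolding C1_grad_def
  proof (intro conjI allI)
    show "continuous_on UNIV ?F"
      by (intro continuous_intros cG cb continuous_on_max)
    fix x
    have s: "(sqpos has_derivative (\<lambda>h. 2 * max 0 t * h)) (at t)" for t
      using sqpos_derivative[of t] by (simp add: has_field_derivative_def)
    have 1: "((\<lambda>y. 1 - (real n + 1) * boxdist a b y) has_derivative (\<lambda>h. 0 - (real n + 1) * (G x \<bullet> h))) (at x)"
      by (intro derivative_intros dG)
    show "(boxbump a b n has_derivative (\<lambda>h. ?F x \<bullet> h)) (at x)"
      using has_derivative_compose[OF 1 s] unfolding boxbump_def
      by (rule back_subst[where P="\<lambda>F. (_ has_derivative F) _"]) (simp add: fun_eq_iff algebra_simps)
  qed
  moreover have clos: "closure {x. boxbump a b n x \<noteq> 0} \<subseteq> {x. boxdist a b x \<le> 1 / (real n + 1)}" for n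
  proof (rule closure_minimal)
    show "{x. boxbump a b n x \<noteq> 0} \<subseteq> {x. boxdist a b x \<le> 1 / (real n + 1)}"
      by (auto simp: boxbump_def sqpos_eq_0 field_simps)
    show "closed {x. boxdist a b x \<le> 1 / (real n + 1)}"
      by (intro closed_Collect_le cb continuous_intros)
  qed
  have near: "\<exists>p\<in>cbox a b. dist x p \<le> r" if "boxdist a b x \<le> r\<^sup>2" "0 \<le> r" for x r
    using boxdist_ge[OF ne, of x] that by (metis abs_le_square_iff abs_of_nonneg zero_le_dist)
  obtain R where R: "\<And>p. p \<in> cbox a b \<Longrightarrow> norm p \<le> R" using bounded_cbox bounded_iff by metis
  have "bounded {x. boxdist a b x \<le> 1 / (real n + 1)}"
    unfolding bounded_iff
  proof (intro exI ballI)
    fix x assume "x \<in> {x. boxdist a b x \<le> 1 / (real n + 1)}"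
    then have "boxdist a b x \<le> 1 / (real n + 1)" by simp
    also have "\<dots> \<le> 1\<^sup>2" by simp
    finally obtain p where p: "p \<in> cbox a b" "dist x p \<le> 1" using near[of x 1] zero_le_one by blast
    then show "norm x \<le> R + 1" using R[OF p(1)] norm_triangle_sub[of x p] by (simp add: dist_norm)
  qed
  then have "compact (closure {x. boxbump a b n x \<noteq> 0})"
    using clos[of n] by (meson bounded_subset closed_closure compact_eq_bounded_closed)
  ultimately show "C1c (boxbump a b n)" unfolding C1c_def by blast
  obtain e where e: "e > 0" "(\<Union>x\<in>cbox a b. ball x e) \<subseteq> \<Omega>"
    using compact_subset_open_imp_ball_epsilon_subset[OF compact_cbox assms(2,3)] by blast
  have "(\<lambda>n. 1 / (real n + 1)) \<longlonglongrightarrow> 0" using LIMSEQ_inverse_real_of_nat by (simp add: inverse_eq_divide add.commute)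
  then have "\<forall>\<^sub>F n in sequentially. 1 / (real n + 1) < (e/2)\<^sup>2"
    using e(1) by (intro order_tendstoD) auto
  then show "\<forall>\<^sub>F n in sequentially. closure {x. boxbump a b n x \<noteq> 0} \<subseteq> \<Omega>"
  proof eventually_elim
    case (elim n)
    show ?case
    proof
      fix x assume "x \<in> closure {x. boxbump a b n x \<noteq> 0}"
      then have "boxdist a b x \<le> (e/2)\<^sup>2" using clos[of n] elim by force
      then obtain p where "p \<in> cbox a b" "dist x p \<le> e/2" using near[of x "e/2"] e(1) by auto
      then have "x \<in> (\<Union>x\<in>cbox a b. ball x e)" using e(1) by (intro UN_I[of p]) (auto simp: dist_commute)
      then show "x \<in> \<Omega>" using e(2) by blast
    qed
  qed
qed

lemma boxbump_tendsto: "(\<lambda>n. boxbump a b n x) \<longlonglongrightarrow> indicator (cbox a b) x"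
proof (cases "x \<in> cbox a b")
  case True
  then have "boxbump a b n x = 1" for n by (simp add: boxbump_def boxdist_eq_0[THEN iffD2] sqpos_def)
  then show ?thesis using True by simp
next
  case False
  then have pos: "boxdist a b x > 0" using boxdist_eq_0[of a b x] boxdist_nonneg[of a b x] by linarith
  obtain N where N: "1 / boxdist a b x < real N" using reals_Archimedean2 by blast
  have "boxbump a b n x = 0" if "n \<ge> N" for n
  proof -
    have "1 / boxdist a b x < real n + 1" using N that by simp
    then have "1 \<le> (real n + 1) * boxdist a b x" using pos by (simp add: field_simps)
    then show ?thesis by (simp add: boxbump_def sqpos_eq_0)
  qed
  then have "\<forall>\<^sub>F n in sequentially. boxbump a b n x = 0" by (auto simp: eventually_sequentially)
  then show ?thesis using False by (simp add: tendsto_eventually)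
qed

lemma boxbump_le_1: "\<bar>boxbump a b n x\<bar> \<le> 1"
proof -
  have "1 - (real n + 1) * boxdist a b x \<le> 1" using boxdist_nonneg[of a b x] by simp
  then have "max 0 (1 - (real n + 1) * boxdist a b x) \<le> 1" by simp
  then show ?thesis unfolding boxbump_def sqpos_def by (simp add: power_le_one)
qed

text \<open>Testing with the bumps and passing to the limit by dominated convergence, the integral
  of f over every box inside \<Omega> vanishes. Lebesgue differentiation along cubes with a corner
  at x then gives f x = 0 for almost every x.\<close>

lemma fundamental_lemma_calculus_of_variations:
  fixes \<Omega> :: "(real^'d) set"
  assumes \<Omega>: "open \<Omega>" and f: "integrable (lebesgue_on \<Omega>) f"
    and zero: "\<And>\<phi>. C1c \<phi> \<Longrightarrow> closure {x. \<phi> x \<noteq> 0} \<subseteq> \<Omega> \<Longrightarrow> (\<integral>x. f x * \<phi> x \<partial>lebesgue_on \<Omega>) = 0"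
  shows "AE x in lebesgue_on \<Omega>. f x = 0"
proof -
  have \<Omega>m: "\<Omega> \<in> sets lebesgue" using \<Omega> by simp
  have box0: "(\<integral>x. f x * indicator (cbox a b) x \<partial>lebesgue_on \<Omega>) = 0" if "cbox a b \<subseteq> \<Omega>" for a b
  proof (cases "cbox a b = {}")
    case False
    have fm: "f \<in> borel_measurable (lebesgue_on \<Omega>)" using f by auto
    have bm: "boxbump a b n \<in> borel_measurable (lebesgue_on \<Omega>)" for n
      using C1c_measurable[OF boxbump_C1c(1)[OF False \<Omega> that]] by (rule borel_measurable_lebesgue_on)
    have "(\<lambda>n. \<integral>x. f x * boxbump a b n x \<partial>lebesgue_on \<Omega>) \<longlonglongrightarrow> (\<integral>x. f x * indicator (cbox a b) x \<partial>lebesgue_on \<Omega>)"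
    proof (rule integral_dominated_convergence[where w="\<lambda>x. \<bar>f x\<bar>"])
      show "(\<lambda>x. f x * indicator (cbox a b) x) \<in> borel_measurable (lebesgue_on \<Omega>)"
        by (intro borel_measurable_times[OF fm] borel_measurable_lebesgue_on) auto
      show "(\<lambda>x. f x * boxbump a b n x) \<in> borel_measurable (lebesgue_on \<Omega>)" for n
        using fm bm by (intro borel_measurable_times)
      show "integrable (lebesgue_on \<Omega>) (\<lambda>x. \<bar>f x\<bar>)" using f by simp
      show "AE x in lebesgue_on \<Omega>. (\<lambda>n. f x * boxbump a b n x) \<longlonglongrightarrow> f x * indicator (cbox a b) x"
        by (intro AE_I2 tendsto_intros boxbump_tendsto)
      show "AE x in lebesgue_on \<Omega>. norm (f x * boxbump a b n x) \<le> \<bar>f x\<bar>" for n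
        using boxbump_le_1[of a b n] by (intro AE_I2) (simp add: abs_mult mult_left_le)
    qed
    moreover have "\<forall>\<^sub>F n in sequentially. (\<integral>x. f x * boxbump a b n x \<partial>lebesgue_on \<Omega>) = 0"
      using boxbump_C1c(2)[OF False \<Omega> that] by eventually_elim (intro zero boxbump_C1c(1)[OF False \<Omega> that])
    ultimately show ?thesis by (intro LIMSEQ_unique[OF _ tendsto_eventually])
  qed simp
  \<comment> \<open>Extension by 0, because the differentiation theorem asks for integrability over
    all boxes of the whole space.\<close>
  define F where "F x = (if x \<in> \<Omega> then f x else 0)" for x
  have Fint: "integrable lebesgue F"
  proof -
    have "integrable lebesgue (\<lambda>x. indicator \<Omega> x *\<^sub>R f x)"
      using f \<Omega>m by (subst (asm) integrable_restrict_space) auto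
    then show ?thesis by (rule back_subst[of "integrable lebesgue"]) (auto simp: F_def fun_eq_iff)
  qed
  have Fi: "integrable (lebesgue_on (cbox a b)) F" for a b :: "real^'d"
    using integrable_mult_indicator[OF _ Fint, of "cbox a b"] by (simp add: integrable_restrict_space)
  have Fon: "F integrable_on cbox a b" for a b :: "real^'d"
    using Fi by (rule integrable_on_lebesgue_on) simp
  have Fbox: "integral (cbox a b) F = 0" if "cbox a b \<subseteq> \<Omega>" for a b
  proof -
    have "integral (cbox a b) F = (\<integral>x. F x \<partial>lebesgue_on (cbox a b))"
      using Fi by (intro lebesgue_integral_eq_integral[symmetric]) auto
    also have "\<dots> = (\<integral>x. indicator (cbox a b) x *\<^sub>R F x \<partial>lebesgue)"
      by (subst integral_restrict_space) auto
    also have "\<dots> = (\<integral>x. indicator \<Omega> x *\<^sub>R (f x * indicator (cbox a b) x) \<partial>lebesgue)"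
      using that by (intro Bochner_Integration.integral_cong) (auto simp: F_def indicator_def)
    also have "\<dots> = (\<integral>x. f x * indicator (cbox a b) x \<partial>lebesgue_on \<Omega>)"
      using \<Omega>m by (subst integral_restrict_space) auto
    finally show ?thesis using box0[OF that] by simp
  qed
  obtain N where N: "negligible N"
    "\<And>x e. \<lbrakk>x \<notin> N; 0 < e\<rbrakk> \<Longrightarrow> \<exists>d>0. \<forall>h. 0 < h \<and> h < d \<longrightarrow>
        norm (integral (cbox x (x + h *\<^sub>R One)) F /\<^sub>R h ^ DIM(real^'d) - F x) < e"
    using integrable_ccontinuous_explicit[of F] Fon by metis
  have fz: "f x = 0" if x: "x \<in> \<Omega>" "x \<notin> N" for x
  proof (rule ccontr)
    assume "f x \<noteq> 0"
    then obtain d where d: "d > 0" "\<And>h. 0 < h \<Longrightarrow> h < d \<Longrightarrow>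
        norm (integral (cbox x (x + h *\<^sub>R One)) F /\<^sub>R h ^ DIM(real^'d) - F x) < \<bar>f x\<bar>"
      using N(2)[OF x(2), of "\<bar>f x\<bar>"] by auto
    obtain r where r: "r > 0" "ball x r \<subseteq> \<Omega>" using \<Omega> x(1) openE by blast
    \<comment> \<open>Small enough for the differentiation estimate (h < d) and for the cube to stay
      in the ball, since its points are within DIM times h of x in the l1 norm.\<close>
    define h where "h = min (d/2) (r / (2 * real DIM(real^'d)))"
    have h: "0 < h" "h < d" "real DIM(real^'d) * h < r"
    proof -
      show "0 < h" "h < d" using d(1) r(1) by (auto simp: h_def)
      have "real DIM(real^'d) * h \<le> real DIM(real^'d) * (r / (2 * real DIM(real^'d)))"
        by (intro mult_left_mono) (auto simp: h_def)
      also have "\<dots> = r / 2" by (simp del: DIM_cart)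
      finally show "real DIM(real^'d) * h < r" using r(1) by simp
    qed
    have "cbox x (x + h *\<^sub>R One) \<subseteq> \<Omega>"
    proof
      fix y assume y: "y \<in> cbox x (x + h *\<^sub>R One)"
      have "norm (y - x) \<le> (\<Sum>b\<in>Basis. \<bar>(y - x) \<bullet> b\<bar>)" by (rule norm_le_l1)
      also have "\<dots> \<le> (\<Sum>b\<in>(Basis::(real^'d) set). h)"
        using y by (intro sum_mono) (force simp: mem_box inner_add_left inner_diff_left abs_le_iff)
      also have "\<dots> < r" using h(3) by simp
      finally show "y \<in> \<Omega>" using r(2) by (auto simp: dist_norm norm_minus_commute)
    qed
    then show False using d(2)[OF h(1,2)] Fbox x(1) by (simp add: F_def)
  qed
  have "AE x in lebesgue. x \<notin> N" using N(1) by (simp add: negligible_iff_null_sets AE_not_in)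
  then have "AE x in lebesgue. x \<in> \<Omega> \<longrightarrow> f x = 0" by eventually_elim (use fz in auto)
  then show ?thesis using \<Omega>m by (subst AE_restrict_space_iff) auto
qed

section \<open>Weak gradients and their linear combinations\<close>

lemma L2v_sqint: "L2v \<Omega> G \<longleftrightarrow> (\<forall>i. sqint (lebesgue_on \<Omega>) (\<lambda>x. G x $ i))"
  by (simp add: L2v_def L2_iff_sqint)

lemma C1c_sqint:
  fixes \<Omega> :: "(real^'d) set"
  assumes "open \<Omega>" "bounded \<Omega>" "C1c \<phi>"
  shows "sqint (lebesgue_on \<Omega>) \<phi>" and "sqint (lebesgue_on \<Omega>) (\<lambda>x. cgrad \<phi> x $ i)"
proof -
  show "sqint (lebesgue_on \<Omega>) \<phi>"
    using C1c_bounded[OF assms(3)] sqint_bounded_borel[OF assms(1,2) C1c_measurable[OF assms(3)]] by blast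
  obtain B where B: "\<And>x. norm (cgrad \<phi> x) \<le> B" using cgrad_bounded[OF assms(3)] by blast
  have "(\<lambda>x. cgrad \<phi> x $ i) \<in> borel_measurable borel"
    using continuous_on_cgrad[OF assms(3)] by (intro borel_measurable_continuous_onI continuous_intros)
  then show "sqint (lebesgue_on \<Omega>) (\<lambda>x. cgrad \<phi> x $ i)"
    using B component_le_norm_cart[of "cgrad \<phi> _" i] order_trans
    by (intro sqint_bounded_borel[OF assms(1,2), of _ B]) blast+
qed

text \<open>Each component of the difference of two weak gradients integrates to 0 against every
  test function; it is integrable because the domain has finite measure.\<close>

lemma weak_grad_unique:
  fixes \<Omega> :: "(real^'d) set"
  assumes \<Omega>: "open \<Omega>" "bounded \<Omega>" and G: "weak_grad \<Omega> f G" "weak_grad \<Omega> f G'"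
  shows "AE x in lebesgue_on \<Omega>. G x = G' x"
proof -
  have "AE x in lebesgue_on \<Omega>. G x $ i - G' x $ i = 0" for i
  proof (rule fundamental_lemma_calculus_of_variations[OF \<Omega>(1)])
    have sq: "sqint (lebesgue_on \<Omega>) (\<lambda>x. G x $ i)" "sqint (lebesgue_on \<Omega>) (\<lambda>x. G' x $ i)"
      using G by (auto simp: weak_grad_def L2v_sqint)
    show "integrable (lebesgue_on \<Omega>) (\<lambda>x. G x $ i - G' x $ i)"
      using sqint_imp_integrable[OF finite_measure_lebesgue_on[OF \<Omega>] sqint_diff[OF sq]] .
    fix \<phi> :: "real^'d \<Rightarrow> real" assume \<phi>: "C1c \<phi>" "closure {x. \<phi> x \<noteq> 0} \<subseteq> \<Omega>"
    have "(\<integral>x. (G x $ i - G' x $ i) * \<phi> x \<partial>lebesgue_on \<Omega>)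
      = (\<integral>x. G x $ i * \<phi> x \<partial>lebesgue_on \<Omega>) - (\<integral>x. G' x $ i * \<phi> x \<partial>lebesgue_on \<Omega>)"
      unfolding left_diff_distrib
      by (intro Bochner_Integration.integral_diff sqint_mult sq C1c_sqint[OF \<Omega> \<phi>(1)])
    also have "\<dots> = 0" 
    proof -
      have "- (\<integral>x. G x $ i * \<phi> x \<partial>lebesgue_on \<Omega>) = - (\<integral>x. G' x $ i * \<phi> x \<partial>lebesgue_on \<Omega>)"
        using G \<phi> unfolding weak_grad_def by (metis (no_types))
      then show ?thesis by simp
    qed
    finally show "(\<integral>x. (G x $ i - G' x $ i) * \<phi> x \<partial>lebesgue_on \<Omega>) = 0" .
  qed
  then have "AE x in lebesgue_on \<Omega>. \<forall>i. G x $ i - G' x $ i = 0" by (simp add: AE_all_countable)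
  then show ?thesis by eventually_elim (simp add: vec_eq_iff)
qed

lemma weak_grad_lincomb:
  fixes \<Omega> :: "(real^'d) set"
  assumes \<Omega>: "open \<Omega>" "bounded \<Omega>" and f: "L2 \<Omega> f" "L2 \<Omega> f'"
    and G: "weak_grad \<Omega> f G" "weak_grad \<Omega> f' G'"
  shows "weak_grad \<Omega> (\<lambda>x. a * f x + b * f' x) (\<lambda>x. a *\<^sub>R G x + b *\<^sub>R G' x)"
  unfolding weak_grad_def
proof (intro conjI allI impI)
  have sq: "sqint (lebesgue_on \<Omega>) (\<lambda>x. G x $ i)" "sqint (lebesgue_on \<Omega>) (\<lambda>x. G' x $ i)" for i
    using G by (auto simp: weak_grad_def L2v_sqint)
  note sf = f[unfolded L2_iff_sqint]
  show "L2v \<Omega> (\<lambda>x. a *\<^sub>R G x + b *\<^sub>R G' x)"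
    using sqint_lincomb[OF sq] by (simp add: L2v_sqint)
  fix \<phi> :: "real^'d \<Rightarrow> real" and i 
  assume "C1c \<phi> \<and> closure {x. \<phi> x \<noteq> 0} \<subseteq> \<Omega>"
  then have \<phi>: "C1c \<phi>" "closure {x. \<phi> x \<noteq> 0} \<subseteq> \<Omega>" by auto
  note s\<phi> = C1c_sqint[OF \<Omega> \<phi>(1)]
  have "(\<integral>x. (a * f x + b * f' x) * cgrad \<phi> x $ i \<partial>lebesgue_on \<Omega>)
    = (\<integral>x. a * (f x * cgrad \<phi> x $ i) + b * (f' x * cgrad \<phi> x $ i) \<partial>lebesgue_on \<Omega>)"
    by (simp add: algebra_simps)
  also have "\<dots> = a * (\<integral>x. f x * cgrad \<phi> x $ i \<partial>lebesgue_on \<Omega>) + b * (\<integral>x. f' x * cgrad \<phi> x $ i \<partial>lebesgue_on \<Omega>)"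
    using sqint_mult[OF sf(1) s\<phi>(2)] sqint_mult[OF sf(2) s\<phi>(2)] by simp
  also have "\<dots> = - (a * (\<integral>x. G x $ i * \<phi> x \<partial>lebesgue_on \<Omega>) + b * (\<integral>x. G' x $ i * \<phi> x \<partial>lebesgue_on \<Omega>))"
    using G \<phi> unfolding weak_grad_def by simp
  also have "a * (\<integral>x. G x $ i * \<phi> x \<partial>lebesgue_on \<Omega>) + b * (\<integral>x. G' x $ i * \<phi> x \<partial>lebesgue_on \<Omega>)
    = (\<integral>x. a * (G x $ i * \<phi> x) + b * (G' x $ i * \<phi> x) \<partial>lebesgue_on \<Omega>)"
    using sqint_mult[OF sq(1) s\<phi>(1)] sqint_mult[OF sq(2) s\<phi>(1)] by simp
  also have "\<dots> = (\<integral>x. (a *\<^sub>R G x + b *\<^sub>R G' x) $ i * \<phi> x \<partial>lebesgue_on \<Omega>)"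
    by (simp add: algebra_simps)
  finally show "(\<integral>x. (a * f x + b * f' x) * cgrad \<phi> x $ i \<partial>lebesgue_on \<Omega>)
    = - (\<integral>x. (a *\<^sub>R G x + b *\<^sub>R G' x) $ i * \<phi> x \<partial>lebesgue_on \<Omega>)" .
qed

lemma H1_weak_grad: "H1 \<Omega> f \<Longrightarrow> weak_grad \<Omega> f (wgrad \<Omega> f)"
  unfolding H1_def wgrad_def by (metis someI)

text \<open>\<open>wgrad\<close> selects an arbitrary weak gradient of each function, so it is
  linear only up to a null set.\<close>

lemma H1_lincomb:
  fixes \<Omega> :: "(real^'d) set"
  assumes \<Omega>: "open \<Omega>" "bounded \<Omega>" and f: "H1 \<Omega> f" "H1 \<Omega> f'"
  shows "H1 \<Omega> (\<lambda>x. a * f x + b * f' x)"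
    and "AE x in lebesgue_on \<Omega>. wgrad \<Omega> (\<lambda>x. a * f x + b * f' x) x = a *\<^sub>R wgrad \<Omega> f x + b *\<^sub>R wgrad \<Omega> f' x"
proof -
  have L: "L2 \<Omega> f" "L2 \<Omega> f'" using f by (auto simp: H1_def)
  note w = weak_grad_lincomb[OF \<Omega> L H1_weak_grad[OF f(1)] H1_weak_grad[OF f(2)], of a b]
  show H: "H1 \<Omega> (\<lambda>x. a * f x + b * f' x)"
    using w sqint_lincomb[of _ f f'] L unfolding H1_def L2_iff_sqint by blast
  show "AE x in lebesgue_on \<Omega>. wgrad \<Omega> (\<lambda>x. a * f x + b * f' x) x = a *\<^sub>R wgrad \<Omega> f x + b *\<^sub>R wgrad \<Omega> f' x"
    by (rule weak_grad_unique[OF \<Omega> H1_weak_grad[OF H] w])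
qed

lemma wgrad_sqint: "H1 \<Omega> f \<Longrightarrow> sqint (lebesgue_on \<Omega>) (\<lambda>x. wgrad \<Omega> f x $ i)"
  using H1_weak_grad unfolding weak_grad_def L2v_sqint by blast

section \<open>Boundary values\<close>

lemma space_surf [simp]: "space (surf A) = A"
  by (simp add: surf_def space_restrict_space)

lemma sets_surf [measurable_cong]: "sets (surf A) = sets (restrict_space borel A)"
  by (simp add: surf_def sets_restrict_space)

lemma surf_measurable: "f \<in> borel_measurable borel \<Longrightarrow> f \<in> borel_measurable (surf A)"
  unfolding surf_def by (intro measurable_restrict_space1) (simp add: measurable_cong_sets[OF sets_hausdorff_measure refl])

lemma emeasure_surf:
  fixes A :: "(real^'d) set"
  assumes "A \<in> sets borel" "B \<in> sets (surf A)"
  shows "emeasure (surf A) B = hausdorff_outer (real CARD('d) - 1) B"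
proof -
  have B: "B \<subseteq> A" "B \<in> sets borel" using assms by (auto simp: sets_surf sets_restrict_space_iff)
  then show ?thesis
    unfolding surf_def using assms(1) by (simp add: emeasure_restrict_space emeasure_hausdorff_measure)
qed

abbreviation nnsq :: "'a measure \<Rightarrow> ('a \<Rightarrow> 'b::real_normed_vector) \<Rightarrow> ennreal" where
  "nnsq M u \<equiv> \<integral>\<^sup>+x. ennreal ((norm (u x))\<^sup>2) \<partial>M"

lemma ennreal_summable_tendsto_0:
  fixes a :: "nat \<Rightarrow> ennreal"
  assumes "(\<Sum>k. a k) < top" shows "a \<longlonglongrightarrow> 0"
proof -
  have a: "a k = ennreal (enn2real (a k))" for k
    using ennreal_suminf_lessD[OF assms, of k] by simp
  have "(\<Sum>k. ennreal (enn2real (a k))) \<noteq> top" using assms a by simp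
  then have "summable (\<lambda>k. enn2real (a k))" by (intro summable_suminf_not_top) auto
  then have "(\<lambda>k. ennreal (enn2real (a k))) \<longlonglongrightarrow> ennreal 0"
    by (intro tendsto_ennrealI summable_LIMSEQ_zero)
  then show ?thesis using a by simp
qed

text \<open>For each k an index with value below 2^-(k+1) is picked separately, so \<open>r\<close>
  is a selection of indices that may repeat or decrease.\<close>

lemma ennreal_tendsto_0_summable_choice:
  fixes a :: "nat \<Rightarrow> ennreal"
  assumes "a \<longlonglongrightarrow> 0" obtains r where "(\<Sum>k. a (r k)) < top"
proof -
  have "\<exists>n. a n < ennreal ((1/2)^Suc k)" for k
  proof -
    have "\<forall>\<^sub>F n in sequentially. a n < ennreal ((1/2)^Suc k)"
      using assms by (rule order_tendstoD) simp
    then show ?thesis by (auto simp: eventually_sequentially)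
  qed
  then obtain r where r: "\<And>k. a (r k) < ennreal ((1/2)^Suc k)" by metis
  have "(\<Sum>k. a (r k)) \<le> (\<Sum>k. ennreal ((1/2)^Suc k))"
    by (intro suminf_le less_imp_le r) auto
  also have "\<dots> = ennreal 1" by (rule suminf_ennreal_eq[OF _ power_half_series]) simp
  finally have "(\<Sum>k. a (r k)) < top" by (rule le_less_trans) simp
  then show thesis by (rule that)
qed

lemma tendsto_0_le_ennreal:
  fixes a b :: "nat \<Rightarrow> ennreal"
  assumes "b \<longlonglongrightarrow> 0" "\<And>k. a k \<le> b k" shows "a \<longlonglongrightarrow> 0"
  by (rule tendsto_sandwich[OF _ _ tendsto_const assms(1)]) (auto simp: assms(2))

section \<open>Integration along lines\<close>

lemma C1c_derivative_line:
  assumes "C1c \<phi>"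
  shows "((\<lambda>t. \<phi> (y + t *\<^sub>R v)) has_real_derivative cgrad \<phi> (y + t *\<^sub>R v) \<bullet> v) (at t)"
proof -
  have 1: "((\<lambda>t. y + t *\<^sub>R v) has_derivative (\<lambda>h. h *\<^sub>R v)) (at t)"
    by (auto intro!: derivative_eq_intros)
  show ?thesis
    using has_derivative_compose[OF 1 C1c_has_derivative[OF assms]]
    by (simp add: has_field_derivative_def mult.commute[of _ "_ \<bullet> _"])
qed

lemma C1c_continuous_line:
  assumes "C1c \<phi>"
  shows "continuous_on A (\<lambda>t. \<phi> (y + t *\<^sub>R v))" "continuous_on A (\<lambda>t. cgrad \<phi> (y + t *\<^sub>R v))"
  by (intro continuous_on_compose2[OF C1c_continuous[OF assms]] continuous_on_compose2[OF continuous_on_cgrad[OF assms]] continuous_intros; simp)+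

text \<open>Integrating the derivative of \<open>(\<epsilon> - t) \<phi>(y + t v)\<^sup>2\<close>.\<close>

lemma C1c_boundary_value_le:
  fixes v :: "real^'d"
  assumes \<phi>: "C1c \<phi>" and v: "norm v = 1" and \<epsilon>: "0 < \<epsilon>"
  shows "ennreal (\<epsilon> * (\<phi> y)\<^sup>2) \<le> ennreal (1 + \<epsilon>) *
    (\<integral>\<^sup>+t. ennreal ((\<phi> (y + t *\<^sub>R v))\<^sup>2 + (norm (cgrad \<phi> (y + t *\<^sub>R v)))\<^sup>2) * indicator {0<..<\<epsilon>} t \<partial>lborel)"
proof -
  define f where "f t = \<phi> (y + t *\<^sub>R v)" for t
  define f' where "f' t = cgrad \<phi> (y + t *\<^sub>R v) \<bullet> v" for t
  define w where "w t = (f t)\<^sup>2 + (norm (cgrad \<phi> (y + t *\<^sub>R v)))\<^sup>2" for t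
  have d: "(f has_real_derivative f' t) (at t)" for t
    unfolding f_def f'_def by (rule C1c_derivative_line[OF \<phi>])
  have wpos: "0 \<le> w t" for t by (simp add: w_def)
  have cw: "continuous_on A w" for A
    unfolding w_def f_def by (intro continuous_intros C1c_continuous_line[OF \<phi>])
  have f'w: "(f' t)\<^sup>2 \<le> (norm (cgrad \<phi> (y + t *\<^sub>R v)))\<^sup>2" for t
    using Cauchy_Schwarz_ineq2[of "cgrad \<phi> (y + t *\<^sub>R v)" v] v 
    by (metis f'_def mult.right_neutral abs_le_square_iff abs_norm_cancel)
  \<comment> \<open>The weight \<epsilon> - t removes the unknown value at the far end and leaves
    \<epsilon> times the squared value at y.\<close>
  have "((\<lambda>t. (f t)\<^sup>2 - 2 * (\<epsilon> - t) * (f t * f' t)) has_integral (- ((\<epsilon> - \<epsilon>) * (f \<epsilon>)\<^sup>2) - - ((\<epsilon> - 0) * (f 0)\<^sup>2))) {0..\<epsilon>}"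
  proof (rule fundamental_theorem_of_calculus)
    fix t
    have "((\<lambda>t. - ((\<epsilon> - t) * (f t)\<^sup>2)) has_real_derivative ((f t)\<^sup>2 - 2 * (\<epsilon> - t) * (f t * f' t))) (at t)"
      by (auto intro!: derivative_eq_intros d simp: power2_eq_square algebra_simps)
    then show "((\<lambda>t. - ((\<epsilon> - t) * (f t)\<^sup>2)) has_vector_derivative ((f t)\<^sup>2 - 2 * (\<epsilon> - t) * (f t * f' t))) (at t within {0..\<epsilon>})"
      by (metis has_real_derivative_iff_has_vector_derivative has_vector_derivative_at_within)
  qed (use \<epsilon> in simp)
  moreover have wi: "(w has_integral integral {0..\<epsilon>} w) {0..\<epsilon>}"
    by (intro integrable_integral integrable_continuous_real cw)
  then have "((\<lambda>t. (1 + \<epsilon>) * w t) has_integral ((1 + \<epsilon>) * integral {0..\<epsilon>} w)) {0..\<epsilon>}"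
    by (rule has_integral_mult_right)
  moreover have "(f t)\<^sup>2 - 2 * (\<epsilon> - t) * (f t * f' t) \<le> (1 + \<epsilon>) * w t" if t: "t \<in> {0..\<epsilon>}" for t
  proof -
    have "- (2 * (f t * f' t)) \<le> w t"
      using sum_squares_bound[of "f t" "- f' t"] f'w[of t] by (simp add: w_def)
    then have "(\<epsilon> - t) * (- (2 * (f t * f' t))) \<le> (\<epsilon> - t) * w t" using t by (intro mult_left_mono) auto
    also have "\<dots> \<le> \<epsilon> * w t" using t by (intro mult_right_mono) (auto simp: w_def)
    finally have "- (2 * (\<epsilon> - t) * (f t * f' t)) \<le> \<epsilon> * w t" by (simp add: algebra_simps)
    moreover have "(f t)\<^sup>2 \<le> w t" by (simp add: w_def)
    ultimately show ?thesis by (simp add: algebra_simps)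
  qed
  ultimately have "- ((\<epsilon> - \<epsilon>) * (f \<epsilon>)\<^sup>2) - - ((\<epsilon> - 0) * (f 0)\<^sup>2) \<le> (1 + \<epsilon>) * integral {0..\<epsilon>} w"
    by (rule has_integral_le)
  then have "\<epsilon> * (\<phi> y)\<^sup>2 \<le> (1 + \<epsilon>) * integral {0..\<epsilon>} w" by (simp add: f_def)
  then have "ennreal (\<epsilon> * (\<phi> y)\<^sup>2) \<le> ennreal (1 + \<epsilon>) * ennreal (integral {0..\<epsilon>} w)"
    using \<epsilon> by (subst ennreal_mult'[symmetric]) (auto intro: ennreal_leI)
  also have "ennreal (integral {0..\<epsilon>} w) = (\<integral>\<^sup>+t. ennreal (w t) * indicator {0<..<\<epsilon>} t \<partial>lborel)"
    using wi by (intro nn_integral_has_integral_lebesgue'[symmetric])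
      (simp_all add: has_integral_Icc_iff_Ioo wpos)
  finally show ?thesis by (simp only: w_def f_def)
qed

text \<open>Tonelli's theorem and translation invariance: for fixed s the integral over z is that of
  \<open>G\<close>.\<close>

lemma nn_integral_line_average:
  fixes G :: "'a::euclidean_space \<Rightarrow> ennreal"
  assumes G: "G \<in> borel_measurable borel" and A: "A \<in> sets borel"
  shows "(\<lambda>z. \<integral>\<^sup>+s. G (z + s *\<^sub>R e) * indicator A s \<partial>lborel) \<in> borel_measurable lborel"
    and "(\<integral>\<^sup>+z. (\<integral>\<^sup>+s. G (z + s *\<^sub>R e) * indicator A s \<partial>lborel) \<partial>lborel) 
      = (\<integral>\<^sup>+z. G z \<partial>lborel) * emeasure lborel (A :: real set)"
proof -
  let ?H = "\<lambda>z s. G (z + s *\<^sub>R e) * indicator A s"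
  have m: "(\<lambda>(z, s). ?H z s) \<in> borel_measurable (lborel \<Otimes>\<^sub>M lborel)"
    using A G by (simp add: case_prod_beta) measurable
  show "(\<lambda>z. \<integral>\<^sup>+s. ?H z s \<partial>lborel) \<in> borel_measurable lborel"
    using lborel.borel_measurable_nn_integral[of "\<lambda>z s. ?H z s" lborel] m by simp
  have "(\<integral>\<^sup>+z. (\<integral>\<^sup>+s. ?H z s \<partial>lborel) \<partial>lborel) = (\<integral>\<^sup>+s. (\<integral>\<^sup>+z. ?H z s \<partial>lborel) \<partial>lborel)"
    using lborel_pair.Fubini'[OF m] by simp
  also have "\<dots> = (\<integral>\<^sup>+s. (\<integral>\<^sup>+z. G z \<partial>lborel) * indicator A s \<partial>lborel)"
  proof (rule nn_integral_cong)
    fix s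
    have "(\<integral>\<^sup>+z. ?H z s \<partial>lborel) = (\<integral>\<^sup>+z. G (s *\<^sub>R e + z) \<partial>lborel) * indicator A s"
      using G by (subst nn_integral_multc) (auto simp: add.commute intro!: measurable_compose[OF _ G])
    also have "(\<integral>\<^sup>+z. G (s *\<^sub>R e + z) \<partial>lborel) = (\<integral>\<^sup>+z. G z \<partial>(distr lborel borel ((+) (s *\<^sub>R e))))"
      using G by (subst nn_integral_distr) auto
    also have "distr lborel borel ((+) (s *\<^sub>R e)) = lborel" by (rule lborel_distr_plus)
    finally show "(\<integral>\<^sup>+z. ?H z s \<partial>lborel) = (\<integral>\<^sup>+z. G z \<partial>lborel) * indicator A s" .
  qed
  also have "\<dots> = (\<integral>\<^sup>+z. G z \<partial>lborel) * emeasure lborel A"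
    using A by (intro nn_integral_cmult_indicator) simp
  finally show "(\<integral>\<^sup>+z. (\<integral>\<^sup>+s. ?H z s \<partial>lborel) \<partial>lborel) = (\<integral>\<^sup>+z. G z \<partial>lborel) * emeasure lborel A" .
qed

text \<open>The window is symmetric on purpose. If \<open>G\<close> has infinite integral over a
  segment of length \<epsilon> starting at y in the direction of \<open>e\<close>, every point of
  that segment is exceptional as well. One bad boundary point thus spoils a whole segment, which is
  the tube hypothesis of \<open>hausdorff_outer_graph_null\<close>.\<close>

lemma null_line_integrals_infinite:
  fixes G :: "'a::euclidean_space \<Rightarrow> ennreal"
  assumes G: "G \<in> borel_measurable borel" and fin: "(\<integral>\<^sup>+z. G z \<partial>lborel) < top"
  shows "{z. (\<integral>\<^sup>+s. G (z + s *\<^sub>R e) * indicator {-\<epsilon>..\<epsilon>} s \<partial>lborel) = top} \<in> null_sets lborel"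
proof -
  note avg = nn_integral_line_average[OF G, of "{-\<epsilon>..\<epsilon>}" e, simplified]
  have "(\<integral>\<^sup>+z. G z \<partial>lborel) * emeasure lborel {-\<epsilon>..\<epsilon>} < top"
    using fin by (auto intro!: ennreal_mult_less_top[THEN iffD2] simp: emeasure_lborel_Icc_eq)
  then have f: "(\<integral>\<^sup>+z. (\<integral>\<^sup>+s. G (z + s *\<^sub>R e) * indicator {-\<epsilon>..\<epsilon>} s \<partial>lborel) \<partial>lborel) \<noteq> \<infinity>"
    unfolding avg(2)[symmetric] by (simp add: less_top)
  have "AE z in lborel. (\<integral>\<^sup>+s. G (z + s *\<^sub>R e) * indicator {-\<epsilon>..\<epsilon>} s \<partial>lborel) \<noteq> \<infinity>"
    using avg(1) by (intro nn_integral_PInf_AE[OF _ f]) simp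
  then show ?thesis using avg(1) by (subst (asm) AE_iff_null) auto
qed

text \<open>With \<open>e\<close> the vector that \<open>Q\<close> sends to the k-th axis, the
  boundary is locally a graph over the hyperplane orthogonal to \<open>e\<close>, with the domain on
  the side of -e. The Lipschitz bound turns into a cone condition free of coordinates.\<close>

lemma lipschitz_domain_local_graph:
  fixes \<Omega> :: "(real^'d) set"
  assumes \<Omega>: "lipschitz_domain \<Omega>" and x: "x \<in> frontier \<Omega>"
  obtains r e L where "r > 0" "norm e = 1" "0 \<le> L"
    "\<And>y y'. y \<in> frontier \<Omega> \<inter> ball x r \<Longrightarrow> y' \<in> frontier \<Omega> \<inter> ball x r \<Longrightarrow>
       \<bar>(y - y') \<bullet> e\<bar> \<le> L * norm ((y - y') - ((y - y') \<bullet> e) *\<^sub>R e)"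
    "\<And>y t. y \<in> frontier \<Omega> \<inter> ball x r \<Longrightarrow> 0 < t \<Longrightarrow> t < r \<Longrightarrow> y - t *\<^sub>R e \<in> \<Omega>"
proof -
  obtain R and Q :: "real^'d \<Rightarrow> real^'d" and k and h :: "real^'d \<Rightarrow> real" and L where R: "R > 0" and Q: "orthogonal_transformation Q"
    and hk: "\<And>z t. h (\<chi> j. if j = k then t else z $ j) = h z"
    and L: "L-lipschitz_on UNIV h"
    and eq: "\<Omega> \<inter> ball x R = {y \<in> ball x R. Q (y - x) $ k < h (Q (y - x))}"
    using \<Omega> x unfolding lipschitz_domain_def by blast
  have op: "open \<Omega>" using \<Omega> by (simp add: lipschitz_domain_def)
  have lin: "linear Q" using Q by (simp add: orthogonal_transformation_linear)
  obtain e where Qe: "Q e = axis k 1" using orthogonal_transformation_surj[OF Q] by (metis surjD)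
  have e: "norm e = 1" using Q Qe by (metis orthogonal_transformation_norm norm_axis_1)
  have L0: "0 \<le> L" using L by (rule lipschitz_on_nonneg)
  have Qin: "Q a \<bullet> Q b = a \<bullet> b" for a b using Q by (simp add: orthogonal_transformation_def)
  have ke: "Q a $ k = a \<bullet> e" for a using Qin[of a e] Qe by (simp add: inner_axis)
  have cont: "continuous_on UNIV (\<lambda>y. h (Q (y - x)) - Q (y - x) $ k)"
  proof -
    have "continuous_on UNIV h" using L by (rule lipschitz_on_continuous_on)
    moreover have "continuous_on UNIV (\<lambda>y. Q (y - x))"
      by (intro linear_continuous_on_compose[OF _ lin] continuous_intros)
    moreover from this have "continuous_on UNIV (\<lambda>y. Q (y - x) $ k)" by (rule continuous_on_component)
    ultimately show ?thesis
      by (intro continuous_on_diff continuous_on_compose2[of UNIV h UNIV "\<lambda>y. Q (y - x)"]) auto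
  qed
  \<comment> \<open>Strictly below the graph y would belong to the open set \<Omega>, and strictly
    above it a whole neighbourhood of y avoids \<Omega>; a frontier point admits neither.\<close>
  have graph: "Q (y - x) $ k = h (Q (y - x))" if y: "y \<in> frontier \<Omega>" "y \<in> ball x R" for y
  proof (rule ccontr)
    assume ne: "\<not> ?thesis"
    have "y \<notin> \<Omega>" using y(1) op by (simp add: frontier_def interior_open)
    then have gt: "Q (y - x) $ k > h (Q (y - x))" using ne eq y(2) by fastforce
    let ?S = "{y. h (Q (y - x)) - Q (y - x) $ k < 0} \<inter> ball x R"
    have "open ?S" by (intro open_Int open_Collect_less cont continuous_intros) auto
    moreover have "y \<in> ?S" using gt y(2) by simp
    moreover have "?S \<inter> \<Omega> = {}"
    proof -
      have False if "z \<in> ?S" "z \<in> \<Omega>" for z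
      proof -
        have "z \<in> \<Omega> \<inter> ball x R" using that by simp
        then have "Q (z - x) $ k < h (Q (z - x))" unfolding eq by simp
        then show False using that(1) by simp
      qed
      then show ?thesis by blast
    qed
    ultimately have "y \<notin> closure \<Omega>" unfolding closure_iff_nhds_not_empty by blast
    then show False using y(1) by (simp add: frontier_def)
  qed
  \<comment> \<open>Half the radius is used so that points lowered by less than R/2 stay in the ball
    where the graph description holds.\<close>
  show thesis
  proof (rule that[of "R/2" e L])
    show "R/2 > 0" "norm e = 1" "0 \<le> L" using R e L0 by auto
    fix y assume y: "y \<in> frontier \<Omega> \<inter> ball x (R/2)"
    then have yR: "y \<in> ball x R" using R by auto
    show "y - t *\<^sub>R e \<in> \<Omega>" if t: "0 < t" "t < R/2" for t
    proof -
      have "dist x (y - t *\<^sub>R e) \<le> dist x y + norm (t *\<^sub>R e)"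
        by (metis dist_triangle add_diff_cancel_left' diff_add_cancel dist_norm norm_minus_commute)
      also have "\<dots> < R" using y t e by simp
      finally have b: "y - t *\<^sub>R e \<in> ball x R" by simp
      let ?w = "Q (y - x)"
      have w: "Q (y - t *\<^sub>R e - x) = ?w - t *\<^sub>R axis k 1"
        by (simp add: linear_diff[OF lin] linear_cmul[OF lin] Qe)
      have "h (?w - t *\<^sub>R axis k 1) = h ?w"
      proof -
        have "?w - t *\<^sub>R axis k 1 = (\<chi> j. if j = k then ?w $ k - t else ?w $ j)"
          by (simp add: vec_eq_iff axis_def)
        then show ?thesis using hk by simp
      qed
      then have "Q (y - t *\<^sub>R e - x) $ k < h (Q (y - t *\<^sub>R e - x))"
        unfolding w using graph[of y] y yR t by simp
      then show ?thesis using eq b by blast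
    qed
    fix y' assume y': "y' \<in> frontier \<Omega> \<inter> ball x (R/2)"
    then have yR': "y' \<in> ball x R" using R by auto
    \<comment> \<open>\<open>h\<close> ignores coordinate k, so its arguments may be projected
      first; the Lipschitz bound then involves horizontal distances only.\<close>
    define p where "p w = (\<chi> j. if j = k then 0 else w $ j)" for w :: "real^'d"
    have hp: "h (p w) = h w" for w unfolding p_def by (rule hk)
    have "(y - y') \<bullet> e = Q (y - x) $ k - Q (y' - x) $ k"
      by (simp add: ke inner_diff_left)
    also have "\<dots> = h (p (Q (y - x))) - h (p (Q (y' - x)))" using graph y y' yR yR' by (simp add: hp)
    finally have "\<bar>(y - y') \<bullet> e\<bar> \<le> L * dist (p (Q (y - x))) (p (Q (y' - x)))"
      using lipschitz_onD[OF L, of "p (Q (y - x))" "p (Q (y' - x))"] by (simp add: dist_real_def)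
    also have "dist (p (Q (y - x))) (p (Q (y' - x))) = norm (Q ((y - y') - ((y - y') \<bullet> e) *\<^sub>R e))"
    proof -
      have "Q ((y - y') - ((y - y') \<bullet> e) *\<^sub>R e) = Q (y - y') - (Q (y - y') $ k) *\<^sub>R axis k 1"
        using lin by (simp add: linear_diff[OF lin] linear_cmul[OF lin] Qe ke inner_diff_left)
      also have "Q (y - y') = Q (y - x) - Q (y' - x)" using lin by (simp add: linear_diff[OF lin, symmetric])
      also have "(Q (y - x) - Q (y' - x)) - ((Q (y - x) - Q (y' - x)) $ k) *\<^sub>R axis k 1 = p (Q (y - x)) - p (Q (y' - x))"
        by (simp add: vec_eq_iff p_def axis_def)
      finally show ?thesis by (simp add: dist_norm)
    qed
    also have "\<dots> = norm ((y - y') - ((y - y') \<bullet> e) *\<^sub>R e)"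
      using Q by (simp add: orthogonal_transformation_norm)
    finally show "\<bar>(y - y') \<bullet> e\<bar> \<le> L * norm ((y - y') - ((y - y') \<bullet> e) *\<^sub>R e)" .
  qed
qed

lemma nn_integral_lebesgue_on:
  fixes \<Omega> :: "'a::euclidean_space set"
  assumes "\<Omega> \<in> sets lebesgue"
  shows "(\<integral>\<^sup>+x. f x \<partial>lebesgue_on \<Omega>) = (\<integral>\<^sup>+x. f x * indicator \<Omega> x \<partial>lborel)"
  using assms by (simp add: nn_integral_restrict_space nn_integral_completion)

text \<open>Along a fast subsequence the squares are summable, hence so are their integrals over almost every segment
  ending at the boundary.\<close>

lemma trace_closable:
  fixes \<Omega> :: "(real^'d) set"
  assumes dim: "CARD('d) \<ge> 2" and \<Omega>: "lipschitz_domain \<Omega>" and C: "\<And>k. C1c (\<phi> k)"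
    and h: "h \<in> borel_measurable (surf (frontier \<Omega>))"
    and lim: "(\<lambda>k. nnsq (lebesgue_on \<Omega>) (\<phi> k)) \<longlonglongrightarrow> 0"
       "(\<lambda>k. nnsq (lebesgue_on \<Omega>) (cgrad (\<phi> k))) \<longlonglongrightarrow> 0"
       "(\<lambda>k. nnsq (surf (frontier \<Omega>)) (\<lambda>x. \<phi> k x - h x)) \<longlonglongrightarrow> 0"
  shows "AE x in surf (frontier \<Omega>). h x = 0"
proof -
  have op: "open \<Omega>" and bd: "bounded \<Omega>" using \<Omega> by (auto simp: lipschitz_domain_def)
  have \<Omega>b: "\<Omega> \<in> sets borel" and \<Omega>m: "\<Omega> \<in> sets lebesgue" using op by auto
  let ?S = "surf (frontier \<Omega>)"
  let ?a = "\<lambda>k. (nnsq (lebesgue_on \<Omega>) (\<phi> k)) 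
      + (nnsq (lebesgue_on \<Omega>) (cgrad (\<phi> k)))
      + (nnsq ?S (\<lambda>x. \<phi> k x - h x))"
  have "?a \<longlonglongrightarrow> 0 + 0 + 0" by (intro tendsto_add lim)
  then obtain r where r: "(\<Sum>k. ?a (r k)) < top" using ennreal_tendsto_0_summable_choice[of ?a] by auto
  define \<psi> where "\<psi> k = \<phi> (r k)" for k
  have \<psi>: "C1c (\<psi> k)" for k using C by (simp add: \<psi>_def)
  have [measurable]: "\<psi> k \<in> borel_measurable borel" "cgrad (\<psi> k) \<in> borel_measurable borel" for k
    using \<psi> C1c_measurable cgrad_measurable by auto
  have [measurable]: "\<psi> k \<in> borel_measurable ?S" for k by (rule surf_measurable) simp
  note h[measurable]
  \<comment> \<open>The cut-off makes the total integral of \<open>F k\<close> the sum of the two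
    domain integrals, and it is invisible on the segments used below, which lie in \<Omega>.\<close>
  define F where "F k z = ennreal ((\<psi> k z)\<^sup>2 + (norm (cgrad (\<psi> k) z))\<^sup>2) * indicator \<Omega> z" for k z
  have [measurable]: "F k \<in> borel_measurable borel" for k unfolding F_def using \<Omega>b by measurable
  have Fint: "(\<integral>\<^sup>+z. F k z \<partial>lborel) = (nnsq (lebesgue_on \<Omega>) (\<psi> k)) 
      + (nnsq (lebesgue_on \<Omega>) (cgrad (\<psi> k)))" for k
  proof -
    have "(\<integral>\<^sup>+z. F k z \<partial>lborel) = (\<integral>\<^sup>+x. ennreal ((\<psi> k x)\<^sup>2) * indicator \<Omega> x + ennreal ((norm (cgrad (\<psi> k) x))\<^sup>2) * indicator \<Omega> x \<partial>lborel)"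
      by (intro nn_integral_cong) (simp add: F_def distrib_right)
    also have "\<dots> = (\<integral>\<^sup>+x. ennreal ((\<psi> k x)\<^sup>2) * indicator \<Omega> x \<partial>lborel) + (\<integral>\<^sup>+x. ennreal ((norm (cgrad (\<psi> k) x))\<^sup>2) * indicator \<Omega> x \<partial>lborel)"
      using \<Omega>b by (intro nn_integral_add) auto
    finally show ?thesis using \<Omega>m by (simp add: nn_integral_lebesgue_on)
  qed
  define G where "G z = (\<Sum>k. F k z)" for z
  have [measurable]: "G \<in> borel_measurable borel" unfolding G_def by measurable
  have "(\<integral>\<^sup>+z. G z \<partial>lborel) = (\<Sum>k. \<integral>\<^sup>+z. F k z \<partial>lborel)"
    unfolding G_def by (rule nn_integral_suminf) simp
  also have "\<dots> \<le> (\<Sum>k. ?a (r k))"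
    by (rule suminf_le) (auto simp: Fint \<psi>_def)
  finally have Gfin: "(\<integral>\<^sup>+z. G z \<partial>lborel) < top" using r by (rule le_less_trans)
  define D where "D y = (\<Sum>k. ennreal ((\<psi> k y - h y)\<^sup>2))" for y
  have [measurable]: "D \<in> borel_measurable ?S" unfolding D_def by measurable
  have "(\<integral>\<^sup>+y. D y \<partial>?S) = (\<Sum>k. \<integral>\<^sup>+y. ennreal ((\<psi> k y - h y)\<^sup>2) \<partial>?S)"
    unfolding D_def by (rule nn_integral_suminf) simp
  also have "\<dots> \<le> (\<Sum>k. ?a (r k))"
    by (rule suminf_le) (auto simp: \<psi>_def)
  finally have "(\<integral>\<^sup>+y. D y \<partial>?S) < top" using r by (rule le_less_trans)
  then have aeD: "AE y in ?S. D y \<noteq> \<infinity>" by (intro nn_integral_PInf_AE) (auto simp: less_top)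
  \<comment> \<open>The bad points near x, restricted to those with summable boundary errors, where
    \<open>\<psi> k y\<close> converges to \<open>h y\<close>.\<close>
  define N where "N x \<rho> = {y \<in> frontier \<Omega>. y \<in> ball x \<rho> \<and> h y \<noteq> 0 \<and> D y \<noteq> \<infinity>}" for x \<rho>
  have Nm: "N x \<rho> \<in> sets ?S" for x \<rho>
  proof -
    have "{y \<in> space ?S. y \<in> ball x \<rho>} \<in> sets ?S"
      unfolding sets_surf by (auto simp: sets_restrict_space_iff)
    moreover have "{y \<in> space ?S. h y \<noteq> 0 \<and> D y \<noteq> \<infinity>} \<in> sets ?S" by measurable
    ultimately have "{y \<in> space ?S. y \<in> ball x \<rho>} \<inter> {y \<in> space ?S. h y \<noteq> 0 \<and> D y \<noteq> \<infinity>} \<in> sets ?S" by blast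
    also have "{y \<in> space ?S. y \<in> ball x \<rho>} \<inter> {y \<in> space ?S. h y \<noteq> 0 \<and> D y \<noteq> \<infinity>} = N x \<rho>"
      by (auto simp: N_def)
    finally show ?thesis .
  qed
  have "\<exists>\<rho>>0. N x \<rho> \<in> null_sets ?S" if x: "x \<in> frontier \<Omega>" for x
  proof -
    obtain \<rho> e L where \<rho>: "\<rho> > 0" and e: "norm e = 1" and L: "0 \<le> L"
      and cone: "\<And>y y'. y \<in> frontier \<Omega> \<inter> ball x \<rho> \<Longrightarrow> y' \<in> frontier \<Omega> \<inter> ball x \<rho> \<Longrightarrow>
       \<bar>(y - y') \<bullet> e\<bar> \<le> L * norm ((y - y') - ((y - y') \<bullet> e) *\<^sub>R e)"
      and tube: "\<And>y t. y \<in> frontier \<Omega> \<inter> ball x \<rho> \<Longrightarrow> 0 < t \<Longrightarrow> t < \<rho> \<Longrightarrow> y - t *\<^sub>R e \<in> \<Omega>"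
      using lipschitz_domain_local_graph[OF \<Omega> x] by blast
    let ?Z = "{z. (\<integral>\<^sup>+s. G (z + s *\<^sub>R (-e)) * indicator {-\<rho>..\<rho>} s \<partial>lborel) = top}"
    have Z: "?Z \<in> null_sets lborel" by (rule null_line_integrals_infinite[OF _ Gfin]) simp
    \<comment> \<open>If this integral were finite, the line integrals of the single
      \<open>F k\<close> would tend to 0 and force \<open>\<psi> k y\<close> to 0; but
      \<open>\<psi> k y\<close> tends to \<open>h y\<close>, which is nonzero.\<close>
    have inf: "(\<integral>\<^sup>+t. G (y + t *\<^sub>R (-e)) * indicator {0<..<\<rho>} t \<partial>lborel) = top" if y: "y \<in> N x \<rho>" for y
    proof (rule ccontr)
      assume ne: "\<not> ?thesis"
      let ?I = "\<lambda>k. \<integral>\<^sup>+t. F k (y + t *\<^sub>R (-e)) * indicator {0<..<\<rho>} t \<partial>lborel"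
      have "(\<Sum>k. ?I k) = (\<integral>\<^sup>+t. (\<Sum>k. F k (y + t *\<^sub>R (-e)) * indicator {0<..<\<rho>} t) \<partial>lborel)"
        by (rule nn_integral_suminf[symmetric]) measurable
      also have "\<dots> = (\<integral>\<^sup>+t. G (y + t *\<^sub>R (-e)) * indicator {0<..<\<rho>} t \<partial>lborel)"
        by (simp add: G_def)
      finally have "?I \<longlonglongrightarrow> 0" using ne by (intro ennreal_summable_tendsto_0) (simp add: less_top)
      then have "(\<lambda>k. ennreal (1 + \<rho>) * ?I k) \<longlonglongrightarrow> ennreal (1 + \<rho>) * 0"
        by (intro ennreal_tendsto_cmult) auto
      moreover have "ennreal (\<rho> * (\<psi> k y)\<^sup>2) \<le> ennreal (1 + \<rho>) * ?I k" for k
      proof -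
        have "ennreal (\<rho> * (\<psi> k y)\<^sup>2) \<le> ennreal (1 + \<rho>) *
          (\<integral>\<^sup>+t. ennreal ((\<psi> k (y + t *\<^sub>R (-e)))\<^sup>2 + (norm (cgrad (\<psi> k) (y + t *\<^sub>R (-e))))\<^sup>2) * indicator {0<..<\<rho>} t \<partial>lborel)"
          using e \<rho> by (intro C1c_boundary_value_le \<psi>) auto
        also have "(\<integral>\<^sup>+t. ennreal ((\<psi> k (y + t *\<^sub>R (-e)))\<^sup>2 + (norm (cgrad (\<psi> k) (y + t *\<^sub>R (-e))))\<^sup>2) * indicator {0<..<\<rho>} t \<partial>lborel) = ?I k"
          using tube[of y] y by (intro nn_integral_cong) (auto simp: F_def N_def indicator_def)
        finally show ?thesis .
      qed
      ultimately have "(\<lambda>k. ennreal (\<rho> * (\<psi> k y)\<^sup>2)) \<longlonglongrightarrow> 0"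
        using tendsto_0_le_ennreal[of "\<lambda>k. ennreal (1 + \<rho>) * ?I k"] by simp
      then have "(\<lambda>k. ennreal (\<rho> * (\<psi> k y)\<^sup>2)) \<longlonglongrightarrow> ennreal 0" by simp
      then have "(\<lambda>k. \<rho> * (\<psi> k y)\<^sup>2) \<longlonglongrightarrow> 0"
        using \<rho> by (subst (asm) tendsto_ennreal_iff) auto
      then have "(\<lambda>k. inverse \<rho> * (\<rho> * (\<psi> k y)\<^sup>2)) \<longlonglongrightarrow> inverse \<rho> * 0" by (intro tendsto_mult_left)
      then have 1: "(\<lambda>k. (\<psi> k y)\<^sup>2) \<longlonglongrightarrow> 0" using \<rho> by (simp add: mult.assoc[symmetric])
      have "(\<lambda>k. ennreal ((\<psi> k y - h y)\<^sup>2)) \<longlonglongrightarrow> ennreal 0"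
        using y ennreal_summable_tendsto_0[of "\<lambda>k. ennreal ((\<psi> k y - h y)\<^sup>2)"] by (simp add: N_def D_def less_top)
      then have 2: "(\<lambda>k. (\<psi> k y - h y)\<^sup>2) \<longlonglongrightarrow> 0" by (subst (asm) tendsto_ennreal_iff) auto
      have "(\<lambda>k. 2 * (\<psi> k y)\<^sup>2 + 2 * (\<psi> k y - h y)\<^sup>2) \<longlonglongrightarrow> 2 * 0 + 2 * 0" by (intro tendsto_intros 1 2)
      moreover have "(h y)\<^sup>2 \<le> 2 * (\<psi> k y)\<^sup>2 + 2 * (\<psi> k y - h y)\<^sup>2" for k
        using zero_le_power2[of "2 * \<psi> k y - h y"] by (simp add: power2_eq_square algebra_simps)
      ultimately have "(h y)\<^sup>2 \<le> 2 * 0 + 2 * 0" by (intro LIMSEQ_le_const) auto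
      then show False using y by (simp add: N_def)
    qed
    have "hausdorff_outer (real DIM(real^'d) - 1) (N x \<rho>) = 0"
    proof (rule hausdorff_outer_graph_null[OF _ e L _ _ \<rho>])
      show "DIM(real^'d) \<ge> 2" using dim by simp
      show "negligible ?Z" using Z negligible_iff_null_sets null_sets_completionI by blast
      show "bounded (N x \<rho>)" by (rule bounded_subset[of "ball x \<rho>"]) (auto simp: N_def)
      show "\<bar>(y - y') \<bullet> e\<bar> \<le> L * norm ((y - y') - ((y - y') \<bullet> e) *\<^sub>R e)" if "y \<in> N x \<rho>" "y' \<in> N x \<rho>" for y y'
        using that by (intro cone) (auto simp: N_def)
      fix y t assume y: "y \<in> N x \<rho>" and t: "0 < t" "t < \<rho>"
      \<comment> \<open>Seen from the lowered point y - t e, the segment occupies the parameters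
        from -t to \<rho> - t, which lie inside the symmetric window.\<close>
      have "top = (\<integral>\<^sup>+t. G (y + t *\<^sub>R (-e)) * indicator {0<..<\<rho>} t \<partial>lborel)" using inf[OF y] by simp
      also have "\<dots> = (\<integral>\<^sup>+s. G (y + (t + 1 * s) *\<^sub>R (-e)) * indicator {0<..<\<rho>} (t + 1 * s) \<partial>lborel)"
        by (subst nn_integral_real_affine[where c=1 and t=t]) auto
      also have "\<dots> \<le> (\<integral>\<^sup>+s. G (y - t *\<^sub>R e + s *\<^sub>R (-e)) * indicator {-\<rho>..\<rho>} s \<partial>lborel)"
        using t by (intro nn_integral_mono) (auto simp: indicator_def algebra_simps)
      finally show "y - t *\<^sub>R e \<in> ?Z" by (simp add: top_unique)
    qed
    then have "emeasure ?S (N x \<rho>) = 0" using emeasure_surf[OF _ Nm, of x \<rho>] by simp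
    then show ?thesis using \<rho> Nm by auto
  qed
  then obtain \<rho> where \<rho>: "\<And>x. x \<in> frontier \<Omega> \<Longrightarrow> \<rho> x > 0 \<and> N x (\<rho> x) \<in> null_sets ?S" by metis
  have "compact (frontier \<Omega>)" using bd by (rule compact_frontier_bounded)
  moreover have "frontier \<Omega> \<subseteq> (\<Union>x\<in>frontier \<Omega>. ball x (\<rho> x))" using \<rho> by force
  ultimately obtain X where X: "X \<subseteq> frontier \<Omega>" "finite X" "frontier \<Omega> \<subseteq> (\<Union>x\<in>X. ball x (\<rho> x))"
    using compactE_image[of "frontier \<Omega>" "frontier \<Omega>" "\<lambda>x. ball x (\<rho> x)"] open_ball by blast
  have "AE y in ?S. \<forall>x\<in>X. y \<notin> N x (\<rho> x)"
    using X \<rho> by (subst AE_finite_all) (auto intro!: AE_not_in)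
  with aeD AE_space show ?thesis
  proof eventually_elim
    case (elim y)
    then have "y \<in> frontier \<Omega>" by simp
    then obtain x where "x \<in> X" "y \<in> ball x (\<rho> x)" using X(3) by blast
    then show "h y = 0" using elim by (auto simp: N_def)
  qed
qed

section \<open>Uniqueness and linear combinations of traces\<close>

lemma lipschitz_domain_open: "lipschitz_domain \<Omega> \<Longrightarrow> open \<Omega>"
  and lipschitz_domain_bounded: "lipschitz_domain \<Omega> \<Longrightarrow> bounded \<Omega>"
  by (auto simp: lipschitz_domain_def)

lemma borel_measurable_vecI:
  fixes f :: "'a \<Rightarrow> real^'n"
  assumes "\<And>i. (\<lambda>x. f x $ i) \<in> borel_measurable M" shows "f \<in> borel_measurable M"
  by (subst borel_measurable_euclidean_space) (auto simp: Basis_vec_def inner_axis assms)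

lemma nnsq_lincomb_le:
  fixes u v :: "'a \<Rightarrow> 'b::{real_normed_vector,second_countable_topology}"
  assumes [measurable]: "u \<in> borel_measurable M" "v \<in> borel_measurable M"
  shows "nnsq M (\<lambda>x. a *\<^sub>R u x + b *\<^sub>R v x) \<le> ennreal (2 * a\<^sup>2) * nnsq M u + ennreal (2 * b\<^sup>2) * nnsq M v"
proof -
  have "(norm (a *\<^sub>R u x + b *\<^sub>R v x))\<^sup>2 \<le> 2 * a\<^sup>2 * (norm (u x))\<^sup>2 + 2 * b\<^sup>2 * (norm (v x))\<^sup>2" for x
  proof -
    have "(norm (a *\<^sub>R u x + b *\<^sub>R v x))\<^sup>2 \<le> (\<bar>a\<bar> * norm (u x) + \<bar>b\<bar> * norm (v x))\<^sup>2"
      using norm_triangle_ineq[of "a *\<^sub>R u x" "b *\<^sub>R v x"] by (intro power_mono) auto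
    also have "\<dots> \<le> 2 * (\<bar>a\<bar> * norm (u x))\<^sup>2 + 2 * (\<bar>b\<bar> * norm (v x))\<^sup>2"
      using sum_squares_bound[of "\<bar>a\<bar> * norm (u x)" "\<bar>b\<bar> * norm (v x)"] by (simp add: power2_sum)
    finally show ?thesis by (simp add: power_mult_distrib)
  qed
  then have "nnsq M (\<lambda>x. a *\<^sub>R u x + b *\<^sub>R v x)
     \<le> (\<integral>\<^sup>+x. ennreal (2 * a\<^sup>2 * (norm (u x))\<^sup>2 + 2 * b\<^sup>2 * (norm (v x))\<^sup>2) \<partial>M)"
    by (intro nn_integral_mono ennreal_leI)
  also have "\<dots> = (\<integral>\<^sup>+x. ennreal (2 * a\<^sup>2) * ennreal ((norm (u x))\<^sup>2) + ennreal (2 * b\<^sup>2) * ennreal ((norm (v x))\<^sup>2) \<partial>M)"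
    by (intro nn_integral_cong) (simp add: ennreal_mult'[symmetric])
  also have "\<dots> = ennreal (2 * a\<^sup>2) * nnsq M u + ennreal (2 * b\<^sup>2) * nnsq M v"
    by (simp add: nn_integral_add nn_integral_cmult)
  finally show ?thesis .
qed

lemma nnsq_lincomb_tendsto:
  fixes u v :: "nat \<Rightarrow> 'a \<Rightarrow> 'b::{real_normed_vector,second_countable_topology}"
  assumes m: "\<And>k. u k \<in> borel_measurable M" "\<And>k. v k \<in> borel_measurable M"
    and lim: "(\<lambda>k. nnsq M (u k)) \<longlonglongrightarrow> 0" "(\<lambda>k. nnsq M (v k)) \<longlonglongrightarrow> 0"
    and w: "\<And>k x. w k x = a *\<^sub>R u k x + b *\<^sub>R v k x"
  shows "(\<lambda>k. nnsq M (w k)) \<longlonglongrightarrow> 0"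
proof (rule tendsto_0_le_ennreal)
  have "(\<lambda>k. ennreal (2 * a\<^sup>2) * nnsq M (u k) + ennreal (2 * b\<^sup>2) * nnsq M (v k))
     \<longlonglongrightarrow> ennreal (2 * a\<^sup>2) * 0 + ennreal (2 * b\<^sup>2) * 0"
    by (intro tendsto_add ennreal_tendsto_cmult lim) auto
  then show "(\<lambda>k. ennreal (2 * a\<^sup>2) * nnsq M (u k) + ennreal (2 * b\<^sup>2) * nnsq M (v k)) \<longlonglongrightarrow> 0"
    by simp
qed (unfold w, rule nnsq_lincomb_le[OF m])

lemma H1_measurable: "H1 \<Omega> f \<Longrightarrow> f \<in> borel_measurable (lebesgue_on \<Omega>)"
  by (simp add: H1_def L2_def)

lemma H1_sqint: "H1 \<Omega> f \<Longrightarrow> sqint (lebesgue_on \<Omega>) f"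
  by (simp add: H1_def L2_iff_sqint)

lemma wgrad_measurable: "H1 \<Omega> f \<Longrightarrow> wgrad \<Omega> f \<in> borel_measurable (lebesgue_on \<Omega>)"
  using wgrad_sqint by (intro borel_measurable_vecI) blast

lemma has_trace_sqint: "has_trace \<Omega> f g \<Longrightarrow> sqint (surf (frontier \<Omega>)) g"
  by (simp add: has_trace_def sqint_def)

text \<open>The limit \<open>G\<close> of the gradients is a separate argument because a linear
  combination first approximates the combination of the chosen gradients; this agrees only almost
  everywhere with the gradient chosen for the combination.\<close>

definition trace_approx where
  "trace_approx \<Omega> f G g \<phi> \<longleftrightarrow> (\<forall>k :: nat. C1c (\<phi> k)) \<and>
     (\<lambda>k. nnsq (lebesgue_on \<Omega>) (\<lambda>x. \<phi> k x - f x)) \<longlonglongrightarrow> 0 \<and>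
     (\<lambda>k. nnsq (lebesgue_on \<Omega>) (\<lambda>x. cgrad (\<phi> k) x - G x)) \<longlonglongrightarrow> 0 \<and>
     (\<lambda>k. nnsq (surf (frontier \<Omega>)) (\<lambda>x. \<phi> k x - g x)) \<longlonglongrightarrow> 0"

lemma has_trace_iff:
  "has_trace \<Omega> f g \<longleftrightarrow> H1 \<Omega> f \<and> sqint (surf (frontier \<Omega>)) g \<and> (\<exists>\<phi>. trace_approx \<Omega> f (wgrad \<Omega> f) g \<phi>)"
  by (simp add: has_trace_def trace_approx_def sqint_def)

lemma trace_approx_lincomb:
  assumes t: "trace_approx \<Omega> f G g \<phi>" "trace_approx \<Omega> f' G' g' \<phi>'"
    and m: "f \<in> borel_measurable (lebesgue_on \<Omega>)" "f' \<in> borel_measurable (lebesgue_on \<Omega>)"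
      "G \<in> borel_measurable (lebesgue_on \<Omega>)" "G' \<in> borel_measurable (lebesgue_on \<Omega>)"
      "g \<in> borel_measurable (surf (frontier \<Omega>))" "g' \<in> borel_measurable (surf (frontier \<Omega>))"
  shows "trace_approx \<Omega> (\<lambda>x. a * f x + b * f' x) (\<lambda>x. a *\<^sub>R G x + b *\<^sub>R G' x) (\<lambda>x. a * g x + b * g' x)
    (\<lambda>k x. a * \<phi> k x + b * \<phi>' k x)"
proof -
  have C: "C1c (\<phi> k)" "C1c (\<phi>' k)" for k using t by (auto simp: trace_approx_def)
  have ms: "\<phi> k \<in> borel_measurable (lebesgue_on \<Omega>)" "\<phi>' k \<in> borel_measurable (lebesgue_on \<Omega>)"
    "cgrad (\<phi> k) \<in> borel_measurable (lebesgue_on \<Omega>)" "cgrad (\<phi>' k) \<in> borel_measurable (lebesgue_on \<Omega>)"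
    "\<phi> k \<in> borel_measurable (surf (frontier \<Omega>))" "\<phi>' k \<in> borel_measurable (surf (frontier \<Omega>))" for k
    using C C1c_measurable cgrad_measurable by (auto intro!: borel_measurable_lebesgue_on surf_measurable)
  show ?thesis
    unfolding trace_approx_def C1c_lincomb(2)[OF C]
  proof (intro conjI allI C1c_lincomb(1) C)
    show "(\<lambda>k. nnsq (lebesgue_on \<Omega>) (\<lambda>x. a * \<phi> k x + b * \<phi>' k x - (a * f x + b * f' x))) \<longlonglongrightarrow> 0"
      by (rule nnsq_lincomb_tendsto[where u="\<lambda>k x. \<phi> k x - f x" and v="\<lambda>k x. \<phi>' k x - f' x" and a=a and b=b])
        (use t m ms in \<open>auto simp: trace_approx_def algebra_simps\<close>)
    show "(\<lambda>k. nnsq (lebesgue_on \<Omega>) (\<lambda>x. a *\<^sub>R cgrad (\<phi> k) x + b *\<^sub>R cgrad (\<phi>' k) x - (a *\<^sub>R G x + b *\<^sub>R G' x))) \<longlonglongrightarrow> 0"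
      by (rule nnsq_lincomb_tendsto[where u="\<lambda>k x. cgrad (\<phi> k) x - G x" and v="\<lambda>k x. cgrad (\<phi>' k) x - G' x" and a=a and b=b])
        (use t m ms in \<open>auto simp: trace_approx_def algebra_simps\<close>)
    show "(\<lambda>k. nnsq (surf (frontier \<Omega>)) (\<lambda>x. a * \<phi> k x + b * \<phi>' k x - (a * g x + b * g' x))) \<longlonglongrightarrow> 0"
      by (rule nnsq_lincomb_tendsto[where u="\<lambda>k x. \<phi> k x - g x" and v="\<lambda>k x. \<phi>' k x - g' x" and a=a and b=b])
        (use t m ms in \<open>auto simp: trace_approx_def algebra_simps\<close>)
  qed
qed

text \<open>The difference of the two approximating sequences tends to 0 in H1 and has the boundary
  limit g - g', so \<open>trace_closable\<close> applies.\<close>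

lemma has_trace_unique:
  fixes \<Omega> :: "(real^'d) set"
  assumes dim: "CARD('d) \<ge> 2" and \<Omega>: "lipschitz_domain \<Omega>" and t: "has_trace \<Omega> f g" "has_trace \<Omega> f g'"
  shows "AE x in surf (frontier \<Omega>). g x = g' x"
proof -
  obtain \<phi> \<phi>' where a: "trace_approx \<Omega> f (wgrad \<Omega> f) g \<phi>" "trace_approx \<Omega> f (wgrad \<Omega> f) g' \<phi>'"
    and H: "H1 \<Omega> f" and m: "g \<in> borel_measurable (surf (frontier \<Omega>))" "g' \<in> borel_measurable (surf (frontier \<Omega>))"
    using t by (auto simp: has_trace_iff)
  note l = trace_approx_lincomb[OF a H1_measurable[OF H] H1_measurable[OF H] wgrad_measurable[OF H] wgrad_measurable[OF H] m, of 1 "-1"]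
  have "AE x in surf (frontier \<Omega>). 1 * g x + (-1) * g' x = 0"
    by (rule trace_closable[OF dim \<Omega>, of "\<lambda>k x. 1 * \<phi> k x + (-1) * \<phi>' k x"])
      (use l m in \<open>simp_all add: trace_approx_def\<close>)
  then show ?thesis by eventually_elim simp
qed

lemma has_trace_lincomb:
  fixes \<Omega> :: "(real^'d) set"
  assumes \<Omega>: "open \<Omega>" "bounded \<Omega>" and t: "has_trace \<Omega> f g" "has_trace \<Omega> f' g'"
  shows "has_trace \<Omega> (\<lambda>x. a * f x + b * f' x) (\<lambda>x. a * g x + b * g' x)"
proof -
  let ?f = "\<lambda>x. a * f x + b * f' x"
  obtain \<phi> \<phi>' where p: "trace_approx \<Omega> f (wgrad \<Omega> f) g \<phi>" "trace_approx \<Omega> f' (wgrad \<Omega> f') g' \<phi>'"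
    and H: "H1 \<Omega> f" "H1 \<Omega> f'" and s: "sqint (surf (frontier \<Omega>)) g" "sqint (surf (frontier \<Omega>)) g'"
    using t by (auto simp: has_trace_iff)
  let ?\<chi> = "\<lambda>k x. a * \<phi> k x + b * \<phi>' k x" and ?G = "\<lambda>x. a *\<^sub>R wgrad \<Omega> f x + b *\<^sub>R wgrad \<Omega> f' x"
  have l: "trace_approx \<Omega> ?f ?G (\<lambda>x. a * g x + b * g' x) ?\<chi>"
    by (rule trace_approx_lincomb[OF p]) (use H s in \<open>auto intro: H1_measurable wgrad_measurable\<close>)
  have "nnsq (lebesgue_on \<Omega>) (\<lambda>x. cgrad (?\<chi> k) x - ?G x) = nnsq (lebesgue_on \<Omega>) (\<lambda>x. cgrad (?\<chi> k) x - wgrad \<Omega> ?f x)" for k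
  proof (rule nn_integral_cong_AE)
    show "AE x in lebesgue_on \<Omega>. ennreal ((norm (cgrad (?\<chi> k) x - ?G x))\<^sup>2) = ennreal ((norm (cgrad (?\<chi> k) x - wgrad \<Omega> ?f x))\<^sup>2)"
      using H1_lincomb(2)[OF \<Omega> H, of a b] by eventually_elim simp
  qed
  then have "trace_approx \<Omega> ?f (wgrad \<Omega> ?f) (\<lambda>x. a * g x + b * g' x) ?\<chi>"
    using l unfolding trace_approx_def by simp
  then show ?thesis
    using H1_lincomb(1)[OF \<Omega> H] sqint_lincomb[OF s] unfolding has_trace_iff by blast
qed

lemma has_trace_tr: "has_trace \<Omega> f g \<Longrightarrow> has_trace \<Omega> f (tr \<Omega> f)"
  unfolding tr_def by (rule someI[where P="has_trace \<Omega> f"])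

lemma tr_lincomb:
  fixes \<Omega> :: "(real^'d) set"
  assumes dim: "CARD('d) \<ge> 2" and \<Omega>: "lipschitz_domain \<Omega>"
    and t: "has_trace \<Omega> f g" "has_trace \<Omega> f' g'"
  shows "AE x in surf (frontier \<Omega>). tr \<Omega> (\<lambda>x. a * f x + b * f' x) x = a * tr \<Omega> f x + b * tr \<Omega> f' x"
proof -
  note l = has_trace_lincomb[OF lipschitz_domain_open[OF \<Omega>] lipschitz_domain_bounded[OF \<Omega>] has_trace_tr[OF t(1)] has_trace_tr[OF t(2)], of a b]
  show ?thesis by (rule has_trace_unique[OF dim \<Omega> has_trace_tr[OF l] l])
qed

section \<open>Friedrichs inequality\<close>

text \<open>Cauchy-Schwarz on a segment, obtained by integrating the nonnegative expression w - 2 m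
  f' + m^2 with the mean slope m of f.\<close>

lemma C1c_increment_sq_le:
  fixes v :: "real^'d"
  assumes \<phi>: "C1c \<phi>" and v: "norm v = 1" and \<tau>: "0 < \<tau>"
  shows "ennreal ((\<phi> (z + \<tau> *\<^sub>R v) - \<phi> z)\<^sup>2) \<le> ennreal \<tau> *
    (\<integral>\<^sup>+t. ennreal ((norm (cgrad \<phi> (z + t *\<^sub>R v)))\<^sup>2) * indicator {0<..<\<tau>} t \<partial>lborel)"
proof -
  define f where "f t = \<phi> (z + t *\<^sub>R v)" for t
  define f' where "f' t = cgrad \<phi> (z + t *\<^sub>R v) \<bullet> v" for t
  define w where "w t = (norm (cgrad \<phi> (z + t *\<^sub>R v)))\<^sup>2" for t
  have d: "(f has_real_derivative f' t) (at t)" for t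
    unfolding f_def f'_def by (rule C1c_derivative_line[OF \<phi>])
  have wpos: "0 \<le> w t" for t by (simp add: w_def)
  have cw: "continuous_on A w" for A
    unfolding w_def by (intro continuous_intros C1c_continuous_line[OF \<phi>])
  have f'w: "(f' t)\<^sup>2 \<le> w t" for t
    using Cauchy_Schwarz_ineq2[of "cgrad \<phi> (z + t *\<^sub>R v)" v] v unfolding w_def
    by (metis f'_def mult.right_neutral abs_le_square_iff abs_norm_cancel)
  define \<Delta> where "\<Delta> = f \<tau> - f 0"
  define m where "m = \<Delta> / \<tau>"
  define I where "I = integral {0..\<tau>} w"
  have "(f' has_integral \<Delta>) {0..\<tau>}"
    unfolding \<Delta>_def using \<tau> d
    by (intro fundamental_theorem_of_calculus)
      (auto simp: has_real_derivative_iff_has_vector_derivative intro: has_vector_derivative_at_within)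
  moreover have wi: "(w has_integral I) {0..\<tau>}"
    unfolding I_def by (intro integrable_integral integrable_continuous_real cw)
  moreover have "((\<lambda>t. m\<^sup>2) has_integral (m\<^sup>2 * \<tau>)) {0..\<tau>}"
    using has_integral_const_real[of "m\<^sup>2" 0 \<tau>] \<tau> by (simp add: mult.commute)
  ultimately have "((\<lambda>t. w t - 2 * m * f' t + m\<^sup>2) has_integral (I - 2 * m * \<Delta> + m\<^sup>2 * \<tau>)) {0..\<tau>}"
    by (intro has_integral_add has_integral_diff has_integral_mult_right)
  moreover have "0 \<le> w t - 2 * m * f' t + m\<^sup>2" for t
    using f'w[of t] zero_le_power2[of "f' t - m"] by (simp add: power2_diff algebra_simps)
  ultimately have "0 \<le> I - 2 * m * \<Delta> + m\<^sup>2 * \<tau>" by (rule has_integral_nonneg)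
  then have "\<tau> * (2 * m * \<Delta> - m\<^sup>2 * \<tau>) \<le> \<tau> * I" using \<tau> by (intro mult_left_mono) auto
  also have "\<tau> * (2 * m * \<Delta> - m\<^sup>2 * \<tau>) = \<Delta>\<^sup>2" using \<tau> by (simp add: m_def power2_eq_square field_simps)
  finally have "ennreal (\<Delta>\<^sup>2) \<le> ennreal \<tau> * ennreal I"
    using \<tau> by (subst ennreal_mult'[symmetric]) (auto intro: ennreal_leI)
  also have "ennreal I = (\<integral>\<^sup>+t. ennreal (w t) * indicator {0<..<\<tau>} t \<partial>lborel)"
    using wi by (intro nn_integral_has_integral_lebesgue'[symmetric])
      (simp_all add: has_integral_Icc_iff_Ioo wpos)
  finally show ?thesis by (simp add: \<Delta>_def f_def w_def)
qed

section \<open>Exit times and exit points of parallel rays\<close>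

definition exit_time :: "'a::euclidean_space set \<Rightarrow> 'a \<Rightarrow> 'a \<Rightarrow> real" where
  "exit_time \<Omega> b z = Inf {t. 0 \<le> t \<and> z + t *\<^sub>R b \<notin> \<Omega>}"

text \<open>The infimum is attained since the complement of \<Omega> is closed, and it is at most
  2\<rho> since points of \<Omega> have norm below \<rho>. The exit point is a limit of earlier
  points of the ray, hence in the frontier.\<close>

lemma exit_time:
  fixes \<Omega> :: "'a::euclidean_space set"
  assumes \<Omega>: "open \<Omega>" and b: "norm b = 1" and \<rho>': "\<forall>x\<in>\<Omega>. norm x < \<rho>" and z: "z \<in> \<Omega>"
  shows "0 < exit_time \<Omega> b z" "exit_time \<Omega> b z \<le> 2 * \<rho>"
    and "\<And>t. 0 \<le> t \<Longrightarrow> t < exit_time \<Omega> b z \<Longrightarrow> z + t *\<^sub>R b \<in> \<Omega>"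
    and "z + exit_time \<Omega> b z *\<^sub>R b \<in> frontier \<Omega>"
proof -
  have \<rho>: "norm x < \<rho>" if "x \<in> \<Omega>" for x using \<rho>' that by blast
  let ?T = "{t. 0 \<le> t \<and> z + t *\<^sub>R b \<notin> \<Omega>}"
  let ?\<tau> = "exit_time \<Omega> b z"
  have \<rho>0: "0 < \<rho>" using \<rho>[OF z] norm_ge_zero le_less_trans by blast
  have in2: "2 * \<rho> \<in> ?T"
  proof -
    have "\<rho> \<le> norm (z + (2 * \<rho>) *\<^sub>R b)"
      using norm_diff_ineq[of "(2 * \<rho>) *\<^sub>R b" z] \<rho>[OF z] b \<rho>0 by (simp add: add.commute)
    then show ?thesis using \<rho>[of "z + (2 * \<rho>) *\<^sub>R b"] \<rho>0 by auto
  qed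
  have bb: "bdd_below ?T" by (rule bdd_belowI[of _ 0]) auto
  have cl: "closed ?T"
  proof -
    have "closed ({t. 0 \<le> t} \<inter> (\<lambda>t. z + t *\<^sub>R b) -` (- \<Omega>))"
      using \<Omega> by (intro closed_Int closed_vimage closed_Collect_le continuous_intros) auto
    then show ?thesis by (simp add: vimage_def Int_def)
  qed
  have inT: "?\<tau> \<in> ?T" unfolding exit_time_def using in2 by (intro closed_contains_Inf[OF _ bb cl]) blast
  show "?\<tau> \<le> 2 * \<rho>" unfolding exit_time_def by (rule cInf_lower[OF in2 bb])
  have "?\<tau> \<noteq> 0" using inT z by auto
  then show pos: "0 < ?\<tau>" using inT by simp
  show seg: "z + t *\<^sub>R b \<in> \<Omega>" if "0 \<le> t" "t < ?\<tau>" for t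
    using that cInf_lower[OF _ bb, of t] unfolding exit_time_def by fastforce
  have "z + ?\<tau> *\<^sub>R b \<in> closure \<Omega>"
  proof (rule closure_sequential[THEN iffD2], intro exI conjI allI)
    let ?t = "\<lambda>n. ?\<tau> * (1 - 1 / (real n + 2))"
    show "z + ?t n *\<^sub>R b \<in> \<Omega>" for n using pos by (intro seg) (auto simp: field_simps)
    have "(\<lambda>n. 1 / (real n + 2)) \<longlonglongrightarrow> 0"
      using LIMSEQ_ignore_initial_segment[OF lim_inverse_n', of 2] by (simp add: add.commute)
    then have "(\<lambda>n. z + ?t n *\<^sub>R b) \<longlonglongrightarrow> z + (?\<tau> * (1 - 0)) *\<^sub>R b" by (intro tendsto_intros)
    then show "(\<lambda>n. z + ?t n *\<^sub>R b) \<longlonglongrightarrow> z + ?\<tau> *\<^sub>R b" by simp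
  qed
  then show "z + ?\<tau> *\<^sub>R b \<in> frontier \<Omega>" using inT \<Omega> by (simp add: frontier_def interior_open)
qed

text \<open>The exit time is lower semicontinuous. For s \<ge> 0 it exceeds s exactly if the segment
  up to time s stays in \<Omega>, and the starting points violating this form the Minkowski
  difference of a closed and a compact set, which is closed.\<close>

lemma exit_time_measurable:
  fixes \<Omega> :: "'a::euclidean_space set"
  assumes \<Omega>: "open \<Omega>" "bounded \<Omega>" and b: "norm b = 1"
  shows "exit_time \<Omega> b \<in> borel_measurable (restrict_space borel \<Omega>)"
proof (subst borel_measurable_iff_greater, rule allI)
  fix s :: real
  obtain \<rho> where \<rho>: "\<forall>x\<in>\<Omega>. norm x < \<rho>" using \<Omega>(2) bounded_pos_less by blast
  note et = exit_time[OF \<Omega>(1) b \<rho>]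
  show "{z \<in> space (restrict_space borel \<Omega>). s < exit_time \<Omega> b z} \<in> sets (restrict_space borel \<Omega>)"
  proof (cases "s < 0")
    case True
    then have "{z \<in> space (restrict_space borel \<Omega>). s < exit_time \<Omega> b z} = \<Omega>"
      using et(1) by (force simp: space_restrict_space)
    then show ?thesis using \<Omega>(1) by (simp add: sets_restrict_space_iff)
  next
    case False
    let ?S = "{z. \<forall>t\<in>{0..s}. z + t *\<^sub>R b \<in> \<Omega>}"
    have "{z \<in> space (restrict_space borel \<Omega>). s < exit_time \<Omega> b z} = ?S"
    proof (intro equalityI subsetI)
      fix z assume "z \<in> {z \<in> space (restrict_space borel \<Omega>). s < exit_time \<Omega> b z}"
      then show "z \<in> ?S" using et(3)[of z] by (auto simp: space_restrict_space)
    next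
      fix z assume z: "z \<in> ?S"
      then have z\<Omega>: "z \<in> \<Omega>" using False by (auto dest: bspec[of _ _ 0])
      have "s < exit_time \<Omega> b z"
      proof (rule ccontr)
        assume "\<not> s < exit_time \<Omega> b z"
        then have "z + exit_time \<Omega> b z *\<^sub>R b \<in> \<Omega>" using z et(1)[OF z\<Omega>] by auto
        then show False using et(4)[OF z\<Omega>] \<Omega>(1) by (simp add: frontier_def interior_open)
      qed
      then show "z \<in> {z \<in> space (restrict_space borel \<Omega>). s < exit_time \<Omega> b z}"
        using z\<Omega> by (simp add: space_restrict_space)
    qed
    moreover have "open ?S"
    proof -
      let ?K = "(\<lambda>t. t *\<^sub>R b) ` {0..s}"
      have "compact ?K" by (intro compact_continuous_image continuous_intros) auto
      then have "closed (\<Union>x\<in>- \<Omega>. \<Union>y\<in>?K. {x - y})"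
        using \<Omega>(1) by (intro closed_compact_differences) auto
      moreover have "(\<Union>x\<in>- \<Omega>. \<Union>y\<in>?K. {x - y}) = - ?S"
      proof (intro equalityI subsetI)
        fix z assume "z \<in> - ?S"
        then obtain t where "t \<in> {0..s}" "z + t *\<^sub>R b \<in> - \<Omega>" by auto
        then show "z \<in> (\<Union>x\<in>- \<Omega>. \<Union>y\<in>?K. {x - y})"
          by (intro UN_I[of "z + t *\<^sub>R b"] UN_I[of "t *\<^sub>R b"]) auto
      next
        fix z assume "z \<in> (\<Union>x\<in>- \<Omega>. \<Union>y\<in>?K. {x - y})"
        then obtain x t where "x \<notin> \<Omega>" "t \<in> {0..s}" "z = x - t *\<^sub>R b" by auto
        then show "z \<in> - ?S" by (auto intro!: bexI[of _ t])
      qed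
      ultimately show ?thesis by (simp add: open_closed)
    qed
    ultimately show ?thesis using \<Omega>(1) et(1) by (auto simp: sets_restrict_space_iff space_restrict_space)
  qed
qed

lemma exit_point_measurable:
  fixes \<Omega> :: "'a::euclidean_space set"
  assumes \<Omega>: "open \<Omega>" "bounded \<Omega>" and b: "norm b = 1"
  shows "(\<lambda>z. z + exit_time \<Omega> b z *\<^sub>R b) \<in> borel_measurable (restrict_space lborel \<Omega>)"
proof -
  have "(\<lambda>z. z + exit_time \<Omega> b z *\<^sub>R b) \<in> borel_measurable (restrict_space borel \<Omega>)"
    by (intro borel_measurable_add borel_measurable_scaleR exit_time_measurable[OF assms] measurable_restrict_space1) auto
  then show ?thesis
    by (simp add: measurable_cong_sets[OF sets_restrict_space_cong[OF sets_lborel] refl])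
qed

text \<open>The image of Lebesgue measure under the exit map is at most a constant times the surface
  measure: the points that leave through \<open>B\<close> form a shadow of \<open>B\<close> along
  the rays, of controlled volume. Comparing the measures on sets first gives the inequality for all
  integrands.\<close>

lemma nn_integral_exit_point_le:
  fixes \<Omega> :: "(real^'d) set" and b :: "real^'d"
  assumes dim: "CARD('d) \<ge> 2" and \<Omega>: "open \<Omega>" "bounded \<Omega>" and b: "b \<in> Basis"
  obtains C :: real where "0 \<le> C" "\<And>F. F \<in> borel_measurable borel \<Longrightarrow>
    (\<integral>\<^sup>+z. F (z + exit_time \<Omega> b z *\<^sub>R b) * indicator \<Omega> z \<partial>lborel) \<le> ennreal C * (\<integral>\<^sup>+y. F y \<partial>surf (frontier \<Omega>))"
proof -
  have b1: "norm b = 1" using b by simp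
  obtain \<rho> where \<rho>: "\<forall>x\<in>\<Omega>. norm x < \<rho>" using \<Omega>(2) bounded_pos_less by blast
  define R where "R = 2 * \<bar>\<rho>\<bar>"
  have R: "0 \<le> R" by (simp add: R_def)
  have et: "0 < exit_time \<Omega> b z" "exit_time \<Omega> b z \<le> R" "z + exit_time \<Omega> b z *\<^sub>R b \<in> frontier \<Omega>" if "z \<in> \<Omega>" for z
    using exit_time[OF \<Omega>(1) b1 \<rho> that] by (auto simp: R_def)
  let ?s = "real CARD('d) - 1"
  define C where "C = 2 powr ?s * (R + 2) / hausdorff_coef ?s"
  have C0: "0 \<le> C" unfolding C_def using R dim by (intro divide_nonneg_nonneg) auto
  define Y where "Y z = z + exit_time \<Omega> b z *\<^sub>R b" for z
  let ?M = "restrict_space lborel \<Omega>" and ?S = "surf (frontier \<Omega>)"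
  have Yb: "Y \<in> borel_measurable ?M" unfolding Y_def by (rule exit_point_measurable[OF \<Omega> b1])
  have YS: "Y \<in> measurable ?M ?S"
    unfolding measurable_cong_sets[OF refl sets_surf]
    using Yb et(3) by (intro measurable_restrict_space2) (auto simp: Y_def space_restrict_space)
  have "distr ?M ?S Y \<le> scale_measure (ennreal C) ?S"
  proof (subst le_measure, simp, intro ballI)
    fix B assume "B \<in> sets (distr ?M ?S Y)"
    then have B: "B \<in> sets ?S" by simp
    have "emeasure (distr ?M ?S Y) B = emeasure ?M (Y -` B \<inter> space ?M)"
      by (rule emeasure_distr[OF YS B])
    also have "\<dots> = emeasure lborel (Y -` B \<inter> \<Omega>)"
      using \<Omega>(1) by (subst emeasure_restrict_space) (auto simp: space_restrict_space)
    also have "\<dots> \<le> ennreal (2 powr (real DIM(real^'d) - 1) * (R + 2) / hausdorff_coef (real DIM(real^'d) - 1)) 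
        * hausdorff_outer (real DIM(real^'d) - 1) B"
    proof (rule emeasure_shadow_le_hausdorff[OF _ b R])
      show "2 \<le> DIM(real^'d)" using dim by simp
      fix z assume "z \<in> Y -` B \<inter> \<Omega>"
      then show "\<exists>t. 0 \<le> t \<and> t \<le> R \<and> z + t *\<^sub>R b \<in> B"
        using et[of z] by (intro exI[of _ "exit_time \<Omega> b z"]) (auto simp: Y_def)
    qed
    also have "\<dots> = emeasure (scale_measure (ennreal C) ?S) B"
      using emeasure_surf[OF _ B] by (simp add: C_def)
    finally show "emeasure (distr ?M ?S Y) B \<le> emeasure (scale_measure (ennreal C) ?S) B" .
  qed
  then have le: "nn_integral (distr ?M ?S Y) F \<le> nn_integral (scale_measure (ennreal C) ?S) F" for F
    by (intro nn_integral_mono_measure) simp_all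
  show thesis
  proof (rule that[OF C0])
    fix F :: "real^'d \<Rightarrow> ennreal" assume F: "F \<in> borel_measurable borel"
    have FS: "F \<in> borel_measurable ?S"
      unfolding surf_def using F by (intro measurable_restrict_space1) (simp add: measurable_cong_sets[OF sets_hausdorff_measure refl])
    have "(\<integral>\<^sup>+z. F (z + exit_time \<Omega> b z *\<^sub>R b) * indicator \<Omega> z \<partial>lborel) = (\<integral>\<^sup>+z. F (Y z) \<partial>?M)"
      using \<Omega>(1) by (subst nn_integral_restrict_space) (auto simp: Y_def)
    also have "\<dots> = nn_integral (distr ?M ?S Y) F"
      using FS YS by (subst nn_integral_distr) auto
    also have "\<dots> \<le> nn_integral (scale_measure (ennreal C) ?S) F" by (rule le)
    also have "\<dots> = ennreal C * nn_integral ?S F" using FS by (rule nn_integral_scale_measure)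
    finally show "(\<integral>\<^sup>+z. F (z + exit_time \<Omega> b z *\<^sub>R b) * indicator \<Omega> z \<partial>lborel) \<le> ennreal C * (\<integral>\<^sup>+y. F y \<partial>?S)" .
  qed
qed

lemma friedrichs_C1c:
  fixes \<Omega> :: "(real^'d) set"
  assumes dim: "CARD('d) \<ge> 2" and \<Omega>: "open \<Omega>" "bounded \<Omega>"
  obtains C :: real where "0 \<le> C" "\<And>\<phi>. C1c \<phi> \<Longrightarrow>
    nnsq (lebesgue_on \<Omega>) \<phi> \<le>
      ennreal C * ((nnsq (lebesgue_on \<Omega>) (cgrad \<phi>)) + nnsq (surf (frontier \<Omega>)) \<phi>)"
proof -
  obtain b :: "real^'d" where b: "b \<in> Basis" using nonempty_Basis by blast
  have b1: "norm b = 1" using b by simp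
  obtain C where C: "0 \<le> C" and exit: "\<And>F. F \<in> borel_measurable borel \<Longrightarrow>
    (\<integral>\<^sup>+z. F (z + exit_time \<Omega> b z *\<^sub>R b) * indicator \<Omega> z \<partial>lborel) \<le> ennreal C * (\<integral>\<^sup>+y. F y \<partial>surf (frontier \<Omega>))"
    by (rule nn_integral_exit_point_le[OF dim \<Omega> b]) (rule that)
  obtain \<rho> where \<rho>: "\<forall>x\<in>\<Omega>. norm x < \<rho>" using \<Omega>(2) bounded_pos_less by blast
  define R where "R = 2 * \<bar>\<rho>\<bar>"
  have R: "0 \<le> R" by (simp add: R_def)
  note et = exit_time[OF \<Omega>(1) b1 \<rho>]
  have \<Omega>b: "\<Omega> \<in> sets borel" "\<Omega> \<in> sets lebesgue" using \<Omega> by auto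
  \<comment> \<open>The 2 comes from splitting a square, C from the exit points, and R^2 from the
    increments: one R bounds the factor in Cauchy-Schwarz, the other is the length of the
    window.\<close>
  define C' where "C' = 2 * (C + R\<^sup>2)"
  show thesis
  proof (rule that[of C'])
    show "0 \<le> C'" using C by (simp add: C'_def)
    fix \<phi> :: "real^'d \<Rightarrow> real" assume \<phi>: "C1c \<phi>"
    note [measurable] = C1c_measurable[OF \<phi>] cgrad_measurable[OF \<phi>] \<Omega>b(1)
    define G where "G z = ennreal ((norm (cgrad \<phi> z))\<^sup>2) * indicator \<Omega> z" for z
    have G[measurable]: "G \<in> borel_measurable borel" unfolding G_def by measurable
    \<comment> \<open>The fixed window [0, R] replaces the exit time, which varies with z. With the
      cut-off inside \<open>G\<close> this is a plain average over parallel lines, and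
      \<open>nn_integral_line_average\<close> gives its integral.\<close>
    define J where "J z = (\<integral>\<^sup>+s. G (z + s *\<^sub>R b) * indicator {0..R} s \<partial>lborel)" for z
    define E where "E z = ennreal ((\<phi> (z + exit_time \<Omega> b z *\<^sub>R b))\<^sup>2) * indicator \<Omega> z" for z
    have Jm[measurable]: "J \<in> borel_measurable lborel"
      unfolding J_def by (rule nn_integral_line_average[OF G]) simp
    have pw: "ennreal ((\<phi> z)\<^sup>2) * indicator \<Omega> z \<le> 2 * E z + ennreal (2 * R) * J z" for z
    proof (cases "z \<in> \<Omega>")
      case True
      let ?\<tau> = "exit_time \<Omega> b z"
      let ?y = "z + ?\<tau> *\<^sub>R b"
      have \<tau>: "0 < ?\<tau>" "?\<tau> \<le> R" using et(1,2)[OF True] by (auto simp: R_def)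
      have "(\<phi> z)\<^sup>2 \<le> 2 * (\<phi> ?y)\<^sup>2 + 2 * (\<phi> ?y - \<phi> z)\<^sup>2"
        using zero_le_power2[of "2 * \<phi> ?y - \<phi> z"] by (simp add: power2_eq_square algebra_simps)
      then have "ennreal ((\<phi> z)\<^sup>2) \<le> ennreal (2 * (\<phi> ?y)\<^sup>2 + 2 * (\<phi> ?y - \<phi> z)\<^sup>2)" by (rule ennreal_leI)
      also have "\<dots> = 2 * ennreal ((\<phi> ?y)\<^sup>2) + 2 * ennreal ((\<phi> ?y - \<phi> z)\<^sup>2)"
        by (simp add: ennreal_mult')
      also have "ennreal ((\<phi> ?y - \<phi> z)\<^sup>2) \<le> ennreal ?\<tau> *
         (\<integral>\<^sup>+t. ennreal ((norm (cgrad \<phi> (z + t *\<^sub>R b)))\<^sup>2) * indicator {0<..<?\<tau>} t \<partial>lborel)"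
        by (rule C1c_increment_sq_le[OF \<phi> b1 \<tau>(1)])
      also have "\<dots> \<le> ennreal R * J z"
      proof (intro mult_mono ennreal_leI)
        have "ennreal ((norm (cgrad \<phi> (z + t *\<^sub>R b)))\<^sup>2) * indicator {0<..<?\<tau>} t \<le> G (z + t *\<^sub>R b) * indicator {0..R} t" for t
          using \<tau> et(3)[OF True, of t] by (cases "t \<in> {0<..<?\<tau>}") (auto simp: G_def)
        then show "(\<integral>\<^sup>+t. ennreal ((norm (cgrad \<phi> (z + t *\<^sub>R b)))\<^sup>2) * indicator {0<..<?\<tau>} t \<partial>lborel) \<le> J z"
          unfolding J_def by (rule nn_integral_mono)
      qed (use \<tau> in auto)
      finally have "ennreal ((\<phi> z)\<^sup>2) \<le> 2 * ennreal ((\<phi> ?y)\<^sup>2) + 2 * (ennreal R * J z)"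
        by (simp add: add_left_mono mult_left_mono)
      also have "2 * (ennreal R * J z) = ennreal (2 * R) * J z" using R by (simp add: ennreal_mult' mult.assoc)
      finally show ?thesis using True by (simp add: E_def)
    qed simp
    have Ein: "(\<integral>\<^sup>+z. E z \<partial>lborel) \<le> ennreal C * nnsq (surf (frontier \<Omega>)) \<phi>"
      unfolding E_def real_norm_def power2_abs by (rule exit) measurable
    have Jin: "(\<integral>\<^sup>+z. J z \<partial>lborel) = (\<integral>\<^sup>+z. G z \<partial>lborel) * ennreal R"
      unfolding J_def using R by (subst nn_integral_line_average(2)[OF G]) auto
    have Em[measurable]: "E \<in> borel_measurable lborel"
    proof -
      have "(\<lambda>z. \<phi> (z + exit_time \<Omega> b z *\<^sub>R b)) \<in> borel_measurable (restrict_space lborel \<Omega>)"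
        by (rule measurable_compose[OF exit_point_measurable[OF \<Omega> b1] C1c_measurable[OF \<phi>]])
      then have "(\<lambda>z. ennreal ((\<phi> (z + exit_time \<Omega> b z *\<^sub>R b))\<^sup>2)) \<in> borel_measurable (restrict_space lborel \<Omega>)"
        by (intro measurable_compose[OF _ measurable_ennreal] borel_measurable_power)
      then show ?thesis unfolding E_def 
        using \<Omega>b by (subst (asm) borel_measurable_restrict_space_iff_ennreal) auto
    qed
    have "nnsq (lebesgue_on \<Omega>) \<phi> = (\<integral>\<^sup>+z. ennreal ((\<phi> z)\<^sup>2) * indicator \<Omega> z \<partial>lborel)"
      unfolding real_norm_def power2_abs using \<Omega>b(2) by (rule nn_integral_lebesgue_on)
    also have "\<dots> \<le> (\<integral>\<^sup>+z. 2 * E z + ennreal (2 * R) * J z \<partial>lborel)"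
      by (intro nn_integral_mono pw)
    also have "\<dots> = 2 * (\<integral>\<^sup>+z. E z \<partial>lborel) + ennreal (2 * R) * (\<integral>\<^sup>+z. J z \<partial>lborel)"
      by (simp add: nn_integral_add nn_integral_cmult)
    also have "\<dots> \<le> 2 * (ennreal C * nnsq (surf (frontier \<Omega>)) \<phi>) + ennreal (2 * R) * ((\<integral>\<^sup>+z. G z \<partial>lborel) * ennreal R)"
      unfolding Jin by (intro add_mono mult_left_mono Ein) auto
    also have "\<dots> = ennreal (2 * C) * nnsq (surf (frontier \<Omega>)) \<phi> + ennreal (2 * R\<^sup>2) * (\<integral>\<^sup>+z. G z \<partial>lborel)"
      using C R by (simp add: ennreal_mult' power2_eq_square mult_ac)
    also have "\<dots> \<le> ennreal C' * nnsq (surf (frontier \<Omega>)) \<phi> + ennreal C' * (\<integral>\<^sup>+z. G z \<partial>lborel)"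
      using C R by (intro add_mono mult_right_mono ennreal_leI) (auto simp: C'_def)
    also have "(\<integral>\<^sup>+z. G z \<partial>lborel) = (nnsq (lebesgue_on \<Omega>) (cgrad \<phi>))"
      unfolding G_def using \<Omega>b(2) by (rule nn_integral_lebesgue_on[symmetric])
    finally show "nnsq (lebesgue_on \<Omega>) \<phi> \<le>
      ennreal C' * ((nnsq (lebesgue_on \<Omega>) (cgrad \<phi>)) + nnsq (surf (frontier \<Omega>)) \<phi>)"
      by (simp add: distrib_left add.commute)
  qed
qed

lemma friedrichs_has_trace:
  fixes \<Omega> :: "(real^'d) set"
  assumes dim: "CARD('d) \<ge> 2" and \<Omega>: "open \<Omega>" "bounded \<Omega>"
  obtains C :: real where "0 \<le> C" "\<And>f g. has_trace \<Omega> f g \<Longrightarrow>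
    (\<integral>x. (f x)\<^sup>2 \<partial>lebesgue_on \<Omega>) \<le> C * ((\<integral>x. (norm (wgrad \<Omega> f x))\<^sup>2 \<partial>lebesgue_on \<Omega>) + (\<integral>x. (g x)\<^sup>2 \<partial>surf (frontier \<Omega>)))"
proof -
  obtain C where C: "0 \<le> C" and fr: "\<And>\<phi>. C1c \<phi> \<Longrightarrow>
    nnsq (lebesgue_on \<Omega>) \<phi> \<le>
      ennreal C * ((nnsq (lebesgue_on \<Omega>) (cgrad \<phi>)) + nnsq (surf (frontier \<Omega>)) \<phi>)"
    by (rule friedrichs_C1c[OF dim \<Omega>]) (rule that)
  \<comment> \<open>One factor 2 arises from comparing f with \<open>\<phi> k\<close>, another from
    comparing the gradient and boundary values of \<open>\<phi> k\<close> with those of f.\<close>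
  show thesis
  proof (rule that[of "4 * C"])
    show "0 \<le> 4 * C" using C by simp
    fix f g assume t: "has_trace \<Omega> f g"
    have H: "H1 \<Omega> f" and gm: "g \<in> borel_measurable (surf (frontier \<Omega>))"
      and gi: "integrable (surf (frontier \<Omega>)) (\<lambda>x. (g x)\<^sup>2)" using t by (auto simp: has_trace_def)
    let ?L = "lebesgue_on \<Omega>" and ?S = "surf (frontier \<Omega>)"
    obtain \<phi> where ta: "trace_approx \<Omega> f (wgrad \<Omega> f) g \<phi>" using t by (auto simp: has_trace_iff)
    then have \<phi>: "C1c (\<phi> k)" for k by (simp add: trace_approx_def)
    have ms: "\<phi> k \<in> borel_measurable ?L" "cgrad (\<phi> k) \<in> borel_measurable ?L" "\<phi> k \<in> borel_measurable ?S" for k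
      using \<phi> C1c_measurable cgrad_measurable by (auto intro!: borel_measurable_lebesgue_on surf_measurable)
    note fm = H1_measurable[OF H] and wm = wgrad_measurable[OF H]
    define A where "A k = nnsq ?L (\<lambda>x. \<phi> k x - f x)" for k
    define B where "B k = nnsq ?L (\<lambda>x. cgrad (\<phi> k) x - wgrad \<Omega> f x)" for k
    define D where "D k = nnsq ?S (\<lambda>x. \<phi> k x - g x)" for k
    let ?f = "nnsq ?L f" and ?w = "nnsq ?L (wgrad \<Omega> f)" and ?g = "nnsq ?S g"
    have 1: "?f \<le> 2 * A k + 2 * nnsq ?L (\<phi> k)" for k
      using nnsq_lincomb_le[of "\<lambda>x. \<phi> k x - f x" ?L "\<phi> k" "-1" 1] ms fm by (simp add: A_def)
    have 2: "nnsq ?L (\<lambda>x. cgrad (\<phi> k) x) \<le> 2 * B k + 2 * ?w" for k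
      using nnsq_lincomb_le[of "\<lambda>x. cgrad (\<phi> k) x - wgrad \<Omega> f x" ?L "wgrad \<Omega> f" 1 1] ms wm by (simp add: B_def)
    have 3: "nnsq ?S (\<phi> k) \<le> 2 * D k + 2 * ?g" for k
      using nnsq_lincomb_le[of "\<lambda>x. \<phi> k x - g x" ?S g 1 1] ms gm by (simp add: D_def)
    have le: "?f \<le> 2 * A k + 2 * (ennreal C * ((2 * B k + 2 * ?w) + (2 * D k + 2 * ?g)))" for k
    proof -
      have "nnsq ?L (\<phi> k) \<le> ennreal C * ((2 * B k + 2 * ?w) + (2 * D k + 2 * ?g))"
        by (rule order_trans[OF fr[OF \<phi>]]) (intro mult_left_mono add_mono 2 3; simp)
      then show ?thesis using 1[of k] by (meson add_left_mono mult_left_mono order_trans zero_le)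
    qed
    have "(\<lambda>k. 2 * A k + 2 * (ennreal C * ((2 * B k + 2 * ?w) + (2 * D k + 2 * ?g)))) \<longlonglongrightarrow>
       2 * 0 + 2 * (ennreal C * ((2 * 0 + 2 * ?w) + (2 * 0 + 2 * ?g)))"
      using ta by (intro tendsto_add ennreal_tendsto_cmult tendsto_const) (auto simp: A_def B_def D_def trace_approx_def)
    then have "?f \<le> 2 * 0 + 2 * (ennreal C * ((2 * 0 + 2 * ?w) + (2 * 0 + 2 * ?g)))"
      by (rule LIMSEQ_le_const) (use le in blast)
    then have main: "?f \<le> ennreal (4 * C) * (?w + ?g)"
      using C by (simp add: ennreal_mult' distrib_left mult_ac)
    have wi: "integrable ?L (\<lambda>x. (norm (wgrad \<Omega> f x))\<^sup>2)"
    proof -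
      have "integrable ?L (\<lambda>x. \<Sum>i\<in>UNIV. (wgrad \<Omega> f x $ i)\<^sup>2)"
        using sqint_square[OF wgrad_sqint[OF H]] by (intro Bochner_Integration.integrable_sum)
      then show ?thesis by (simp add: norm_vec_def L2_set_def sum_nonneg)
    qed
    have "?f = ennreal (\<integral>x. (f x)\<^sup>2 \<partial>?L)"
      unfolding real_norm_def power2_abs using sqint_square[OF H1_sqint[OF H]] by (intro nn_integral_eq_integral) auto
    moreover have "?w = ennreal (\<integral>x. (norm (wgrad \<Omega> f x))\<^sup>2 \<partial>?L)"
      using wi by (intro nn_integral_eq_integral) auto
    moreover have "?g = ennreal (\<integral>x. (g x)\<^sup>2 \<partial>?S)"
      unfolding real_norm_def power2_abs using gi by (intro nn_integral_eq_integral) auto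
    ultimately have "ennreal (\<integral>x. (f x)\<^sup>2 \<partial>?L) \<le> 
       ennreal (4 * C * ((\<integral>x. (norm (wgrad \<Omega> f x))\<^sup>2 \<partial>?L) + (\<integral>x. (g x)\<^sup>2 \<partial>?S)))"
      using main C by (simp add: ennreal_mult' ennreal_plus[symmetric] del: ennreal_plus)
    then show "(\<integral>x. (f x)\<^sup>2 \<partial>?L) \<le> 4 * C * ((\<integral>x. (norm (wgrad \<Omega> f x))\<^sup>2 \<partial>?L) + (\<integral>x. (g x)\<^sup>2 \<partial>?S))"
      using C by (subst (asm) ennreal_le_iff) (auto intro!: mult_nonneg_nonneg add_nonneg_nonneg)
  qed
qed

section \<open>The energy space\<close>

text \<open>\<open>min_eig\<close> is a \<open>Min\<close>, which carries meaning only on a finite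
  set. Eigenvectors of distinct eigenvalues are orthogonal, hence independent, so there are finitely
  many eigenvalues.\<close>

lemma symmetric_matrix_finite_eigenvalues:
  fixes K :: "real^'n^'n"
  assumes sym: "transpose K = K"
  shows "finite {l. \<exists>x. x \<noteq> 0 \<and> K *v x = l *\<^sub>R x}" (is "finite ?E")
proof -
  define X where "X l = (SOME x. x \<noteq> 0 \<and> K *v x = l *\<^sub>R x)" for l
  have X: "X l \<noteq> 0 \<and> K *v X l = l *\<^sub>R X l" if "l \<in> ?E" for l
    using that unfolding X_def mem_Collect_eq by (rule someI_ex)
  have inj: "inj_on X ?E"
  proof (rule inj_onI)
    fix l m assume lm: "l \<in> ?E" "m \<in> ?E" "X l = X m"
    have "l *\<^sub>R X l = m *\<^sub>R X m" using X[OF lm(1)] X[OF lm(2)] unfolding lm(3)[symmetric] by metis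
    then show "l = m" using X[OF lm(1)] unfolding lm(3)[symmetric] by simp
  qed
  have orth: "X l \<bullet> X m = 0" if "l \<in> ?E" "m \<in> ?E" "l \<noteq> m" for l m
  proof -
    have "(K *v X l) \<bullet> X m = X l \<bullet> (K *v X m)"
      using dot_lmul_matrix[of "X l" K "X m"] sym by (metis vector_transpose_matrix)
    then have "l * (X l \<bullet> X m) = m * (X l \<bullet> X m)" using X that by simp
    then show ?thesis using that(3) by simp
  qed
  have "pairwise orthogonal (X ` ?E)"
    using orth unfolding pairwise_def orthogonal_def by (metis (no_types, lifting) imageE)
  moreover have "0 \<notin> X ` ?E" using X by fastforce
  ultimately have "independent (X ` ?E)" by (rule pairwise_orthogonal_independent)
  then have "finite (X ` ?E)" using independent_bound by blast
  then show ?thesis using inj finite_imageD by blast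
qed

text \<open>The minimiser of the Rayleigh quotient on the unit sphere is an eigenvector.\<close>

lemma min_eig_le_rayleigh:
  fixes K :: "real^'n^'n"
  assumes sym: "transpose K = K"
  shows "min_eig K * (norm x)\<^sup>2 \<le> (K *v x) \<bullet> x"
proof -
  let ?f = "\<lambda>x. (K *v x) \<bullet> x"
  have adj: "(K *v x) \<bullet> y = x \<bullet> (K *v y)" for x y
    using dot_lmul_matrix[of x K y] sym by (metis vector_transpose_matrix)
  have "continuous_on (sphere 0 1) ?f"
    by (intro continuous_intros matrix_vector_mult_linear_continuous_on)
  moreover have "sphere (0 :: real^'n) 1 \<noteq> {}" by simp
  ultimately obtain z where z: "norm z = 1" and zmin: "\<And>y. norm y = 1 \<Longrightarrow> ?f z \<le> ?f y"
    using continuous_attains_inf[of "sphere (0 :: real^'n) 1" ?f] by auto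
  define l where "l = ?f z"
  have hom: "?f (c *\<^sub>R y) = c\<^sup>2 * ?f y" for c y
    by (simp add: matrix_vector_mult_scaleR power2_eq_square)
  have low: "l * (norm y)\<^sup>2 \<le> ?f y" for y
  proof (cases "y = 0")
    case False
    then have "l \<le> ?f ((1 / norm y) *\<^sub>R y)" unfolding l_def by (intro zmin) simp
    also have "\<dots> = ?f y / (norm y)\<^sup>2" by (simp only: hom) (simp add: power_divide)
    finally show ?thesis using False by (simp add: field_simps)
  qed simp
  have "K *v z = l *\<^sub>R z"
  proof (rule ccontr)
    define h where "h = K *v z - l *\<^sub>R z"
    assume "K *v z \<noteq> l *\<^sub>R z"
    then have c: "h \<bullet> h > 0" by (simp add: h_def)
    define r where "r = ?f h - l * (h \<bullet> h)"
    have zz: "z \<bullet> z = 1" using z by (simp add: norm_eq_1)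
    \<comment> \<open>First variation at the minimiser z in the direction of the residual h = Kz - l
      z, for which the linear term becomes 2 t |h|^2.\<close>
    have q: "0 \<le> 2 * t * (h \<bullet> h) + t\<^sup>2 * r" for t
    proof -
      have "0 \<le> ?f (z + t *\<^sub>R h) - l * ((z + t *\<^sub>R h) \<bullet> (z + t *\<^sub>R h))"
        using low[of "z + t *\<^sub>R h"] by (simp add: power2_norm_eq_inner)
      also have "?f (z + t *\<^sub>R h) = ?f z + 2 * t * ((K *v z) \<bullet> h) + t\<^sup>2 * ?f h"
        using adj[of h z] by (simp add: matrix_vector_right_distrib matrix_vector_mult_scaleR inner_add_left inner_add_right
            power2_eq_square algebra_simps inner_commute[of h])
      also have "(z + t *\<^sub>R h) \<bullet> (z + t *\<^sub>R h) = 1 + 2 * t * (z \<bullet> h) + t\<^sup>2 * (h \<bullet> h)"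
        by (simp add: inner_add_left inner_add_right zz power2_eq_square algebra_simps inner_commute[of h z])
      also have "?f z + 2 * t * ((K *v z) \<bullet> h) + t\<^sup>2 * ?f h - l * (1 + 2 * t * (z \<bullet> h) + t\<^sup>2 * (h \<bullet> h))
         = 2 * t * ((K *v z - l *\<^sub>R z) \<bullet> h) + t\<^sup>2 * r"
        by (simp add: l_def[symmetric] r_def inner_diff_left algebra_simps)
      finally show ?thesis by (simp add: h_def)
    qed
    \<comment> \<open>A step of length s against h is short enough for the linear term to win: s r
      \<le> |h|^2 < 2 |h|^2.\<close>
    define s where "s = (h \<bullet> h) / (\<bar>r\<bar> + 1)"
    have s: "s > 0" using c by (simp add: s_def add_nonneg_pos)
    have "0 \<le> s * (s * r - 2 * (h \<bullet> h))" using q[of "- s"] by (simp add: power2_eq_square algebra_simps)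
    then have "2 * (h \<bullet> h) \<le> s * r" using s by (simp add: zero_le_mult_iff)
    also have "\<dots> \<le> s * (\<bar>r\<bar> + 1)" using s by (intro mult_left_mono) auto
    also have "\<dots> = h \<bullet> h" by (simp add: s_def add_nonneg_pos)
    finally show False using c by simp
  qed
  then have "l \<in> {l. \<exists>x. x \<noteq> 0 \<and> K *v x = l *\<^sub>R x}" using z by (intro CollectI exI[of _ z]) auto
  then have "min_eig K \<le> l"
    unfolding min_eig_def by (intro Min_le symmetric_matrix_finite_eigenvalues sym)
  then have "min_eig K * (norm x)\<^sup>2 \<le> l * (norm x)\<^sup>2" by (intro mult_right_mono) auto
  then show ?thesis using low[of x] by linarith
qed

section \<open>Vector valued square integrable functions and restriction of surface measures\<close>

definition sqintv :: "'a measure \<Rightarrow> ('a \<Rightarrow> 'b::euclidean_space) \<Rightarrow> bool" where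
  "sqintv M u \<longleftrightarrow> u \<in> borel_measurable M \<and> integrable M (\<lambda>x. (norm (u x))\<^sup>2)"

lemma sqintv_real: "sqintv M f \<longleftrightarrow> sqint M f"
  by (simp add: sqintv_def sqint_def)

lemma sqintv_inner: 
  assumes "sqintv M u" "sqintv M v" shows "integrable M (\<lambda>x. u x \<bullet> v x)"
proof (rule Bochner_Integration.integrable_bound)
  have m [measurable]: "u \<in> borel_measurable M" "v \<in> borel_measurable M" using assms by (auto simp: sqintv_def)
  show "integrable M (\<lambda>x. norm (u x) * norm (v x))"
    using assms by (intro sqint_mult) (auto simp: sqintv_def sqint_def)
  show "(\<lambda>x. u x \<bullet> v x) \<in> borel_measurable M" by measurable
  show "AE x in M. norm (u x \<bullet> v x) \<le> norm (norm (u x) * norm (v x))"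
    using Cauchy_Schwarz_ineq2 by auto
qed

lemma sqintv_norm_sq: "sqintv M u \<Longrightarrow> integrable M (\<lambda>x. (norm (u x))\<^sup>2)"
  by (simp add: sqintv_def)

lemma sqintv_lincomb:
  assumes u: "sqintv M u" and v: "sqintv M v" shows "sqintv M (\<lambda>x. a *\<^sub>R u x + b *\<^sub>R v x)"
  unfolding sqintv_def
proof
  show "(\<lambda>x. a *\<^sub>R u x + b *\<^sub>R v x) \<in> borel_measurable M" using assms by (auto simp: sqintv_def)
  have "integrable M (\<lambda>x. a\<^sup>2 * (norm (u x))\<^sup>2 + b\<^sup>2 * (norm (v x))\<^sup>2 + (2 * a * b) * (u x \<bullet> v x))"
    using assms sqintv_inner[OF assms] by (auto simp: sqintv_def)
  then show "integrable M (\<lambda>x. (norm (a *\<^sub>R u x + b *\<^sub>R v x))\<^sup>2)" 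
    by (rule back_subst[of "integrable M"])
      (simp only: power2_norm_eq_inner inner_add_left inner_add_right inner_scaleR_left inner_scaleR_right,
        simp add: inner_commute power2_eq_square algebra_simps)
qed

lemma sqintv_vec:
  fixes u :: "'a \<Rightarrow> ('b::euclidean_space)^'n"
  assumes "\<And>i. sqintv M (\<lambda>x. u x $ i)" shows "sqintv M u"
  unfolding sqintv_def
proof
  have "(\<lambda>x. u x $ i \<bullet> b) \<in> borel_measurable M" for i b
    using assms[of i] by (auto simp: sqintv_def)
  then show "u \<in> borel_measurable M"
    by (subst borel_measurable_euclidean_space) (auto simp: Basis_vec_def inner_axis)
  have "integrable M (\<lambda>x. \<Sum>i\<in>UNIV. (norm (u x $ i))\<^sup>2)"
    using assms by (intro Bochner_Integration.integrable_sum) (auto simp: sqintv_def)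
  then show "integrable M (\<lambda>x. (norm (u x))\<^sup>2)"
    by (simp add: norm_vec_def L2_set_def sum_nonneg)
qed

lemma L2v_sqintv: "L2v \<Omega> u \<Longrightarrow> sqintv (lebesgue_on \<Omega>) u"
  by (intro sqintv_vec) (simp add: sqintv_real L2v_sqint)

lemma norm_vec_sq: "(norm (x :: ('b::real_normed_vector)^'n))\<^sup>2 = (\<Sum>i\<in>UNIV. (norm (x $ i))\<^sup>2)"
  by (simp add: norm_vec_def L2_set_def sum_nonneg)

lemma surf_restrict: 
  fixes A B :: "(real^'d) set"
  assumes "A \<in> sets borel" "B \<in> sets borel" "B \<subseteq> A"
  shows "surf B = restrict_space (surf A) B"
  using assms unfolding surf_def by (subst restrict_restrict_space) (auto simp: Int_absorb1)

lemma surf_subset: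
  fixes A B :: "(real^'d) set"
  assumes AB: "A \<in> sets borel" "B \<in> sets borel" "B \<subseteq> A"
  shows sqint_surf_subset: "sqint (surf A) g \<Longrightarrow> sqint (surf B) g"
    and AE_surf_subset: "AE x in surf A. P x \<Longrightarrow> AE x in surf B. P x"
proof -
  have B: "B \<inter> space (surf A) \<in> sets (surf A)"
    using AB by (auto simp: sets_surf sets_restrict_space_iff)
  show "sqint (surf B) g" if "sqint (surf A) g"
    unfolding surf_restrict[OF AB] sqint_def
  proof
    show "g \<in> borel_measurable (restrict_space (surf A) B)"
      using that by (intro measurable_restrict_space1) auto
    show "integrable (restrict_space (surf A) B) (\<lambda>x. (g x)\<^sup>2)"
      using B sqint_square[OF that] AB integrable_mult_indicator[OF B sqint_square[OF that]]
      by (subst integrable_restrict_space) (auto simp: Int_absorb2)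
  qed
  show "AE x in surf B. P x" if "AE x in surf A. P x"
    unfolding surf_restrict[OF AB] using B that by (subst AE_restrict_space_iff) auto
qed

text \<open>Traces of the energy space vanish on the frontier away from the interface; this moves
  the boundary term of the Friedrichs inequality to the interface.\<close>

lemma integral_surf_subset:
  fixes A B :: "(real^'d) set"
  assumes AB: "A \<in> sets borel" "B \<in> sets borel" "B \<subseteq> A"
    and z: "AE x in surf (A - B). g x = 0" and g: "g \<in> borel_measurable (surf A)"
  shows "(\<integral>x. (g x)\<^sup>2 \<partial>surf A) = (\<integral>x. (g x :: real)\<^sup>2 \<partial>surf B)"
proof -
  have B: "B \<inter> space (surf A) \<in> sets (surf A)" and AmB: "(A - B) \<inter> space (surf A) \<in> sets (surf A)"
    using AB by (auto simp: sets_surf sets_restrict_space_iff)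
  have "AE x in restrict_space (surf A) (A - B). g x = 0"
  proof -
    have e: "surf (A - B) = restrict_space (surf A) (A - B)" by (rule surf_restrict) (use AB in auto)
    show ?thesis unfolding e[symmetric] by (rule z)
  qed
  then have ae: "AE x in surf A. x \<in> A - B \<longrightarrow> g x = 0"
    using AmB by (subst (asm) AE_restrict_space_iff) auto
  have "(\<integral>x. (g x)\<^sup>2 \<partial>surf B) = (\<integral>x. indicator B x *\<^sub>R (g x)\<^sup>2 \<partial>surf A)"
    unfolding surf_restrict[OF AB] using B by (subst integral_restrict_space) auto
  also have "\<dots> = (\<integral>x. (g x)\<^sup>2 \<partial>surf A)"
  proof (rule integral_cong_AE)
    show "(\<lambda>x. indicator B x *\<^sub>R (g x)\<^sup>2) \<in> borel_measurable (surf A)"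
      using AB by (intro borel_measurable_scaleR borel_measurable_power g surf_measurable[of "indicator B"]) auto
    show "(\<lambda>x. (g x)\<^sup>2) \<in> borel_measurable (surf A)" using g by simp
    show "AE x in surf A. indicator B x *\<^sub>R (g x)\<^sup>2 = (g x)\<^sup>2"
      using ae AE_space by eventually_elim (auto simp: indicator_def)
  qed
  finally show ?thesis by simp
qed

text \<open>Measurability and unit length of \<open>nf\<close> make normal traces square integrable
  and bound them by the full trace. In the theorem the unit length is read off from
  \<open>outward_normal\<close>.\<close>

locale coupled_domains =
  fixes \<Omega>f \<Omega>p :: "(real^'d) set" and nf :: "real^'d \<Rightarrow> real^'d"
  assumes dim: "CARD('d) \<ge> 2"
    and dom_f: "lipschitz_domain \<Omega>f" and dom_p: "lipschitz_domain \<Omega>p"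
    and nf_measurable: "nf \<in> borel_measurable (surfG \<Omega>f \<Omega>p)"
    and nf_unit: "AE x in surfG \<Omega>f \<Omega>p. norm (nf x) = 1"
begin

abbreviation "Lf \<equiv> lebesgue_on \<Omega>f"
abbreviation "Lp \<equiv> lebesgue_on \<Omega>p"
abbreviation "\<Sigma> \<equiv> surfG \<Omega>f \<Omega>p"
abbreviation "WW \<equiv> W \<Omega>f \<Omega>p"
abbreviation "nsq \<equiv> normsq \<Omega>f \<Omega>p"
abbreviation "gsq \<equiv> gradsq \<Omega>f \<Omega>p"
abbreviation "tsq \<equiv> gammasq \<Omega>f \<Omega>p"
abbreviation "ips g S \<equiv> ipS g S \<Omega>f \<Omega>p"
abbreviation "aGt g \<gamma>f \<gamma>p \<equiv> form_aGt g \<gamma>f \<gamma>p nf \<Omega>f \<Omega>p"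
abbreviation "ast \<gamma>f \<gamma>p \<equiv> form_ast \<gamma>f \<gamma>p nf \<Omega>f \<Omega>p"
abbreviation "fpr g \<equiv> fpair g \<Omega>f \<Omega>p"
abbreviation "fgrad V \<equiv> wjac \<Omega>f (fst V)"
abbreviation "pgrad V \<equiv> wgrad \<Omega>p (snd V)"
abbreviation "ftr V \<equiv> trv \<Omega>f (fst V)"
abbreviation "ptr V \<equiv> tr \<Omega>p (snd V)"
abbreviation "rest_f \<equiv> surf (frontier \<Omega>f - interface \<Omega>f \<Omega>p)"
abbreviation "rest_p \<equiv> surf (frontier \<Omega>p - interface \<Omega>f \<Omega>p)"

text \<open>The combinations in the scheme are nested two-term combinations, so linearity is
  established once, in this form.\<close>

definition wcomb :: "real \<Rightarrow> 'd wel \<Rightarrow> real \<Rightarrow> 'd wel \<Rightarrow> 'd wel" where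
  "wcomb a U b V = wadd (wscale a U) (wscale b V)"

lemma fst_wcomb: "fst (wcomb a U b V) = (\<lambda>x. a *\<^sub>R fst U x + b *\<^sub>R fst V x)"
  and snd_wcomb: "snd (wcomb a U b V) = (\<lambda>x. a * snd U x + b * snd V x)"
  by (simp_all add: wcomb_def wadd_def wscale_def)

lemma open_f: "open \<Omega>f" and bounded_f: "bounded \<Omega>f" and open_p: "open \<Omega>p" and bounded_p: "bounded \<Omega>p"
  using dom_f dom_p by (auto simp: lipschitz_domain_def)

lemma interface_borel: "interface \<Omega>f \<Omega>p \<in> sets borel" and frontier_borel: "frontier A \<in> sets (borel :: (real^'d) measure)"
  by (auto simp: interface_def)

lemma interface_subset: "interface \<Omega>f \<Omega>p \<subseteq> frontier \<Omega>f" "interface \<Omega>f \<Omega>p \<subseteq> frontier \<Omega>p"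
  by (auto simp: interface_def)

text \<open>\<open>Hf\<close> and \<open>Hp\<close> ask for some trace that vanishes off the
  interface; uniqueness carries this over to the trace that \<open>tr\<close> selects.\<close>

lemma W_trace:
  assumes "V \<in> WW"
  shows "has_trace \<Omega>f (\<lambda>x. fst V x $ i) (tr \<Omega>f (\<lambda>x. fst V x $ i))"
    and "has_trace \<Omega>p (snd V) (ptr V)"
    and "AE x in rest_f. tr \<Omega>f (\<lambda>x. fst V x $ i) x = 0"
    and "AE x in rest_p. ptr V x = 0"
proof -
  obtain g where g: "has_trace \<Omega>f (\<lambda>x. fst V x $ i) g" "AE x in rest_f. g x = 0"
    using assms by (auto simp: W_def Hf_def mem_Times_iff)
  show t: "has_trace \<Omega>f (\<lambda>x. fst V x $ i) (tr \<Omega>f (\<lambda>x. fst V x $ i))" by (rule has_trace_tr[OF g(1)])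
  have "AE x in rest_f. tr \<Omega>f (\<lambda>x. fst V x $ i) x = g x"
    by (rule AE_surf_subset[OF _ _ _ has_trace_unique[OF dim dom_f t g(1)]]) (auto simp: interface_borel frontier_borel)
  with g(2) show "AE x in rest_f. tr \<Omega>f (\<lambda>x. fst V x $ i) x = 0"
    by eventually_elim simp
  obtain h where h: "has_trace \<Omega>p (snd V) h" "AE x in rest_p. h x = 0"
    using assms by (auto simp: W_def Hp_def mem_Times_iff)
  show t': "has_trace \<Omega>p (snd V) (ptr V)" by (rule has_trace_tr[OF h(1)])
  have "AE x in rest_p. ptr V x = h x"
    by (rule AE_surf_subset[OF _ _ _ has_trace_unique[OF dim dom_p t' h(1)]]) (auto simp: interface_borel frontier_borel)
  with h(2) show "AE x in rest_p. ptr V x = 0"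
    by eventually_elim simp
qed

lemma W_H1:
  assumes "V \<in> WW" shows "H1 \<Omega>f (\<lambda>x. fst V x $ i)" "H1 \<Omega>p (snd V)"
  using W_trace(1,2)[OF assms] by (auto simp: has_trace_def)

lemma W_wcomb:
  assumes U: "U \<in> WW" and V: "V \<in> WW" shows "wcomb a U b V \<in> WW"
proof -
  have "\<exists>g. has_trace \<Omega>f (\<lambda>x. (a *\<^sub>R fst U x + b *\<^sub>R fst V x) $ i) g \<and>
      (AE x in rest_f. g x = 0)" for i
  proof (intro exI conjI)
    show "has_trace \<Omega>f (\<lambda>x. (a *\<^sub>R fst U x + b *\<^sub>R fst V x) $ i)
       (\<lambda>x. a * tr \<Omega>f (\<lambda>x. fst U x $ i) x + b * tr \<Omega>f (\<lambda>x. fst V x $ i) x)"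
      using has_trace_lincomb[OF open_f bounded_f W_trace(1)[OF U] W_trace(1)[OF V]] by simp
    show "AE x in rest_f. a * tr \<Omega>f (\<lambda>x. fst U x $ i) x + b * tr \<Omega>f (\<lambda>x. fst V x $ i) x = 0"
      using W_trace(3)[OF U, of i] W_trace(3)[OF V, of i] by eventually_elim simp
  qed
  moreover have "\<exists>g. has_trace \<Omega>p (\<lambda>x. a * snd U x + b * snd V x) g \<and>
      (AE x in rest_p. g x = 0)"
  proof (intro exI conjI)
    show "has_trace \<Omega>p (\<lambda>x. a * snd U x + b * snd V x) (\<lambda>x. a * ptr U x + b * ptr V x)"
      by (rule has_trace_lincomb[OF open_p bounded_p W_trace(2)[OF U] W_trace(2)[OF V]])
    show "AE x in rest_p. a * ptr U x + b * ptr V x = 0"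
      using W_trace(4)[OF U] W_trace(4)[OF V] by eventually_elim simp
  qed
  ultimately show ?thesis
    by (simp add: W_def Hf_def Hp_def mem_Times_iff fst_wcomb snd_wcomb)
qed

lemma wjac_wcomb:
  assumes U: "U \<in> WW" and V: "V \<in> WW"
  shows "AE x in Lf. fgrad (wcomb a U b V) x = a *\<^sub>R fgrad U x + b *\<^sub>R fgrad V x"
proof -
  have "AE x in Lf. \<forall>i. wgrad \<Omega>f (\<lambda>x. a * fst U x $ i + b * fst V x $ i) x
      = a *\<^sub>R wgrad \<Omega>f (\<lambda>x. fst U x $ i) x + b *\<^sub>R wgrad \<Omega>f (\<lambda>x. fst V x $ i) x"
    by (intro AE_all_countable[THEN iffD2] allI H1_lincomb(2)[OF open_f bounded_f W_H1(1)[OF U] W_H1(1)[OF V]])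
  then show ?thesis
    by eventually_elim (simp add: wjac_def vec_eq_iff fst_wcomb)
qed

lemma wgrad_wcomb:
  assumes U: "U \<in> WW" and V: "V \<in> WW"
  shows "AE x in Lp. pgrad (wcomb a U b V) x = a *\<^sub>R pgrad U x + b *\<^sub>R pgrad V x"
  unfolding snd_wcomb by (rule H1_lincomb(2)[OF open_p bounded_p W_H1(2)[OF U] W_H1(2)[OF V]])

lemma trv_wcomb:
  assumes U: "U \<in> WW" and V: "V \<in> WW"
  shows "AE x in \<Sigma>. ftr (wcomb a U b V) x = a *\<^sub>R ftr U x + b *\<^sub>R ftr V x"
proof -
  have "AE x in \<Sigma>. tr \<Omega>f (\<lambda>x. a * fst U x $ i + b * fst V x $ i) x
      = a * tr \<Omega>f (\<lambda>x. fst U x $ i) x + b * tr \<Omega>f (\<lambda>x. fst V x $ i) x" for i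
    unfolding surfG_def
    by (rule AE_surf_subset[OF _ _ _ tr_lincomb[OF dim dom_f W_trace(1)[OF U] W_trace(1)[OF V]]])
      (auto simp: interface_borel frontier_borel interface_subset)
  then have "AE x in \<Sigma>. \<forall>i. tr \<Omega>f (\<lambda>x. a * fst U x $ i + b * fst V x $ i) x
      = a * tr \<Omega>f (\<lambda>x. fst U x $ i) x + b * tr \<Omega>f (\<lambda>x. fst V x $ i) x"
    by (simp add: AE_all_countable)
  then show ?thesis
    by eventually_elim (simp add: trv_def vec_eq_iff fst_wcomb)
qed

lemma tr_wcomb:
  assumes U: "U \<in> WW" and V: "V \<in> WW"
  shows "AE x in \<Sigma>. ptr (wcomb a U b V) x = a * ptr U x + b * ptr V x"
  unfolding surfG_def snd_wcomb
  by (rule AE_surf_subset[OF _ _ _ tr_lincomb[OF dim dom_p W_trace(2)[OF U] W_trace(2)[OF V]]])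
    (auto simp: interface_borel frontier_borel interface_subset)

lemma W_sqintv:
  assumes V: "V \<in> WW"
  shows "sqintv Lf (fst V)" "sqintv Lp (snd V)" "sqintv Lf (fgrad V)" "sqintv Lp (pgrad V)"
    "sqintv \<Sigma> (ftr V)" "sqintv \<Sigma> (ptr V)"
proof -
  show "sqintv Lf (fst V)" using H1_sqint[OF W_H1(1)[OF V]] by (intro sqintv_vec) (simp add: sqintv_real)
  show "sqintv Lp (snd V)" using H1_sqint[OF W_H1(2)[OF V]] by (simp add: sqintv_real)
  have "sqintv Lf (\<lambda>x. fgrad V x $ i $ j)" for i j
    using wgrad_sqint[OF W_H1(1)[OF V, of i], of j] by (simp add: sqintv_real wjac_def)
  then show "sqintv Lf (fgrad V)" by (intro sqintv_vec)
  show "sqintv Lp (pgrad V)"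
    using wgrad_sqint[OF W_H1(2)[OF V]] by (intro sqintv_vec) (simp add: sqintv_real)
  have "sqint \<Sigma> (tr \<Omega>f (\<lambda>x. fst V x $ i))" for i
    unfolding surfG_def
    by (rule sqint_surf_subset[OF _ _ _ has_trace_sqint[OF W_trace(1)[OF V]]])
      (auto simp: interface_borel frontier_borel interface_subset)
  then show "sqintv \<Sigma> (ftr V)" by (intro sqintv_vec) (simp add: sqintv_real trv_def)
  have "sqint \<Sigma> (ptr V)"
    unfolding surfG_def
    by (rule sqint_surf_subset[OF _ _ _ has_trace_sqint[OF W_trace(2)[OF V]]])
      (auto simp: interface_borel frontier_borel interface_subset)
  then show "sqintv \<Sigma> (ptr V)" by (simp add: sqintv_real)
qed

lemma W_normal_sqintv:
  assumes V: "V \<in> WW" shows "sqintv \<Sigma> (\<lambda>x. ftr V x \<bullet> nf x)"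
  unfolding sqintv_def
proof
  have m [measurable]: "ftr V \<in> borel_measurable \<Sigma>" using W_sqintv(5)[OF V] by (simp add: sqintv_def)
  note nf_measurable[measurable]
  show "(\<lambda>x. ftr V x \<bullet> nf x) \<in> borel_measurable \<Sigma>" by measurable
  show "integrable \<Sigma> (\<lambda>x. (norm (ftr V x \<bullet> nf x))\<^sup>2)"
  proof (rule Bochner_Integration.integrable_bound[OF sqintv_norm_sq[OF W_sqintv(5)[OF V]]])
    show "(\<lambda>x. (norm (ftr V x \<bullet> nf x))\<^sup>2) \<in> borel_measurable \<Sigma>" by measurable
    show "AE x in \<Sigma>. norm ((norm (ftr V x \<bullet> nf x))\<^sup>2) \<le> norm ((norm (ftr V x))\<^sup>2)"
      using nf_unit
    proof eventually_elim
      case (elim x)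
      then have "norm (ftr V x \<bullet> nf x) \<le> norm (ftr V x)"
        using Cauchy_Schwarz_ineq2[of "ftr V x" "nf x"] by simp
      then show ?case using power_mono[of "\<bar>ftr V x \<bullet> nf x\<bar>" "norm (ftr V x)" 2] by simp
    qed
  qed
qed

lemma poincare_W:
  assumes Ctr: "\<And>V. V \<in> WW \<Longrightarrow> tsq V \<le> c * gsq V"
  obtains C :: real where "0 < C" "\<And>V. V \<in> WW \<Longrightarrow> nsq V \<le> C * gsq V"
proof -
  obtain Cf where Cf: "0 \<le> Cf" "\<And>f g. has_trace \<Omega>f f g \<Longrightarrow>
    (\<integral>x. (f x)\<^sup>2 \<partial>Lf) \<le> Cf * ((\<integral>x. (norm (wgrad \<Omega>f f x))\<^sup>2 \<partial>Lf) + (\<integral>x. (g x)\<^sup>2 \<partial>surf (frontier \<Omega>f)))"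
    by (rule friedrichs_has_trace[OF dim open_f bounded_f]) (rule that)
  obtain Cp where Cp: "0 \<le> Cp" "\<And>f g. has_trace \<Omega>p f g \<Longrightarrow>
    (\<integral>x. (f x)\<^sup>2 \<partial>Lp) \<le> Cp * ((\<integral>x. (norm (wgrad \<Omega>p f x))\<^sup>2 \<partial>Lp) + (\<integral>x. (g x)\<^sup>2 \<partial>surf (frontier \<Omega>p)))"
    by (rule friedrichs_has_trace[OF dim open_p bounded_p]) (rule that)
  \<comment> \<open>\<open>c\<close> comes without a sign, hence its absolute value; the extra 1
    makes the constant positive.\<close>
  have main: "nsq V \<le> ((Cf + Cp) * (1 + \<bar>c\<bar>) + 1) * gsq V" if V: "V \<in> WW" for V
  proof -
    have sf: "(\<integral>x. (tr \<Omega>f (\<lambda>x. fst V x $ i) x)\<^sup>2 \<partial>surf (frontier \<Omega>f)) = (\<integral>x. (tr \<Omega>f (\<lambda>x. fst V x $ i) x)\<^sup>2 \<partial>\<Sigma>)" for i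
      unfolding surfG_def
      using has_trace_sqint[OF W_trace(1)[OF V, of i]]
      by (intro integral_surf_subset W_trace(3)[OF V] interface_borel frontier_borel interface_subset) auto
    have sp: "(\<integral>x. (ptr V x)\<^sup>2 \<partial>surf (frontier \<Omega>p)) = (\<integral>x. (ptr V x)\<^sup>2 \<partial>\<Sigma>)"
      unfolding surfG_def
      using has_trace_sqint[OF W_trace(2)[OF V]]
      by (intro integral_surf_subset W_trace(4)[OF V] interface_borel frontier_borel interface_subset) auto
    have comp: "integrable Lf (\<lambda>x. (fst V x $ i)\<^sup>2)" "integrable Lf (\<lambda>x. (norm (wgrad \<Omega>f (\<lambda>x. fst V x $ i) x))\<^sup>2)"
      "integrable \<Sigma> (\<lambda>x. (tr \<Omega>f (\<lambda>x. fst V x $ i) x)\<^sup>2)" for i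
    proof -
      show "integrable Lf (\<lambda>x. (fst V x $ i)\<^sup>2)" using H1_sqint[OF W_H1(1)[OF V]] by (rule sqint_square)
      have "sqintv Lf (wgrad \<Omega>f (\<lambda>x. fst V x $ i))"
        using wgrad_sqint[OF W_H1(1)[OF V]] by (intro sqintv_vec) (simp add: sqintv_real)
      then show "integrable Lf (\<lambda>x. (norm (wgrad \<Omega>f (\<lambda>x. fst V x $ i) x))\<^sup>2)" by (rule sqintv_norm_sq)
      have "sqint \<Sigma> (tr \<Omega>f (\<lambda>x. fst V x $ i))"
        unfolding surfG_def
        by (rule sqint_surf_subset[OF _ _ _ has_trace_sqint[OF W_trace(1)[OF V]]])
          (auto simp: interface_borel frontier_borel interface_subset)
      then show "integrable \<Sigma> (\<lambda>x. (tr \<Omega>f (\<lambda>x. fst V x $ i) x)\<^sup>2)" by (rule sqint_square)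
    qed
    have "(\<integral>x. (norm (fst V x))\<^sup>2 \<partial>Lf) = (\<Sum>i\<in>UNIV. \<integral>x. (fst V x $ i)\<^sup>2 \<partial>Lf)"
      using comp by (simp add: norm_vec_sq)
    also have "\<dots> \<le> (\<Sum>i\<in>UNIV. Cf * ((\<integral>x. (norm (wgrad \<Omega>f (\<lambda>x. fst V x $ i) x))\<^sup>2 \<partial>Lf) + (\<integral>x. (tr \<Omega>f (\<lambda>x. fst V x $ i) x)\<^sup>2 \<partial>\<Sigma>)))"
      using Cf(2)[OF W_trace(1)[OF V]] unfolding sf by (intro sum_mono)
    also have "\<dots> = Cf * ((\<integral>x. (norm (fgrad V x))\<^sup>2 \<partial>Lf) + (\<integral>x. (norm (ftr V x))\<^sup>2 \<partial>\<Sigma>))"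
    proof -
      have "(\<integral>x. (norm (fgrad V x))\<^sup>2 \<partial>Lf) = (\<Sum>i\<in>UNIV. \<integral>x. (norm (wgrad \<Omega>f (\<lambda>x. fst V x $ i) x))\<^sup>2 \<partial>Lf)"
        using comp(2) unfolding norm_vec_sq[where 'b="real^'d"] by (simp add: wjac_def)
      moreover have "(\<integral>x. (norm (ftr V x))\<^sup>2 \<partial>\<Sigma>) = (\<Sum>i\<in>UNIV. \<integral>x. (tr \<Omega>f (\<lambda>x. fst V x $ i) x)\<^sup>2 \<partial>\<Sigma>)"
        using comp(3) unfolding norm_vec_sq[where 'b=real] by (simp add: trv_def)
      ultimately show ?thesis by (simp add: sum_distrib_left[symmetric] sum.distrib)
    qed
    finally have 1: "(\<integral>x. (norm (fst V x))\<^sup>2 \<partial>Lf) \<le> Cf * ((\<integral>x. (norm (fgrad V x))\<^sup>2 \<partial>Lf) + (\<integral>x. (norm (ftr V x))\<^sup>2 \<partial>\<Sigma>))" .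
    have 2: "(\<integral>x. (snd V x)\<^sup>2 \<partial>Lp) \<le> Cp * ((\<integral>x. (norm (pgrad V x))\<^sup>2 \<partial>Lp) + (\<integral>x. (ptr V x)\<^sup>2 \<partial>\<Sigma>))"
      using Cp(2)[OF W_trace(2)[OF V]] unfolding sp .
    define a1 a2 b1 b2 where "a1 = (\<integral>x. (norm (fgrad V x))\<^sup>2 \<partial>Lf)" and "a2 = (\<integral>x. (norm (pgrad V x))\<^sup>2 \<partial>Lp)"
      and "b1 = (\<integral>x. (norm (ftr V x))\<^sup>2 \<partial>\<Sigma>)" and "b2 = (\<integral>x. (ptr V x)\<^sup>2 \<partial>\<Sigma>)"
    have nn: "0 \<le> a1" "0 \<le> a2" "0 \<le> b1" "0 \<le> b2" by (auto simp: a1_def a2_def b1_def b2_def)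
    have "nsq V \<le> Cf * (a1 + b1) + Cp * (a2 + b2)"
      using 1 2 by (simp add: normsq_def a1_def a2_def b1_def b2_def)
    also have "\<dots> \<le> (Cf + Cp) * ((a1 + a2) + (b1 + b2))"
      using nn Cf(1) Cp(1) by (simp add: algebra_simps add_mono mult_nonneg_nonneg)
    also have "b1 + b2 \<le> c * (a1 + a2)"
      using Ctr[OF V] by (simp add: gammasq_def gradsq_def a1_def a2_def b1_def b2_def)
    also have "c * (a1 + a2) \<le> \<bar>c\<bar> * (a1 + a2)" using nn by (intro mult_right_mono) auto
    finally have "nsq V \<le> (Cf + Cp) * ((a1 + a2) + \<bar>c\<bar> * (a1 + a2))"
      using Cf(1) Cp(1) by (simp add: mult_left_mono)
    also have "\<dots> \<le> ((Cf + Cp) * (1 + \<bar>c\<bar>) + 1) * (a1 + a2)" using nn by (simp add: algebra_simps)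
    finally show ?thesis by (simp add: gradsq_def a1_def a2_def)
  qed
  show thesis
  proof (rule that[OF _ main])
    show "0 < (Cf + Cp) * (1 + \<bar>c\<bar>) + 1" using Cf(1) Cp(1) by (simp add: add_nonneg_pos)
  qed
qed

end

section \<open>The forms and the energy estimate\<close>

context coupled_domains
begin

text \<open>The forcing is only square integrable and need not lie in W, so the L2 pairings are
  treated on this larger class.\<close>

abbreviation "sqpair V \<equiv> sqintv Lf (fst V) \<and> sqintv Lp (snd V)"

lemma W_sqpair: "V \<in> WW \<Longrightarrow> sqpair V"
  using W_sqintv by blast

lemma forcing_sqpair: "forcing_ok \<Omega>f \<Omega>p F \<Longrightarrow> sqpair F"
  by (simp add: forcing_ok_def L2v_sqintv sqintv_real L2_iff_sqint)

lemma sqpair_wcomb: "sqpair U \<Longrightarrow> sqpair V \<Longrightarrow> sqpair (wcomb a U b V)"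
  using sqintv_lincomb[of Lf "fst U" "fst V" a b] sqintv_lincomb[of Lp "snd U" "snd V" a b]
  by (simp add: fst_wcomb snd_wcomb)

lemma ipS_wcomb:
  assumes "sqpair U" "sqpair V" "sqpair Z"
  shows "ips g S (wcomb a U b V) Z = a * ips g S U Z + b * ips g S V Z"
proof -
  have i: "integrable Lf (\<lambda>x. fst U x \<bullet> fst Z x)" "integrable Lf (\<lambda>x. fst V x \<bullet> fst Z x)"
    "integrable Lp (\<lambda>x. snd U x * snd Z x)" "integrable Lp (\<lambda>x. snd V x * snd Z x)"
    using assms sqintv_inner[of Lp "snd U" "snd Z"] sqintv_inner[of Lp "snd V" "snd Z"] by (auto intro: sqintv_inner)
  have "(\<integral>x. fst (wcomb a U b V) x \<bullet> fst Z x \<partial>Lf) = a * (\<integral>x. fst U x \<bullet> fst Z x \<partial>Lf) + b * (\<integral>x. fst V x \<bullet> fst Z x \<partial>Lf)"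
    using i by (simp add: fst_wcomb inner_add_left)
  moreover have "(\<integral>x. snd (wcomb a U b V) x * snd Z x \<partial>Lp) = a * (\<integral>x. snd U x * snd Z x \<partial>Lp) + b * (\<integral>x. snd V x * snd Z x \<partial>Lp)"
    using i by (simp add: snd_wcomb distrib_right mult.assoc)
  ultimately show ?thesis by (simp add: ipS_def algebra_simps)
qed

lemma ipS_commute: "ips g S U V = ips g S V U"
  by (simp add: ipS_def inner_commute mult.commute)

lemma ipS_wcomb_right:
  assumes "sqpair U" "sqpair V" "sqpair Z"
  shows "ips g S Z (wcomb a U b V) = a * ips g S Z U + b * ips g S Z V"
  using ipS_wcomb[OF assms] by (simp only: ipS_commute[of g S Z])

lemma ipS_bounds:
  assumes "0 \<le> g" "0 \<le> S"
  shows "0 \<le> ips g S V V" "ips g S V V \<le> (1 + g * S) * nsq V"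
proof -
  have e: "ips g S V V = (\<integral>x. (norm (fst V x))\<^sup>2 \<partial>Lf) + g * S * (\<integral>x. (snd V x)\<^sup>2 \<partial>Lp)"
    by (simp add: ipS_def dot_square_norm flip: power2_eq_square)
  have nn: "0 \<le> (\<integral>x. (norm (fst V x))\<^sup>2 \<partial>Lf)" "0 \<le> (\<integral>x. (snd V x)\<^sup>2 \<partial>Lp)" by simp_all
  show "0 \<le> ips g S V V" unfolding e using assms nn by simp
  show "ips g S V V \<le> (1 + g * S) * nsq V"
    unfolding e normsq_def using assms nn by (simp add: algebra_simps)
qed

lemma normsq_nonneg: "0 \<le> nsq V" and gradsq_nonneg: "0 \<le> gsq V"
  and gammasq_nonneg: "0 \<le> tsq V"
  by (simp_all add: normsq_def gradsq_def gammasq_def)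

text \<open>Up to a constant factor the squared G-norm of BDF2 for two consecutive iterates, the
  newer one first.\<close>

definition bdf_energy :: "real \<Rightarrow> real \<Rightarrow> 'd wel \<Rightarrow> 'd wel \<Rightarrow> real" where
  "bdf_energy g S A B = ips g S A A + ips g S (wcomb 2 A (-1) B) (wcomb 2 A (-1) B)"

abbreviation "bdf_diff A B C \<equiv> wcomb 1 A (-1) (wcomb 2 B (-1) C)"

text \<open>Polarisation: 2 (3A - 4B + C, A) = |A|^2 + |2A - B|^2 - |B|^2 - |2B - C|^2 + |A - 2B +
  C|^2. The factor 4\<Delta> turns the 1/(2\<Delta>) of the scheme into this 2.\<close>

lemma bdf2_g_stability:
  assumes A: "sqpair A" and B: "sqpair B" and C: "sqpair C" and \<Delta>: "\<Delta> \<noteq> 0"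
  shows "4 * \<Delta> * ips g S (wscale (1 / (2 * \<Delta>)) (wadd (wadd (wscale 3 A) (wscale (-4) B)) C)) A
    = bdf_energy g S A B - bdf_energy g S B C + ips g S (bdf_diff A B C) (bdf_diff A B C)"
proof -
  define c where "c = 1 / (2 * \<Delta>)"
  have e: "wscale (1 / (2 * \<Delta>)) (wadd (wadd (wscale 3 A) (wscale (-4) B)) C)
      = wcomb (3 * c) A 1 (wcomb (- 4 * c) B c C)"
    by (simp add: wcomb_def wadd_def wscale_def c_def fun_eq_iff algebra_simps)
  have 4: "4 * \<Delta> * c = 2" using \<Delta> by (simp add: c_def)
  note sq = A B C sqpair_wcomb[OF A B] sqpair_wcomb[OF B C]
  define I where "I = ips g S"
  have sym: "I B A = I A B" "I C A = I A C" "I C B = I B C" unfolding I_def by (rule ipS_commute)+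
  have "4 * \<Delta> * I (wcomb (3 * c) A 1 (wcomb (- 4 * c) B c C)) A = (4 * \<Delta> * c) * (3 * I A A - 4 * I B A + I C A)"
    unfolding I_def using sq by (simp add: ipS_wcomb sqpair_wcomb algebra_simps)
  also have "\<dots> = 2 * (3 * I A A - 4 * I A B + I A C)" unfolding 4 sym ..
  also have "\<dots> = bdf_energy g S A B - bdf_energy g S B C + I (bdf_diff A B C) (bdf_diff A B C)"
  proof -
    have "I (wcomb 2 A (-1) B) (wcomb 2 A (-1) B) = 4 * I A A - 4 * I A B + I B B"
      "I (wcomb 2 B (-1) C) (wcomb 2 B (-1) C) = 4 * I B B - 4 * I B C + I C C"
      unfolding I_def using sq ipS_commute[of g S B A] ipS_commute[of g S C B] by (simp_all add: ipS_wcomb ipS_wcomb_right sqpair_wcomb)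
    moreover have "I (bdf_diff A B C) (bdf_diff A B C) = I A A + 4 * I B B + I C C - 4 * I A B + 2 * I A C - 4 * I B C"
      unfolding I_def using sq ipS_commute[of g S B A] ipS_commute[of g S C A] ipS_commute[of g S C B] 
      by (simp add: ipS_wcomb ipS_wcomb_right sqpair_wcomb)
    ultimately show ?thesis by (simp add: bdf_energy_def I_def)
  qed
  finally show ?thesis unfolding e I_def .
qed

lemma ips_le_bdf_energy: "0 \<le> g \<Longrightarrow> 0 \<le> S \<Longrightarrow> ips g S A A \<le> bdf_energy g S A B"
  by (simp add: bdf_energy_def ipS_bounds)

text \<open>Nonnegativity of |2A + B|^2 controls the mixed term and stands in for Cauchy-Schwarz:
  |2A - B|^2 \<le> 8 |A|^2 + 2 |B|^2.\<close>

lemma bdf_energy_le: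
  assumes "sqpair A" "sqpair B" "0 \<le> g" "0 \<le> S"
  shows "bdf_energy g S A B \<le> 9 * (1 + g * S) * (nsq A + nsq B)"
proof -
  let ?I = "ips g S"
  have "0 \<le> ?I (wcomb 2 A 1 B) (wcomb 2 A 1 B)" using assms by (intro ipS_bounds)
  also have "?I (wcomb 2 A 1 B) (wcomb 2 A 1 B) = 4 * ?I A A + 4 * ?I A B + ?I B B"
    using assms ipS_commute[of g S B A] by (simp add: ipS_wcomb ipS_wcomb_right sqpair_wcomb)
  finally have "- 4 * ?I A B \<le> 4 * ?I A A + ?I B B" by simp
  moreover have "?I (wcomb 2 A (-1) B) (wcomb 2 A (-1) B) = 4 * ?I A A - 4 * ?I A B + ?I B B"
    using assms ipS_commute[of g S B A] by (simp add: ipS_wcomb ipS_wcomb_right sqpair_wcomb)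
  ultimately have "bdf_energy g S A B \<le> 9 * ?I A A + 2 * ?I B B" by (simp add: bdf_energy_def)
  also have "\<dots> \<le> 9 * (?I A A + ?I B B)" using ipS_bounds(1)[OF assms(3,4), of B] by simp
  also have "\<dots> \<le> 9 * ((1 + g * S) * nsq A + (1 + g * S) * nsq B)"
    using ipS_bounds(2)[OF assms(3,4)] by (intro mult_left_mono add_mono) auto
  finally show ?thesis by (simp add: algebra_simps)
qed

lemma form_a_coercive:
  assumes V: "V \<in> WW" and "0 \<le> \<nu>" "0 \<le> g" "0 \<le> \<alpha>" and K: "transpose K = K"
  shows "min \<nu> (g * min_eig K) * gsq V \<le> form_a \<nu> g K \<alpha> nf \<Omega>f \<Omega>p V V"
proof -
  let ?J = "\<integral>x. (norm (fgrad V x))\<^sup>2 \<partial>Lf" and ?G = "\<integral>x. (norm (pgrad V x))\<^sup>2 \<partial>Lp"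
  let ?w = "pgrad V"
  have w: "sqintv Lp ?w" by (rule W_sqintv(4)[OF V])
  have "sqintv Lp (\<lambda>x. K *v ?w x)"
  proof (rule sqintv_vec)
    fix i
    have "sqint Lp (\<lambda>x. \<Sum>j\<in>UNIV. K $ i $ j * ?w x $ j)"
      using wgrad_sqint[OF W_H1(2)[OF V]] by (intro sqint_sum sqint_scale)
    then show "sqintv Lp (\<lambda>x. (K *v ?w x) $ i)" by (simp add: sqintv_real matrix_vector_mult_def)
  qed
  from sqintv_inner[OF this w] have i: "integrable Lp (\<lambda>x. (K *v ?w x) \<bullet> ?w x)" .
  have "min_eig K * ?G = (\<integral>x. min_eig K * (norm (?w x))\<^sup>2 \<partial>Lp)" by simp
  also have "\<dots> \<le> (\<integral>x. (K *v ?w x) \<bullet> ?w x \<partial>Lp)"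
    using sqintv_norm_sq[OF w] by (intro integral_mono i min_eig_le_rayleigh[OF K]) auto
  finally have "g * (min_eig K * ?G) \<le> g * (\<integral>x. (K *v ?w x) \<bullet> ?w x \<partial>Lp)"
    using assms by (intro mult_left_mono)
  moreover have "0 \<le> \<alpha> * (\<integral>x. tang (nf x) (ftr V x) \<bullet> tang (nf x) (ftr V x) \<partial>\<Sigma>)"
    using assms by simp
  moreover have "min \<nu> (g * min_eig K) * gsq V \<le> \<nu> * ?J + g * min_eig K * ?G"
    unfolding gradsq_def distrib_left by (intro add_mono mult_right_mono) auto
  ultimately show ?thesis by (simp add: form_a_def power2_norm_eq_inner mult.assoc)
qed

text \<open>All terms of the interface forms are pairings of these two kinds. Traces combine
  linearly almost everywhere, which is enough under the integral.\<close>

lemma integral_tr_wcomb: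
  assumes U: "U \<in> WW" and V: "V \<in> WW" and z: "sqintv \<Sigma> z"
  shows "(\<integral>x. ptr (wcomb a U b V) x * z x \<partial>\<Sigma>) = a * (\<integral>x. ptr U x * z x \<partial>\<Sigma>) + b * (\<integral>x. ptr V x * z x \<partial>\<Sigma>)"
    and "(\<integral>x. (ftr (wcomb a U b V) x \<bullet> nf x) * z x \<partial>\<Sigma>) 
      = a * (\<integral>x. (ftr U x \<bullet> nf x) * z x \<partial>\<Sigma>) + b * (\<integral>x. (ftr V x \<bullet> nf x) * z x \<partial>\<Sigma>)"
proof -
  have sq: "sqint \<Sigma> (ptr Y)" "sqint \<Sigma> (\<lambda>x. ftr Y x \<bullet> nf x)" if "Y \<in> WW" for Y
    using W_sqintv(6)[OF that] W_normal_sqintv[OF that] by (auto simp: sqintv_real)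
  have zq: "sqint \<Sigma> z" using z by (simp add: sqintv_real)
  note i = sqint_mult[OF sq(1)[OF U] zq] sqint_mult[OF sq(1)[OF V] zq] sqint_mult[OF sq(2)[OF U] zq] sqint_mult[OF sq(2)[OF V] zq]
  note m = sqint_mult[OF sq(1)[OF W_wcomb[OF U V]] zq, of a b, THEN borel_measurable_integrable]
    sqint_mult[OF sq(2)[OF W_wcomb[OF U V]] zq, of a b, THEN borel_measurable_integrable]
  have "(\<integral>x. ptr (wcomb a U b V) x * z x \<partial>\<Sigma>) = (\<integral>x. a * (ptr U x * z x) + b * (ptr V x * z x) \<partial>\<Sigma>)"
  proof (rule integral_cong_AE)
    show "AE x in \<Sigma>. ptr (wcomb a U b V) x * z x = a * (ptr U x * z x) + b * (ptr V x * z x)"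
      using tr_wcomb[OF U V, of a b] by eventually_elim (simp add: algebra_simps)
    show "(\<lambda>x. a * (ptr U x * z x) + b * (ptr V x * z x)) \<in> borel_measurable \<Sigma>"
      using i by (intro borel_measurable_integrable) simp
  qed (rule m)
  then show "(\<integral>x. ptr (wcomb a U b V) x * z x \<partial>\<Sigma>) = a * (\<integral>x. ptr U x * z x \<partial>\<Sigma>) + b * (\<integral>x. ptr V x * z x \<partial>\<Sigma>)"
    using i by simp
  have "(\<integral>x. (ftr (wcomb a U b V) x \<bullet> nf x) * z x \<partial>\<Sigma>) 
    = (\<integral>x. a * ((ftr U x \<bullet> nf x) * z x) + b * ((ftr V x \<bullet> nf x) * z x) \<partial>\<Sigma>)"
  proof (rule integral_cong_AE)
    show "AE x in \<Sigma>. (ftr (wcomb a U b V) x \<bullet> nf x) * z x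
       = a * ((ftr U x \<bullet> nf x) * z x) + b * ((ftr V x \<bullet> nf x) * z x)"
      using trv_wcomb[OF U V, of a b] by eventually_elim (simp add: inner_add_left algebra_simps)
    show "(\<lambda>x. a * ((ftr U x \<bullet> nf x) * z x) + b * ((ftr V x \<bullet> nf x) * z x)) \<in> borel_measurable \<Sigma>"
      using i by (intro borel_measurable_integrable) simp
  qed (rule m)
  then show "(\<integral>x. (ftr (wcomb a U b V) x \<bullet> nf x) * z x \<partial>\<Sigma>) 
      = a * (\<integral>x. (ftr U x \<bullet> nf x) * z x \<partial>\<Sigma>) + b * (\<integral>x. (ftr V x \<bullet> nf x) * z x \<partial>\<Sigma>)"
    using i by simp
qed

lemma form_aGt_wcomb:
  assumes U: "U \<in> WW" and V: "V \<in> WW" and Z: "Z \<in> WW"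
  shows "aGt g \<gamma>f \<gamma>p (wcomb a U b V) Z
    = a * aGt g \<gamma>f \<gamma>p U Z + b * aGt g \<gamma>f \<gamma>p V Z"
  using integral_tr_wcomb[OF U V W_sqintv(6)[OF Z], of a b] integral_tr_wcomb[OF U V W_normal_sqintv[OF Z], of a b]
  by (simp add: form_aGt_def form_aG_def form_ast_def algebra_simps)

text \<open>a_\<Gamma> is skew, so the stabilisation alone survives on the diagonal.\<close>

lemma form_aGt_diag: "aGt g \<gamma>f \<gamma>p V V = - ast \<gamma>f \<gamma>p V V"
  by (simp add: form_aGt_def form_aG_def mult.commute)

text \<open>All four coefficients are at most \<open>M\<close>, and the products of interface values
  then add up to (|x| + |y|)(|p| + |q|). In Young's inequality with weight s, the 2 from squaring a
  sum of two terms cancels the 1/2.\<close>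

lemma form_aGt_le:
  assumes E: "E \<in> WW" and A: "A \<in> WW" and M: "0 \<le> g" "g \<le> M" "0 \<le> \<gamma>f" "\<gamma>f \<le> M" "0 \<le> \<gamma>p" "\<gamma>p \<le> M" and s: "0 < s"
  shows "aGt g \<gamma>f \<gamma>p E A \<le> M * (s * tsq E + tsq A / s)"
proof -
  define x where "x = (\<lambda>z. ftr E z \<bullet> nf z)"
  define y where "y = ptr E"
  define p where "p = (\<lambda>z. ftr A z \<bullet> nf z)"
  define q where "q = ptr A"
  have sq: "sqint \<Sigma> x" "sqint \<Sigma> y" "sqint \<Sigma> p" "sqint \<Sigma> q"
    using W_sqintv(6)[OF E] W_normal_sqintv[OF E] W_sqintv(6)[OF A] W_normal_sqintv[OF A]
    by (auto simp: sqintv_real x_def y_def p_def q_def)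
  note i = sqint_mult[OF sq(2,3)] sqint_mult[OF sq(1,4)] sqint_mult[OF sq(1,3)] sqint_mult[OF sq(2,4)] sq[THEN sqint_square]
  note nE = sqintv_norm_sq[OF W_sqintv(5)[OF E]] and nA = sqintv_norm_sq[OF W_sqintv(5)[OF A]]
  have "aGt g \<gamma>f \<gamma>p E A
     = (\<integral>z. g * (y z * p z) - g * (x z * q z) - (\<gamma>f * (x z * p z) + \<gamma>p * (y z * q z)) \<partial>\<Sigma>)"
    using i by (simp add: form_aGt_def form_aG_def form_ast_def x_def y_def p_def q_def)
  also have "\<dots> \<le> (\<integral>z. M * (s * ((x z)\<^sup>2 + (y z)\<^sup>2) + ((p z)\<^sup>2 + (q z)\<^sup>2) / s) \<partial>\<Sigma>)"
  proof (rule integral_mono)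
    fix z
    let ?X = "\<bar>x z\<bar>" and ?Y = "\<bar>y z\<bar>" and ?P = "\<bar>p z\<bar>" and ?Q = "\<bar>q z\<bar>"
    have M0: "0 \<le> M" using M by simp
    have "g * (y z * p z) - g * (x z * q z) - (\<gamma>f * (x z * p z) + \<gamma>p * (y z * q z)) 
      \<le> \<bar>g * (y z * p z)\<bar> + \<bar>g * (x z * q z)\<bar> + (\<bar>\<gamma>f * (x z * p z)\<bar> + \<bar>\<gamma>p * (y z * q z)\<bar>)" by linarith
    also have "\<dots> = g * (?Y * ?P) + g * (?X * ?Q) + (\<gamma>f * (?X * ?P) + \<gamma>p * (?Y * ?Q))"
      using M by (simp add: abs_mult)
    also have "\<dots> \<le> M * (?Y * ?P) + M * (?X * ?Q) + (M * (?X * ?P) + M * (?Y * ?Q))"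
      using M by (intro add_mono mult_right_mono) auto
    also have "\<dots> = M * ((?X + ?Y) * (?P + ?Q))" by (simp add: algebra_simps)
    also have "(?X + ?Y) * (?P + ?Q) \<le> s * ((x z)\<^sup>2 + (y z)\<^sup>2) + ((p z)\<^sup>2 + (q z)\<^sup>2) / s"
    proof -
      have "0 \<le> (s * (?X + ?Y) - (?P + ?Q))\<^sup>2" by simp
      then have "2 * s * ((?X + ?Y) * (?P + ?Q)) \<le> s\<^sup>2 * (?X + ?Y)\<^sup>2 + (?P + ?Q)\<^sup>2"
        by (simp add: power2_eq_square algebra_simps)
      also have "\<dots> \<le> s\<^sup>2 * (2 * ((x z)\<^sup>2 + (y z)\<^sup>2)) + 2 * ((p z)\<^sup>2 + (q z)\<^sup>2)"
        using sum_squares_bound[of ?X ?Y] sum_squares_bound[of ?P ?Q]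
        by (intro add_mono mult_left_mono) (auto simp: power2_sum)
      also have "\<dots> = 2 * s * (s * ((x z)\<^sup>2 + (y z)\<^sup>2) + ((p z)\<^sup>2 + (q z)\<^sup>2) / s)"
        using s by (simp add: field_simps power2_eq_square)
      finally show ?thesis using s by (simp only: mult_le_cancel_left_pos mult_pos_pos zero_less_numeral)
    qed
    finally show "g * (y z * p z) - g * (x z * q z) - (\<gamma>f * (x z * p z) + \<gamma>p * (y z * q z))
       \<le> M * (s * ((x z)\<^sup>2 + (y z)\<^sup>2) + ((p z)\<^sup>2 + (q z)\<^sup>2) / s)" using M0 by (simp add: mult_left_mono)
  qed (use i in auto)
  also have "\<dots> = M * (s * ((\<integral>z. (x z)\<^sup>2 \<partial>\<Sigma>) + (\<integral>z. (y z)\<^sup>2 \<partial>\<Sigma>)) + ((\<integral>z. (p z)\<^sup>2 \<partial>\<Sigma>) + (\<integral>z. (q z)\<^sup>2 \<partial>\<Sigma>)) / s)"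
    using i by simp
  also have "\<dots> \<le> M * (s * tsq E + tsq A / s)"
  proof -
    have nb: "(\<integral>z. (ftr V z \<bullet> nf z)\<^sup>2 \<partial>\<Sigma>) \<le> (\<integral>z. (norm (ftr V z))\<^sup>2 \<partial>\<Sigma>)" if V: "V \<in> WW" for V
    proof (rule integral_mono_AE)
      show "AE z in \<Sigma>. (ftr V z \<bullet> nf z)\<^sup>2 \<le> (norm (ftr V z))\<^sup>2"
        using nf_unit
      proof eventually_elim
        case (elim z)
        then have "\<bar>ftr V z \<bullet> nf z\<bar> \<le> norm (ftr V z)"
          using Cauchy_Schwarz_ineq2[of "ftr V z" "nf z"] by simp
        then show ?case using power_mono[of "\<bar>ftr V z \<bullet> nf z\<bar>" "norm (ftr V z)" 2] by simp
      qed
      show "integrable \<Sigma> (\<lambda>z. (ftr V z \<bullet> nf z)\<^sup>2)" using sqintv_norm_sq[OF W_normal_sqintv[OF V]] by simp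
    qed (rule sqintv_norm_sq[OF W_sqintv(5)[OF V]])
    show ?thesis
      using nb[OF E] nb[OF A] M s
      by (intro mult_left_mono add_mono divide_right_mono) (auto simp: gammasq_def x_def y_def p_def q_def)
  qed
  finally show ?thesis .
qed

text \<open>Young's inequality on each domain. The coefficients 1 and g are both raised to 1 + g, so
  that the norms of pairs can be reassembled.\<close>

lemma fpair_le:
  assumes F: "sqpair F" and A: "sqpair A" and g: "0 \<le> g" and c: "0 < c"
  shows "fpr g F A \<le> (1 + g) / 2 * (c * nsq F + nsq A / c)"
proof -
  have young: "(\<integral>x. u x \<bullet> v x \<partial>M) \<le> (c * (\<integral>x. (norm (u x))\<^sup>2 \<partial>M) + (\<integral>x. (norm (v x))\<^sup>2 \<partial>M) / c) / 2"
    if uv: "sqintv M u" "sqintv M v" for M and u v :: "real^'d \<Rightarrow> 'b::euclidean_space"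
  proof -
    have "(\<integral>x. u x \<bullet> v x \<partial>M) \<le> (\<integral>x. (c * (norm (u x))\<^sup>2 + (norm (v x))\<^sup>2 / c) / 2 \<partial>M)"
    proof (rule integral_mono[OF sqintv_inner[OF uv]])
      show "integrable M (\<lambda>x. (c * (norm (u x))\<^sup>2 + (norm (v x))\<^sup>2 / c) / 2)"
        using sqintv_norm_sq[OF uv(1)] sqintv_norm_sq[OF uv(2)] by auto
      fix x
      have "0 \<le> (norm (c *\<^sub>R u x - v x))\<^sup>2" by simp
      also have "\<dots> = c\<^sup>2 * (norm (u x))\<^sup>2 - 2 * c * (u x \<bullet> v x) + (norm (v x))\<^sup>2"
        unfolding power2_norm_eq_inner
        by (simp add: inner_diff_left inner_diff_right inner_commute[of "v x" "u x"] power2_eq_square algebra_simps)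
      also have "\<dots> = c * (c * (norm (u x))\<^sup>2 + (norm (v x))\<^sup>2 / c - 2 * (u x \<bullet> v x))"
        using c by (simp add: power2_eq_square[of c] right_diff_distrib distrib_left)
      finally show "u x \<bullet> v x \<le> (c * (norm (u x))\<^sup>2 + (norm (v x))\<^sup>2 / c) / 2"
        using c by (simp add: zero_le_mult_iff)
    qed
    then show ?thesis using sqintv_norm_sq[OF uv(1)] sqintv_norm_sq[OF uv(2)] by simp
  qed
  define a1 a2 b1 b2 where "a1 = (\<integral>x. (norm (fst F x))\<^sup>2 \<partial>Lf)" and "a2 = (\<integral>x. (snd F x)\<^sup>2 \<partial>Lp)"
    and "b1 = (\<integral>x. (norm (fst A x))\<^sup>2 \<partial>Lf)" and "b2 = (\<integral>x. (snd A x)\<^sup>2 \<partial>Lp)"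
  have nn: "0 \<le> a1" "0 \<le> a2" "0 \<le> b1" "0 \<le> b2" by (auto simp: a1_def a2_def b1_def b2_def)
  have "fpr g F A \<le> (c * a1 + b1 / c) / 2 + g * ((c * a2 + b2 / c) / 2)"
    unfolding fpair_def using young[of Lf "fst F" "fst A"] young[of Lp "snd F" "snd A"] F A g
    by (intro add_mono mult_left_mono) (auto simp: a1_def a2_def b1_def b2_def)
  also have "\<dots> \<le> (1 + g) * ((c * a1 + b1 / c) / 2) + (1 + g) * ((c * a2 + b2 / c) / 2)"
    using nn g c by (intro add_mono mult_right_mono) (auto simp: distrib_right)
  also have "\<dots> = (1 + g) / 2 * (c * (a1 + a2) + (b1 + b2) / c)"
    by (simp add: add_divide_distrib algebra_simps)
  finally show ?thesis by (simp add: normsq_def a1_def a2_def b1_def b2_def)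
qed

text \<open>Cauchy-Schwarz for a - 2b + c with weights 1, 2, 1, whose sum is the factor 4.\<close>

lemma gradsq_bdf_diff_le:
  assumes A: "A \<in> WW" and B: "B \<in> WW" and C: "C \<in> WW"
  shows "gsq (bdf_diff A B C) \<le> 4 * (gsq A + 2 * gsq B + gsq C)"
proof -
  have gen: "(\<integral>x. (norm (d x))\<^sup>2 \<partial>M) \<le> 4 * ((\<integral>x. (norm (a x))\<^sup>2 \<partial>M) + 2 * (\<integral>x. (norm (b x))\<^sup>2 \<partial>M) + (\<integral>x. (norm (c x))\<^sup>2 \<partial>M))"
    if sq: "sqintv M d" "sqintv M a" "sqintv M b" "sqintv M c"
      and ae: "AE x in M. d x = a x - 2 *\<^sub>R b x + c x" for M and a b c d :: "real^'d \<Rightarrow> 'b::euclidean_space"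
  proof -
    have "(\<integral>x. (norm (d x))\<^sup>2 \<partial>M) \<le> (\<integral>x. 4 * ((norm (a x))\<^sup>2 + 2 * (norm (b x))\<^sup>2 + (norm (c x))\<^sup>2) \<partial>M)"
    proof (rule integral_mono_AE[OF sqintv_norm_sq[OF sq(1)]])
      show "integrable M (\<lambda>x. 4 * ((norm (a x))\<^sup>2 + 2 * (norm (b x))\<^sup>2 + (norm (c x))\<^sup>2))"
        using sq[THEN sqintv_norm_sq] by auto
      show "AE x in M. (norm (d x))\<^sup>2 \<le> 4 * ((norm (a x))\<^sup>2 + 2 * (norm (b x))\<^sup>2 + (norm (c x))\<^sup>2)"
        using ae
      proof eventually_elim
        case (elim x)
        let ?a = "norm (a x)" and ?b = "norm (b x)" and ?c = "norm (c x)"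
        have "norm (d x) \<le> ?a + 2 * ?b + ?c"
          unfolding elim using norm_triangle_ineq[of "a x - 2 *\<^sub>R b x" "c x"] norm_triangle_ineq4[of "a x" "2 *\<^sub>R b x"] by simp
        then have "(norm (d x))\<^sup>2 \<le> (?a + 2 * ?b + ?c)\<^sup>2" by (intro power_mono) auto
        also have "\<dots> \<le> 4 * (?a\<^sup>2 + 2 * ?b\<^sup>2 + ?c\<^sup>2)"
          using sum_squares_bound[of ?a ?b] sum_squares_bound[of ?a ?c] sum_squares_bound[of ?b ?c]
          by (simp add: power2_eq_square algebra_simps)
        finally show ?case .
      qed
    qed
    then show ?thesis using sq[THEN sqintv_norm_sq] by simp
  qed
  note BC = W_wcomb[OF B C, of 2 "-1"] and D = W_wcomb[OF A W_wcomb[OF B C, of 2 "-1"], of 1 "-1"]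
  have "AE x in Lf. fgrad (bdf_diff A B C) x = fgrad A x - 2 *\<^sub>R fgrad B x + fgrad C x"
    using wjac_wcomb[OF A BC, of 1 "-1"] wjac_wcomb[OF B C, of 2 "-1"] by eventually_elim simp
  note 1 = gen[OF W_sqintv(3)[OF D] W_sqintv(3)[OF A] W_sqintv(3)[OF B] W_sqintv(3)[OF C] this]
  have "AE x in Lp. pgrad (bdf_diff A B C) x = pgrad A x - 2 *\<^sub>R pgrad B x + pgrad C x"
    using wgrad_wcomb[OF A BC, of 1 "-1"] wgrad_wcomb[OF B C, of 2 "-1"] by eventually_elim simp
  note 2 = gen[OF W_sqintv(4)[OF D] W_sqintv(4)[OF A] W_sqintv(4)[OF B] W_sqintv(4)[OF C] this]
  show ?thesis using add_mono[OF 1 2] by (simp add: gradsq_def)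
qed

end

text \<open>Adding weighted gradients to the energy gives a functional \<open>Y\<close> in which the
  older gradients on the right are absorbed by copies carried over from the previous step. By
  \<open>EP\<close> a fraction \<sigma> of the energy can be paid with gradients, whence the
  contraction factor 1/(1 + \<sigma>).\<close>

lemma decay_of_recursion:
  fixes E P :: "nat \<Rightarrow> real"
  assumes k: "0 < k" and K1: "0 < K1" and P: "\<And>n. 0 \<le> P n" and E0: "\<And>n. 0 \<le> E n" and X: "0 \<le> X"
    and step: "\<And>n. E (Suc n) + k * (19/32 * P (n + 2)) \<le> E n + k * (1/16 * P (n + 1) + 1/32 * P n) + X"
    and EP: "\<And>n. E n \<le> K1 * (P (n + 1) + P n)"
    and \<sigma>: "\<sigma> = min 1 (k / (32 * K1))"
  shows "E n \<le> (1 / (1 + \<sigma>)) ^ n * (E 0 + k * (P 1 + P 0)) + X / \<sigma>"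
proof -
  define Y where "Y n = E n + k * (1/4 * P (n + 1) + 1/16 * P n)" for n
  \<comment> \<open>The first entry of the minimum keeps 1 + \<sigma> at most 2 in front of the
    carried gradients, the second keeps \<sigma> K1 at most k/32.\<close>
  have s: "0 < \<sigma>" "\<sigma> \<le> 1" "\<sigma> * K1 \<le> k / 32" using k K1 by (auto simp: \<sigma> min_def field_simps)
  have Ystep: "(1 + \<sigma>) * Y (Suc n) \<le> Y n + X" for n
  proof -
    have "\<sigma> * E (Suc n) \<le> \<sigma> * (K1 * (P (n + 2) + P (n + 1)))"
      using EP[of "Suc n"] s by (intro mult_left_mono) auto
    also have "\<dots> = (\<sigma> * K1) * (P (n + 2) + P (n + 1))" by simp
    also have "\<dots> \<le> k / 32 * (P (n + 2) + P (n + 1))" using s P by (intro mult_right_mono) (auto intro: add_nonneg_nonneg)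
    finally have 1: "\<sigma> * E (Suc n) \<le> k * (1/32 * P (n + 2) + 1/32 * P (n + 1))" by (simp add: algebra_simps)
    have "(1 + \<sigma>) * (1/4 * P (n + 2) + 1/16 * P (n + 1)) \<le> 2 * (1/4 * P (n + 2) + 1/16 * P (n + 1))"
      using s P by (intro mult_right_mono) (auto intro: add_nonneg_nonneg)
    then have "k * ((1 + \<sigma>) * (1/4 * P (n + 2) + 1/16 * P (n + 1))) \<le> k * (2 * (1/4 * P (n + 2) + 1/16 * P (n + 1)))"
      using k by (intro mult_left_mono) auto
    then have 2: "(1 + \<sigma>) * (k * (1/4 * P (n + 2) + 1/16 * P (n + 1))) \<le> k * (1/2 * P (n + 2) + 1/8 * P (n + 1))"
      by (simp add: algebra_simps)
    \<comment> \<open>These are exactly the surpluses: 19/32 - 1/2 - 1/32 = 1/16 at n + 2, 1/4 -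
      1/16 - 1/8 - 1/32 = 1/32 at n + 1, and 1/16 - 1/32 = 1/32 at n.\<close>
    have 3: "0 \<le> k * (1/16 * P (n + 2))" "0 \<le> k * (1/32 * P (n + 1))" "0 \<le> k * (1/32 * P n)"
      using k P by auto
    have "(1 + \<sigma>) * Y (Suc n) = E (Suc n) + \<sigma> * E (Suc n) + (1 + \<sigma>) * (k * (1/4 * P (n + 2) + 1/16 * P (n + 1)))"
      by (simp add: Y_def algebra_simps)
    also have "\<dots> \<le> Y n + X"
      using 1 2 3 step[of n] by (simp add: Y_def algebra_simps)
    finally show ?thesis .
  qed
  have Yb: "Y n \<le> (1 / (1 + \<sigma>)) ^ n * Y 0 + X / \<sigma>" for n
  proof (induction n)
    case 0 show ?case using X s by simp
  next
    case (Suc n)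
    have "(1 + \<sigma>) * Y (Suc n) \<le> (1 / (1 + \<sigma>)) ^ n * Y 0 + X / \<sigma> + X" using Ystep[of n] Suc by simp
    also have "\<dots> = (1 + \<sigma>) * ((1 / (1 + \<sigma>)) ^ Suc n * Y 0 + X / \<sigma>)"
    proof -
      have "(1 + \<sigma>) * ((1 / (1 + \<sigma>)) ^ Suc n * Y 0) = ((1 + \<sigma>) * (1 / (1 + \<sigma>))) * ((1 / (1 + \<sigma>)) ^ n * Y 0)"
        by (simp only: power_Suc mult.assoc)
      also have "(1 + \<sigma>) * (1 / (1 + \<sigma>)) = 1" using s by simp
      finally have "(1 + \<sigma>) * ((1 / (1 + \<sigma>)) ^ Suc n * Y 0) = (1 / (1 + \<sigma>)) ^ n * Y 0" by simp
      moreover have "(1 + \<sigma>) * (X / \<sigma>) = X / \<sigma> + X" using s by (simp add: field_simps)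
      ultimately show ?thesis by (simp only: distrib_left[of "1 + \<sigma>"] add.assoc)
    qed
    finally show ?case using s by (simp only: mult_le_cancel_left_pos add_pos_pos zero_less_one)
  qed
  have "E n \<le> Y n" using k P by (simp add: Y_def)
  also note Yb
  also have "(1 / (1 + \<sigma>)) ^ n * Y 0 \<le> (1 / (1 + \<sigma>)) ^ n * (E 0 + k * (P 1 + P 0))"
    using s k P[of 0] P[of 1] unfolding Y_def by (intro mult_left_mono add_left_mono) auto
  finally show ?thesis by simp
qed

context coupled_domains
begin

text \<open>The scheme is tested with its own solution A. Writing 2B - C as A minus the second
  difference, the lagged interface form contributes its value at (A, A), which is minus the
  stabilisation and cancels the implicit one. The pressure term drops by incompressibility.\<close>

lemma energy_step:
  assumes A: "A \<in> WW" and B: "B \<in> WW" and C: "C \<in> WW" and dt: "0 < \<Delta>t"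
    and par: "0 \<le> \<nu>" "0 \<le> g" "0 \<le> \<alpha>" and K: "transpose K = K"
    and scheme: "ips g S (wscale (1 / (2 * \<Delta>t)) (wadd (wadd (wscale 3 A) (wscale (-4) B)) C)) A
        + form_a \<nu> g K \<alpha> nf \<Omega>f \<Omega>p A A + form_b \<Omega>f (fst A) p + ast \<gamma>f \<gamma>p A A
      = fpr g F A - aGt g \<gamma>f \<gamma>p (wadd (wscale 2 B) (wscale (-1) C)) A"
    and incompressible: "form_b \<Omega>f (fst A) p = 0"
  shows "bdf_energy g S A B + ips g S (bdf_diff A B C) (bdf_diff A B C)
      + 4 * \<Delta>t * (min \<nu> (g * min_eig K) * gsq A)
    \<le> bdf_energy g S B C + 4 * \<Delta>t * (fpr g F A + aGt g \<gamma>f \<gamma>p (bdf_diff A B C) A)"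
proof -
  let ?I = "ips g S (wscale (1 / (2 * \<Delta>t)) (wadd (wadd (wscale 3 A) (wscale (-4) B)) C)) A"
  let ?a = "form_a \<nu> g K \<alpha> nf \<Omega>f \<Omega>p A A" and ?G = "aGt g \<gamma>f \<gamma>p"
  have "?G (bdf_diff A B C) A = 1 * ?G A A + (-1) * ?G (wcomb 2 B (-1) C) A"
    by (rule form_aGt_wcomb[OF A W_wcomb[OF B C] A])
  then have "?I + ?a = fpr g F A + ?G (bdf_diff A B C) A"
    using scheme incompressible by (simp add: form_aGt_diag wcomb_def)
  then have "4 * \<Delta>t * ?I + 4 * \<Delta>t * ?a = 4 * \<Delta>t * (fpr g F A + ?G (bdf_diff A B C) A)"
    by (simp flip: distrib_left)
  moreover have "4 * \<Delta>t * (min \<nu> (g * min_eig K) * gsq A) \<le> 4 * \<Delta>t * ?a"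
    using form_a_coercive[OF A par K] dt by (intro mult_left_mono) auto
  moreover have "4 * \<Delta>t * ?I = bdf_energy g S A B - bdf_energy g S B C
      + ips g S (bdf_diff A B C) (bdf_diff A B C)"
    using dt by (intro bdf2_g_stability W_sqpair A B C) simp
  ultimately show ?thesis by linarith
qed

end

text \<open>The interface term: with \<open>s = 4 M c\<^sup>2 / a\<close> the part in \<open>u\<^sup>n\<^sup>+\<^sup>1\<close> costs a quarter of the viscous dissipation and the
  part in the second difference is absorbed, by the time step restriction, by the numerical dissipation and a small
  multiple of the gradients.\<close>

lemma interface_term_absorbed:
  fixes a M c k \<Delta> d G HE HA P J :: real
  assumes a: "0 < a" and M: "0 < M" and c: "c \<noteq> 0" and k: "k \<noteq> 0" and \<Delta>: "0 < \<Delta>"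
    and dt: "\<Delta> \<le> a ^ 3 / (536 * k\<^sup>2 * (4 * M ^ 4) * c ^ 8)"
    and nn: "0 \<le> d" "0 \<le> G" "0 \<le> HE" and HE: "HE \<le> c\<^sup>2 * (sqrt d * sqrt G)" and HA: "HA \<le> c\<^sup>2 * P"
    and T: "T \<le> M * (4 * M * c\<^sup>2 / a * HE + HA / (4 * M * c\<^sup>2 / a))"
  shows "4 * \<Delta> * T \<le> \<Delta> * a * P + d / k\<^sup>2 + 4 * \<Delta> * a * (G / 134)"
proof -
  define u v where "u = sqrt d" and "v = sqrt G"
  have uv: "u\<^sup>2 = d" "v\<^sup>2 = G" using nn by (auto simp: u_def v_def)
  \<comment> \<open>Chosen so that the cross term of 4\<Delta>T reads 2 q u v, matching the square
    of u/k - k q v.\<close>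
  define q where "q = 8 * \<Delta> * M\<^sup>2 * c ^ 4 / a"
  have "M * (HA / (4 * M * c\<^sup>2 / a)) = a / (4 * c\<^sup>2) * HA" using M a c by (simp add: field_simps)
  also have "\<dots> \<le> a / (4 * c\<^sup>2) * (c\<^sup>2 * P)" using a c by (intro mult_left_mono HA) auto
  also have "\<dots> = a * P / 4" using c by simp
  finally have 1: "M * (HA / (4 * M * c\<^sup>2 / a)) \<le> a * P / 4" .
  have "M * (4 * M * c\<^sup>2 / a * HE) = 4 * M\<^sup>2 * c\<^sup>2 / a * HE" by (simp add: power2_eq_square)
  also have "\<dots> \<le> 4 * M\<^sup>2 * c\<^sup>2 / a * (c\<^sup>2 * (u * v))"
    unfolding u_def v_def using a by (intro mult_left_mono HE) auto
  finally have 2: "M * (4 * M * c\<^sup>2 / a * HE) \<le> 4 * M\<^sup>2 * c\<^sup>2 / a * (c\<^sup>2 * (u * v))" .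
  have "T \<le> 4 * M\<^sup>2 * c\<^sup>2 / a * (c\<^sup>2 * (u * v)) + a * P / 4"
    using T 1 2 unfolding distrib_left by linarith
  then have "4 * \<Delta> * T \<le> 4 * \<Delta> * (4 * M\<^sup>2 * c\<^sup>2 / a * (c\<^sup>2 * (u * v)) + a * P / 4)"
    using \<Delta> by (intro mult_left_mono) auto
  also have "\<dots> = 2 * q * (u * v) + \<Delta> * a * P"
    by (simp add: q_def algebra_simps power2_eq_square power4_eq_xxxx)
  also have "2 * q * (u * v) \<le> u\<^sup>2 / k\<^sup>2 + k\<^sup>2 * q\<^sup>2 * v\<^sup>2"
  proof -
    have "0 \<le> (u / k - k * q * v)\<^sup>2" by simp
    also have "\<dots> = u\<^sup>2 / k\<^sup>2 + k\<^sup>2 * q\<^sup>2 * v\<^sup>2 - 2 * q * (u * v)"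
      using k by (simp add: power2_diff power_divide power_mult_distrib)
    finally show ?thesis by simp
  qed
  also have "k\<^sup>2 * q\<^sup>2 * v\<^sup>2 \<le> 4 * \<Delta> * a * (G / 134)"
  proof -
    have D: "0 < 536 * k\<^sup>2 * (4 * M ^ 4) * c ^ 8" using k M c by simp
    then have le: "\<Delta> * (536 * k\<^sup>2 * (4 * M ^ 4) * c ^ 8) \<le> a ^ 3" using dt by (simp add: pos_le_divide_eq)
    \<comment> \<open>Here q^2 = 64 \<Delta>^2 M^4 c^8 / a^2, and 64 / (536 * 4) = 4/134; the
      restriction trades one factor \<Delta>, together with the constants, for a^3.\<close>
    have "k\<^sup>2 * q\<^sup>2 = (\<Delta> * (536 * k\<^sup>2 * (4 * M ^ 4) * c ^ 8)) * (4 * \<Delta> / (134 * a\<^sup>2))"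
      using a by (simp add: q_def power_divide power_mult_distrib power2_eq_square[of \<Delta>] flip: power_mult)
    also have "\<dots> \<le> a ^ 3 * (4 * \<Delta> / (134 * a\<^sup>2))" using \<Delta> a by (intro mult_right_mono le) auto
    also have "\<dots> = 4 * \<Delta> * a / 134" using a by (simp add: power2_eq_square power3_eq_cube)
    finally have "k\<^sup>2 * q\<^sup>2 * G \<le> 4 * \<Delta> * a / 134 * G" using nn(2) by (rule mult_right_mono)
    then show ?thesis unfolding uv by (simp add: mult_ac)
  qed
  finally show ?thesis unfolding uv by simp
qed

theorem theorem3p4:
  fixes \<Omega>f \<Omega>p :: "(real^'d) set"
    and \<nu> g S \<alpha>BJ \<gamma>f \<gamma>p CS Ctr \<Delta>t :: real
    and Kp :: "real^'d^'d"
    and nf :: "real^'d \<Rightarrow> real^'d"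
  defines "Ca \<equiv> min \<nu> (g * min_eig Kp)"
    and "Cct \<equiv> sqrt 2 * Max {\<gamma>f, \<gamma>p, g}"
  assumes dim: "CARD('d) = 2 \<or> CARD('d) = 3"
    and dom_f: "lipschitz_domain \<Omega>f" and dom_p: "lipschitz_domain \<Omega>p"
    and disj: "\<Omega>f \<inter> \<Omega>p = {}"
    and normal: "nf \<in> borel_measurable (surfG \<Omega>f \<Omega>p)"
      "AE x in surfG \<Omega>f \<Omega>p. outward_normal \<Omega>f x (nf x)"
    and params: "\<nu> > 0" "g > 0" "S > 0" "\<alpha>BJ > 0" "\<gamma>f \<ge> 0" "\<gamma>p \<ge> 0"
    and K_spd: "spd Kp" and Kmin_pos: "min_eig Kp > 0"
    and CS: "\<forall>V\<in>W \<Omega>f \<Omega>p. sqrt (normsq \<Omega>f \<Omega>p V) \<le> CS * sqrt (ipS g S \<Omega>f \<Omega>p V V)"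
    and Ctr: "\<forall>V\<in>W \<Omega>f \<Omega>p.
                sqrt (gammasq \<Omega>f \<Omega>p V) \<le> Ctr * sqrt (sqrt (normsq \<Omega>f \<Omega>p V) * sqrt (gradsq \<Omega>f \<Omega>p V))
              \<and> sqrt (gammasq \<Omega>f \<Omega>p V) \<le> Ctr * sqrt (gradsq \<Omega>f \<Omega>p V)"
    and dt: "0 < \<Delta>t" "\<Delta>t \<le> Ca ^ 3 / (536 * CS\<^sup>2 * Cct ^ 4 * Ctr ^ 8)"
  shows "\<exists>lam1 K. 0 < lam1 \<and> lam1 < 1 \<and> 0 < K \<and>
    (\<forall>(U :: nat \<Rightarrow> 'd wel) (P :: nat \<Rightarrow> real^'d \<Rightarrow> real) (Fs :: nat \<Rightarrow> 'd wel).
       (\<forall>n. U n \<in> W \<Omega>f \<Omega>p)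
     \<and> (\<forall>n\<ge>2. forcing_ok \<Omega>f \<Omega>p (Fs n))
     \<and> bdd_above ((\<lambda>n. sqrt (normsq \<Omega>f \<Omega>p (Fs n))) ` {2..})
     \<and> (\<forall>n\<ge>1. L2 \<Omega>f (P (n + 1))
           \<and> (\<forall>V\<in>W \<Omega>f \<Omega>p.
                 ipS g S \<Omega>f \<Omega>p
                   (wscale (1 / (2 * \<Delta>t))
                      (wadd (wadd (wscale 3 (U (n + 1))) (wscale (-4) (U n))) (U (n - 1)))) V
               + form_a \<nu> g Kp \<alpha>BJ nf \<Omega>f \<Omega>p (U (n + 1)) V
               + form_b \<Omega>f (fst V) (P (n + 1))
               + form_ast \<gamma>f \<gamma>p nf \<Omega>f \<Omega>p (U (n + 1)) V
               = fpair g \<Omega>f \<Omega>p (Fs (n + 1)) V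
               - form_aGt g \<gamma>f \<gamma>p nf \<Omega>f \<Omega>p (wadd (wscale 2 (U n)) (wscale (-1) (U (n - 1)))) V)
           \<and> (\<forall>q. L2 \<Omega>f q \<longrightarrow> form_b \<Omega>f (fst (U (n + 1))) q = 0))
     \<longrightarrow> (\<forall>n. normsq \<Omega>f \<Omega>p (U n)
              \<le> K * (lam1 ^ n * (normsq \<Omega>f \<Omega>p (U 0) + normsq \<Omega>f \<Omega>p (U 1)
                                + \<Delta>t * gradsq \<Omega>f \<Omega>p (U 0) + \<Delta>t * gradsq \<Omega>f \<Omega>p (U 1))
                     + (SUP n\<in>{2..}. sqrt (normsq \<Omega>f \<Omega>p (Fs n)))\<^sup>2)))"
proof -
  interpret coupled_domains \<Omega>f \<Omega>p nf
  proof
    show "2 \<le> CARD('d)" using dim by auto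
    show "AE x in surfG \<Omega>f \<Omega>p. norm (nf x) = 1"
      using normal(2) by eventually_elim (simp add: outward_normal_def)
  qed (use dom_f dom_p normal in auto)
  define M where "M = Max {\<gamma>f, \<gamma>p, g}"
  have M: "g \<le> M" "\<gamma>f \<le> M" "\<gamma>p \<le> M" "0 < M" using params by (auto simp: M_def less_max_iff_disj)
  have Cct4: "Cct ^ 4 = 4 * M ^ 4"
  proof -
    have "sqrt 2 ^ 4 = (sqrt 2 ^ 2) ^ 2" by (simp only: power_mult[symmetric]) simp
    also have "\<dots> = (4 :: real)" by simp
    finally show ?thesis by (simp add: Cct_def M_def power_mult_distrib)
  qed
  have Ca: "0 < Ca" using params Kmin_pos by (simp add: Ca_def)
  have dt': "\<Delta>t \<le> Ca ^ 3 / (536 * CS\<^sup>2 * (4 * M ^ 4) * Ctr ^ 8)" using dt(2) by (simp only: Cct4)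
  \<comment> \<open>If \<open>CS\<close> or \<open>Ctr\<close> were 0, the upper bound for
    \<open>\<Delta>t\<close> would be a quotient by 0, which is 0 in HOL, contrary to
    \<open>0 < \<Delta>t\<close>.\<close>
  have nz: "CS \<noteq> 0" "Ctr \<noteq> 0" using dt(1) dt' by auto
  have Kt: "transpose Kp = Kp" using K_spd by (simp add: spd_def)
  have CSsq: "nsq V \<le> CS\<^sup>2 * ips g S V V" if "V \<in> WW" for V
  proof -
    have "(sqrt (nsq V))\<^sup>2 \<le> (CS * sqrt (ips g S V V))\<^sup>2"
      using CS that normsq_nonneg[of V] by (intro power_mono) auto
    then show ?thesis using normsq_nonneg[of V] ipS_bounds(1)[of g S V] params by (simp add: power_mult_distrib)
  qed
  have Ctr1: "tsq V \<le> Ctr\<^sup>2 * (sqrt (nsq V) * sqrt (gsq V))"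
    and Ctr2: "tsq V \<le> Ctr\<^sup>2 * gsq V" if "V \<in> WW" for V
  proof -
    have "(sqrt (tsq V))\<^sup>2 \<le> (Ctr * sqrt (sqrt (nsq V) * sqrt (gsq V)))\<^sup>2"
      using Ctr that gammasq_nonneg[of V] by (intro power_mono) auto
    then show "tsq V \<le> Ctr\<^sup>2 * (sqrt (nsq V) * sqrt (gsq V))"
      using normsq_nonneg[of V] gradsq_nonneg[of V] gammasq_nonneg[of V] by (simp add: power_mult_distrib)
    have "(sqrt (tsq V))\<^sup>2 \<le> (Ctr * sqrt (gsq V))\<^sup>2"
      using Ctr that gammasq_nonneg[of V] by (intro power_mono) auto
    then show "tsq V \<le> Ctr\<^sup>2 * gsq V"
      using gradsq_nonneg[of V] gammasq_nonneg[of V] by (simp add: power_mult_distrib)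
  qed
  \<comment> \<open>The pure gradient form of the trace bound yields the Poincare constant; the
    multiplicative form is kept for the second difference.\<close>
  obtain CP where CP: "0 < CP" "\<And>V. V \<in> WW \<Longrightarrow> nsq V \<le> CP * gsq V"
    by (rule poincare_W[OF Ctr2]) (assumption, rule that)
  \<comment> \<open>Young's weight for the forcing: through \<open>CP\<close>, the part falling on
    the new iterate becomes Ca/8 times its squared gradient norm.\<close>
  define cF where "cF = 4 * (1 + g) * CP / Ca"
  define CF where "CF = (1 + g) * cF / 2"
  have cF: "0 < cF" "0 < CF" using params CP(1) Ca by (auto simp: cF_def CF_def)
  define k where "k = 4 * \<Delta>t * Ca"
  have k: "0 < k" using dt(1) Ca by (simp add: k_def)
  define K1 where "K1 = 9 * (1 + g * S) * CP"
  have gS: "0 < 1 + g * S" using params by (simp add: add_pos_pos)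
  have K1: "0 < K1" using gS CP(1) by (simp add: K1_def)
  define \<sigma> where "\<sigma> = min 1 (k / (32 * K1))"
  have \<sigma>: "0 < \<sigma>" using k K1 by (simp add: \<sigma>_def)
  define lam where "lam = 1 / (1 + \<sigma>)"
  have lam: "0 < lam" "lam < 1" using \<sigma> by (auto simp: lam_def)
  \<comment> \<open>9 (1 + g S) bounds the initial energy; 4 Ca comes from k = 4 \<Delta>t Ca in
    front of the initial gradients, whose factor \<Delta>t is part of the data term.\<close>
  define K0 where "K0 = 9 * (1 + g * S) + 4 * Ca"
  have K0: "0 < K0" using gS Ca by (simp add: K0_def add_pos_pos)
  \<comment> \<open>The summands serve n = 0, the initial data and the forcing. The energy numbered
    m controls \<open>U (m + 1)\<close>, so the decay lags one power behind, hence the division by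
    \<open>lam\<close>.\<close>
  define KK where "KK = 1 + CS\<^sup>2 * K0 / lam + CS\<^sup>2 * (4 * \<Delta>t * CF / \<sigma>)"
  have KK: "1 \<le> KK" "CS\<^sup>2 * K0 / lam \<le> KK" "CS\<^sup>2 * (4 * \<Delta>t * CF / \<sigma>) \<le> KK" 
    using K0 lam \<sigma> cF dt(1) by (auto simp: KK_def intro!: add_nonneg_nonneg)
  show ?thesis
  proof (rule exI[of _ lam], rule exI[of _ KK], intro conjI allI impI)
    show "0 < lam" "lam < 1" by (fact lam)+
    show "0 < KK" using KK(1) by simp
    fix U :: "nat \<Rightarrow> 'd wel" and Pr :: "nat \<Rightarrow> real^'d \<Rightarrow> real" and Fs :: "nat \<Rightarrow> 'd wel" and n :: nat
    assume H: "(\<forall>n. U n \<in> WW)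
     \<and> (\<forall>n\<ge>2. forcing_ok \<Omega>f \<Omega>p (Fs n))
     \<and> bdd_above ((\<lambda>n. sqrt (nsq (Fs n))) ` {2..})
     \<and> (\<forall>n\<ge>1. L2 \<Omega>f (Pr (n + 1))
           \<and> (\<forall>V\<in>WW.
                 ips g S
                   (wscale (1 / (2 * \<Delta>t))
                      (wadd (wadd (wscale 3 (U (n + 1))) (wscale (-4) (U n))) (U (n - 1)))) V
               + form_a \<nu> g Kp \<alpha>BJ nf \<Omega>f \<Omega>p (U (n + 1)) V
               + form_b \<Omega>f (fst V) (Pr (n + 1))
               + ast \<gamma>f \<gamma>p (U (n + 1)) V
               = fpr g (Fs (n + 1)) V
               - aGt g \<gamma>f \<gamma>p (wadd (wscale 2 (U n)) (wscale (-1) (U (n - 1)))) V)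
           \<and> (\<forall>q. L2 \<Omega>f q \<longrightarrow> form_b \<Omega>f (fst (U (n + 1))) q = 0))"
    have U: "U m \<in> WW" for m using H by blast
    define Fb where "Fb = (SUP n\<in>{2..}. sqrt (nsq (Fs n)))"
    have Fb: "nsq (Fs m) \<le> Fb\<^sup>2" if "2 \<le> m" for m
    proof -
      have "sqrt (nsq (Fs m)) \<le> Fb"
        unfolding Fb_def using H that by (intro cSUP_upper) auto
      then have "(sqrt (nsq (Fs m)))\<^sup>2 \<le> Fb\<^sup>2" using normsq_nonneg by (intro power_mono) auto
      then show ?thesis using normsq_nonneg by simp
    qed
    define E where "E m = bdf_energy g S (U (m + 1)) (U m)" for m
    define P where "P m = gsq (U m)" for m
    define X where "X = 4 * \<Delta>t * (CF * Fb\<^sup>2)"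
    have step: "E (Suc m) + k * (19/32 * P (m + 2)) \<le> E m + k * (1/16 * P (m + 1) + 1/32 * P m) + X" for m
    proof -
      let ?A = "U (m + 2)" and ?B = "U (m + 1)" and ?C = "U m"
      let ?D = "bdf_diff ?A ?B ?C"
      have D: "?D \<in> WW" by (intro W_wcomb U)
      \<comment> \<open>The scheme is taken at n = m + 1, so that the truncated difference n - 1 is
        m.\<close>
      have Hm: "L2 \<Omega>f (Pr (m + 2)) \<and> (\<forall>V\<in>WW.
                 ips g S (wscale (1 / (2 * \<Delta>t)) (wadd (wadd (wscale 3 ?A) (wscale (-4) ?B)) ?C)) V
               + form_a \<nu> g Kp \<alpha>BJ nf \<Omega>f \<Omega>p ?A V + form_b \<Omega>f (fst V) (Pr (m + 2)) + ast \<gamma>f \<gamma>p ?A V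
               = fpr g (Fs (m + 2)) V - aGt g \<gamma>f \<gamma>p (wadd (wscale 2 ?B) (wscale (-1) ?C)) V)
           \<and> (\<forall>q. L2 \<Omega>f q \<longrightarrow> form_b \<Omega>f (fst ?A) q = 0)"
        using H[THEN conjunct2, THEN conjunct2, THEN conjunct2, THEN spec, of "m + 1"] by (simp add: numeral_2_eq_2)
      have en: "E (Suc m) + ips g S ?D ?D + 4 * \<Delta>t * (Ca * P (m + 2))
        \<le> E m + 4 * \<Delta>t * (fpr g (Fs (m + 2)) ?A + aGt g \<gamma>f \<gamma>p ?D ?A)"
        using energy_step[OF U U U dt(1) _ _ _ Kt bspec[OF Hm[THEN conjunct2, THEN conjunct1] U[of "m + 2"]]] Hm params
        by (simp add: E_def P_def Ca_def numeral_2_eq_2)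
      have fp: "fpr g (Fs (m + 2)) ?A \<le> Ca / 8 * P (m + 2) + CF * Fb\<^sup>2"
      proof -
        have "forcing_ok \<Omega>f \<Omega>p (Fs (m + 2))" using H by simp
        then have "fpr g (Fs (m + 2)) ?A \<le> (1 + g) / 2 * (cF * nsq (Fs (m + 2)) + nsq ?A / cF)"
          using params cF by (intro fpair_le forcing_sqpair W_sqpair U) auto
        also have "\<dots> \<le> (1 + g) / 2 * (cF * Fb\<^sup>2 + CP * P (m + 2) / cF)"
          using params cF Fb[of "m + 2"] CP(2)[OF U[of "m + 2"]]
          by (intro mult_left_mono add_mono divide_right_mono) (auto simp: P_def)
        also have "\<dots> = Ca / 8 * P (m + 2) + CF * Fb\<^sup>2"
        proof -
          have gen: "w / 2 * (c * F + CP * p / (4 * w * CP / Ca)) = Ca / 8 * p + w * c / 2 * F" if "w \<noteq> 0" for w c F p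
            using that CP(1) Ca by (simp add: field_simps)
          show ?thesis unfolding CF_def by (subst (2) cF_def, rule gen) (use params in simp)
        qed
        finally show ?thesis .
      qed
      have "aGt g \<gamma>f \<gamma>p ?D ?A \<le> M * (4 * M * Ctr\<^sup>2 / Ca * tsq ?D + tsq ?A / (4 * M * Ctr\<^sup>2 / Ca))"
        using params M Ca nz by (intro form_aGt_le D U) auto
      then have ga: "4 * \<Delta>t * aGt g \<gamma>f \<gamma>p ?D ?A
         \<le> \<Delta>t * Ca * P (m + 2) + nsq ?D / CS\<^sup>2 + 4 * \<Delta>t * Ca * (gsq ?D / 134)"
        unfolding P_def
        by (intro interface_term_absorbed[OF Ca M(4) nz(2,1) dt(1) dt' normsq_nonneg gradsq_nonneg gammasq_nonneg Ctr1[OF D] Ctr2[OF U]])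
      have d: "nsq ?D / CS\<^sup>2 \<le> ips g S ?D ?D"
        using CSsq[OF D] nz by (simp add: pos_divide_le_eq mult.commute)
      have "4 * \<Delta>t * Ca * (gsq ?D / 134) \<le> k * ((4 * (P (m + 2) + 2 * P (m + 1) + P m)) / 134)"
        unfolding k_def P_def using gradsq_bdf_diff_le[OF U[of "m + 2"] U[of "m + 1"] U[of m]] k
        by (intro mult_left_mono divide_right_mono) (auto simp: k_def)
      \<comment> \<open>This uses 4/134 < 1/32.\<close>
      also have "\<dots> \<le> k * (1/32 * (P (m + 2) + 2 * P (m + 1) + P m))"
        using k gradsq_nonneg by (intro mult_left_mono) (auto simp: P_def intro!: add_nonneg_nonneg)
      finally have gr: "4 * \<Delta>t * Ca * (gsq ?D / 134) \<le> k * (1/32 * (P (m + 2) + 2 * P (m + 1) + P m))" .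
      have "4 * \<Delta>t * fpr g (Fs (m + 2)) ?A \<le> 4 * \<Delta>t * (Ca / 8 * P (m + 2) + CF * Fb\<^sup>2)"
        using dt(1) by (intro mult_left_mono fp) auto
      \<comment> \<open>In order: the shares of the forcing, the interface term and the gradients of
        the second difference. Moving them to the left leaves the 19/32 that
        \<open>decay_of_recursion\<close> expects.\<close>
      then have "E (Suc m) + k * P (m + 2) \<le> E m + (k * (1/8 * P (m + 2)) + X) + k * (1/4 * P (m + 2))
          + k * (1/32 * (P (m + 2) + 2 * P (m + 1) + P m))"
        using en ga d gr by (simp add: k_def X_def algebra_simps)
      then show ?thesis by (simp add: algebra_simps)
    qed
    have En: "ips g S (U (m + 1)) (U (m + 1)) \<le> E m" for m
      unfolding E_def using params by (intro ips_le_bdf_energy) auto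
    have E0: "0 \<le> E m" for m
      using En[of m] ipS_bounds(1)[of g S "U (m + 1)"] params by simp
    have Ele: "E m \<le> 9 * (1 + g * S) * (nsq (U (m + 1)) + nsq (U m))" for m
      unfolding E_def using params by (intro bdf_energy_le W_sqpair U) auto
    have EP: "E m \<le> K1 * (P (m + 1) + P m)" for m
    proof -
      have "E m \<le> 9 * (1 + g * S) * (CP * P (m + 1) + CP * P m)"
        unfolding P_def using gS by (intro order_trans[OF Ele] mult_left_mono add_mono CP(2) U) auto
      then show ?thesis by (simp add: K1_def algebra_simps)
    qed
    define D0 where "D0 = nsq (U 0) + nsq (U 1) + \<Delta>t * gsq (U 0) + \<Delta>t * gsq (U 1)"
    have D0: "nsq (U 0) \<le> D0" "0 \<le> D0"
      using normsq_nonneg[of "U 0"] normsq_nonneg[of "U 1"] gradsq_nonneg[of "U 0"] gradsq_nonneg[of "U 1"] dt(1)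
      by (auto simp: D0_def intro!: add_nonneg_nonneg)
    have init: "E 0 + k * (P 1 + P 0) \<le> K0 * D0"
    proof -
      have "k * (P 1 + P 0) = 4 * Ca * (\<Delta>t * gsq (U 0) + \<Delta>t * gsq (U 1))"
        by (simp add: k_def P_def algebra_simps)
      also have "\<dots> \<le> 4 * Ca * D0"
        using Ca normsq_nonneg[of "U 0"] normsq_nonneg[of "U 1"] by (intro mult_left_mono) (auto simp: D0_def)
      finally have 1: "k * (P 1 + P 0) \<le> 4 * Ca * D0" .
      have "E 0 \<le> 9 * (1 + g * S) * (nsq (U 1) + nsq (U 0))" using Ele[of 0] by simp
      also have "\<dots> \<le> 9 * (1 + g * S) * D0"
        using gS gradsq_nonneg[of "U 0"] gradsq_nonneg[of "U 1"] dt(1) by (intro mult_left_mono) (auto simp: D0_def)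
      finally show ?thesis using 1 by (simp add: K0_def algebra_simps)
    qed
    show "nsq (U n) \<le> KK * (lam ^ n * (nsq (U 0) + nsq (U 1)
         + \<Delta>t * gsq (U 0) + \<Delta>t * gsq (U 1)) + (SUP n\<in>{2..}. sqrt (nsq (Fs n)))\<^sup>2)"
      unfolding D0_def[symmetric] Fb_def[symmetric]
    proof (cases n)
      \<comment> \<open>The energies control the iterates from \<open>U 1\<close> on;
        \<open>U 0\<close> is part of the data.\<close>
      case 0
      have "nsq (U n) \<le> 1 * (lam ^ n * D0 + Fb\<^sup>2)" using D0(1) 0 by (simp add: add_increasing2)
      also have "\<dots> \<le> KK * (lam ^ n * D0 + Fb\<^sup>2)" using KK(1) D0(2) lam by (intro mult_right_mono) auto
      finally show "nsq (U n) \<le> KK * (lam ^ n * D0 + Fb\<^sup>2)" .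
    next
      case (Suc m)
      have "E m \<le> lam ^ m * (E 0 + k * (P 1 + P 0)) + X / \<sigma>"
        unfolding lam_def using dt(1) cF
        by (intro decay_of_recursion[OF k K1 _ E0 _ step EP \<sigma>_def]) (auto simp: P_def X_def gradsq_nonneg)
      also have "\<dots> \<le> lam ^ m * (K0 * D0) + X / \<sigma>"
        using lam by (intro add_right_mono mult_left_mono init) auto
      finally have Em: "E m \<le> lam ^ m * (K0 * D0) + X / \<sigma>" .
      have "nsq (U n) \<le> CS\<^sup>2 * E m"
        using CSsq[OF U[of n]] mult_left_mono[OF En[of m], of "CS\<^sup>2"] Suc by simp
      also have "\<dots> \<le> CS\<^sup>2 * (lam ^ m * (K0 * D0) + X / \<sigma>)" by (intro mult_left_mono Em) auto
      also have "\<dots> = (CS\<^sup>2 * K0 / lam) * (lam ^ n * D0) + (CS\<^sup>2 * (4 * \<Delta>t * CF / \<sigma>)) * Fb\<^sup>2"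
        using lam Suc by (simp add: X_def field_simps)
      also have "\<dots> \<le> KK * (lam ^ n * D0) + KK * Fb\<^sup>2"
        using lam D0(2) by (intro add_mono mult_right_mono KK(2,3)) auto
      finally show "nsq (U n) \<le> KK * (lam ^ n * D0 + Fb\<^sup>2)" by (simp add: distrib_left)
    qed
  qed
qed

end
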